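(* Let $\preceq$ be a pair ordering on an arc diagram $\mathcal{Z}$, and let $X_n:\mathcal{H}^{\otimes n}\to\mathcal{H}$ and $f_n:\mathcal{H}^{\otimes n}\to\mathcal{A}$ be the $A_\infty$ structure on $\mathcal{H}=H(\mathcal{A}(\mathcal{Z}))$ and the $A_\infty$ morphism $\mathcal{H}\to\mathcal{A}=\mathcal{A}(\mathcal{Z})$ arising from $\preceq$. Let $M=M_1\otimes\cdots\otimes M_n\in\mathcal{H}^{\otimes n}$ be a tensor product of nonzero homology classes of strand diagrams. (1) Suppose $n\ge 2$. If $\overline{f}_n(M)\ne0$, then $M$ has $l$ twisted and $m$ critical matched pairs, where $l+m\ge n-1$ and $m\le n-2$, and all other matched pairs are tight. In this case $\overline{f}_n(M)$ is (represented by) a sum of diagrams, where each diagram $D$ is tight at all matched pairs where $M$ is critical or tight, and has $n-1-m$ crossed and $l+m-n+1$ twisted matched pairs. (2) If $X_n(M)\neq0$, then $M$ has precisely $n-2$ critical matched pairs, and all other matched pairs are tight. In this case $X_n(M)$ is the unique homology class of a tight diagram with the H-data of $M$.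
   Context: All algebra is over $\mathbb{Z}_2$. An arc diagram $\mathcal{Z}=(\mathbf{Z},\mathbf{a},r)$ consists of oriented intervals $\mathbf{Z}=\{Z_1,\dots,Z_l\}$, distinct points $\mathbf{a}=(a_1,\dots,a_{2k})$ (places) in the interiors of the intervals, ordered along them, and a 2-to-1 map $r:\mathbf{a}\to\{1,\dots,k\}$ such that oriented surgery on $\mathbf{Z}$ at all $0$-spheres $r^{-1}(i)$ yields a 1-manifold with no circle components. The fibres $P=\{p,q\}$ of $r$ are the matched pairs, identified with $1,\dots,k$. Let $-\infty_i,+\infty_i$ be the start and end of $Z_i$ and $\mathbf{a}_{\pm\infty}=\mathbf{a}\cup\{\pm\infty_i\}$, partially ordered along the intervals; the places cut the intervals into steps. A strand diagram is a triple $(S,T,\phi)$ with $S,T\subseteq\mathbf{a}_{\pm\infty}$ and $\phi:S\to T$ a bijection with $\phi(x)\ge x$; it is drawn as strands in $[0,1]\times\mathbf{Z}$ from $\{0\}\times S$ to $\{1\}\times T$, meeting efficiently; crossings are inversions ($x<y$ with $\phi(x)>\phi(y)$), counted by $\mathrm{inv}$. The product of $(S,T,\phi)$ and $(U,V,\psi)$ is $(S,V,\psi\phi)$ if $T=U$ and $\mathrm{inv}(\psi\phi)=\mathrm{inv}(\phi)+\mathrm{inv}(\psi)$, and $0$ otherwise; $\partial$ is the sum of all resolutions of one crossing which lower the number of crossings by exactly $1$. $I(S)$ is the identity diagram on $S$. For a set $s$ of matched pairs let $I(s)=\sum_S I(S)$, over all $S\subseteq \mathbf{a}_{\pm\infty}$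 consisting of exactly one place of each pair in $s$, no other places, and any subset of $\{\pm\infty_i\}$. For $\mu=(S,T,\phi)$ without horizontal strands (fixed points) let $a(\mu)=\sum_U(S\cup U,T\cup U,\phi_U)$ over $U\subseteq\mathbf{a}_{\pm\infty}\setminus(S\cup T)$, $\phi_U$ extending $\phi$ by the identity. A diagram from $s$ to $t$ is a nonzero element $I(s)a(\mu)I(t)$; it is drawn as one picture with dotted horizontal strands at both places $p,q$ of every matched pair carrying a horizontal strand. The (augmented) strand algebra $\mathcal{A}=\mathcal{A}(\mathcal{Z})$ is the DGA with basis the diagrams; $\mathcal{H}=H(\mathcal{A})$, a DGA with zero differential. H-data is a triple $(h,s,t)$ with $h\in H_1(\mathbf{Z},\mathbf{a}_{\pm\infty})$ and $s,t$ sets of matched pairs. A diagram from $s$ to $t$ has H-data $(h,s,t)$, $h=\sum_x[x,\phi(x)]$; $\mathcal{A}(h,s,t)$ is the span of diagrams with this H-data and $\mathcal{H}(h,s,t)$ its homology, so $\mathcal{A}=\bigoplus\mathcal{A}(h,s,t)$, $\mathcal{H}=\bigoplus\mathcal{H}(h,s,t)$. The Maslov grading is $\iota(D)=\mathrm{inv}(\mu)-m(h,S)$ for any term $\mu=(S,T,\phi)$ of $D$, where $m(h,S)$ is the sum over places $a\in S\cap\mathbf{a}$ of the average multiplicity of $h$ on the two steps at $a$ (and $m$ is extended linearly to $0$-chains, ignoring $\pm\infty_i$). $h$ (and any H-data or diagram with H-grading $h$) is viable if $h$ has multiplicity $0$ or $1$ on every step. In a viable diagram every crossing involves a horizontal strand,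 hence lies at a matched pair. Cutting the intervals between consecutive places gives, for each matched pair $P=\{p,q\}$, the fragment $\mathcal{Z}_P$ (two intervals with one place each); cutting a viable diagram $D$ accordingly gives local diagrams $D_P\in\mathcal{A}(\mathcal{Z}_P)$. A viable diagram is tight if it has no crossings and is nonzero in homology, twisted if it has no crossings and is zero in homology, crossed if it has crossings; it has such a property at $P$ if $D_P$ does. Viable H-data is tight (resp. twisted) if some tight (resp. twisted) diagram has that H-data, and singular otherwise. Each $\mathcal{H}(h,s,t)$ is $0$ or $\mathbb{Z}_2$, nonzero exactly for tight $(h,s,t)$, with generator represented by any tight diagram with H-data $(h,s,t)$. A pair $P$ is 11 if $P\in s$ and $P\in t$; it is once occupied at $p$ by $h$ if $h$ covers both steps at $p$ and neither step at the twin $q$; doubly occupied if $h$ covers all four steps at $p,q$. $\mathcal{F}\subset\mathcal{A}$ is the two-sided ideal spanned by diagrams that are non-viable or have a crossing at some doubly occupied pair. $\overline{f}$ denotes the composition of a map $f$ into $\mathcal{A}$ with $\mathcal{A}\to\overline{\mathcal{A}}=\mathcal{A}/\mathcal{F}$. For classes $M_i$ with H-data $(h_i,s_i,t_i)$, $M=M_1\otimes\cdots\otimes M_n$ has an idempotent mismatch if some $t_i\neq s_{i+1}$; $M$ is viable if it has no mismatch and $\sum h_i$ is viable. Its H-data is $(h,s,t)=(\sum h_i,s_1,t_n)$ and its Maslov grading is $\sum\iota(M_i)+\sum_{j<k}m(h_k,\partial h_j)$. A map preserves H-data if it sends such $M$ into the $(\sum h_i,s_1,t_n)$ summand. Tightness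 of a viable tensor product $M$ of nonzero classes: let $D_i$ be (tight) diagrams representing $M_i$; $M$ is tight if $D_1\cdots D_n$ is nonzero and tight; twisted if $D_1\cdots D_n$ is nonzero and twisted; critical if $D_1\cdots D_n=0$ but $\mathcal{A}(h,s,t)\ne0$; singular if $\mathcal{A}(h,s,t)=0$. Exactly one holds, independently of the choice of $D_i$. A matched pair $P$ is tight, twisted, critical or singular in $M$ if the local tensor product $M_P=(M_1)_P\otimes\cdots\otimes(M_n)_P$ is so on $\mathcal{Z}_P$, where $(M_i)_P$ is the homology class of $(D_i)_P$. When the theorem says that $M$ has twisted, critical or tight pairs, it includes the assertion that $M$ is viable. A pair ordering $\preceq$ is a total order on the set of matched pairs together with a total order on the two places of each matched pair. $f^{\preceq}:\mathcal{H}\to\mathcal{A}$ is the linear map sending, for each tight $(h,s,t)$, the generator of $\mathcal{H}(h,s,t)$ to the unique tight diagram with H-data $(h,s,t)$ in which, at each 11 doubly occupied pair, strands begin and end at the $\preceq$-smaller place of the pair. The operator $A^*_{\preceq}$ on $\bigoplus_{(h,s,t)\text{ twisted}}\mathcal{A}(h,s,t)$ is defined on diagrams $D\in\mathcal{A}(h,s,t)$ as follows: let $P=\{p,q\}$ be the $\preceq$-smallest 11 once occupied pair, $p$ its occupied place (a twisted $(h,s,t)$ has such a pair). If $D$ has a crossing at $P$, $A^*_{\preceq}D=0$. Otherwise one strand of $D$ ends at $p$ and another begins at $p$; $A^*_{\preceq}D$ is obtained by joining these into a single strand running past $p$ and adding dotted horizontal strands at $p$ and $q$. The $A_\infty$ structure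 $X$ on $\mathcal{H}$ and $A_\infty$ morphism $f:\mathcal{H}\to\mathcal{A}$ ($\mathcal{A}$ having trivial $n$-ary operations for $n\ge3$) arising from $\preceq$ have $X_1=0$, $X_2$ multiplication, $f_1=f^{\preceq}$, and satisfy, for all tensor products $M$ of nonzero homology classes of diagrams: (a) if $M$ is not viable then $\overline{f}_n(M)=0$, $X_n(M)=0$, and if $M$ has an idempotent mismatch then $f_n(M)=0$; (b) $X_n,f_n$ preserve H-data and have Maslov degrees $n-2,n-1$; (c) for $n\ge2$, if $(f_1X_n-U_n)(M)=0$ then $f_n(M)=0$; (d) for $n\ge2$ and $M$ viable with twisted H-data, $f_n(M)=A^*_{\preceq}((f_1X_n-U_n)(M))$. Here $U_n(a_1\otimes\cdots\otimes a_n)=\sum_{j=1}^{n-1}f_j(a_1\otimes\cdots\otimes a_j)f_{n-j}(a_{j+1}\otimes\cdots\otimes a_n)+\sum_{2\le j\le n-1,\,0\le k\le n-j}f_{n-j+1}(a_1\otimes\cdots\otimes a_k\otimes X_j(a_{k+1}\otimes\cdots\otimes a_{k+j})\otimes\cdots\otimes a_n)$, $X_n=[U_n]$, and the morphism relations amount to $\partial f_n=f_1X_n-U_n$. Such $X$, $f$ exist, and the $X_n$ and $\overline{f}_n$ are uniquely determined by $\preceq$. *)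

theory Defs
  imports Complex_Main "HOL-Library.Poly_Mapping" "HOL-Library.Z2" "HOL-Library.Set_Algebras"
begin

section \<open>Arc diagrams\<close>

text \<open>
  Points of the oriented intervals are pairs of an interval \<open>i\<close> and a position.  If \<open>i\<close> carries
  \<open>n\<close> places, then position \<open>0\<close> is the start (minus infinity), positions \<open>1, \<dots>, n\<close> are the places
  and position \<open>n + 1\<close> is the end (plus infinity).  A step is named by the point at which it starts.
\<close>

type_synonym 'i pt = "'i \<times> nat"

text \<open>
  Matched pairs are named by their label, the value of \<open>lab\<close> on both places; labels need not be
  consecutive, so that a fragment \<open>\<Z>\<^sub>P\<close> can keep the label \<open>P\<close>.
\<close>

record 'i arc_diagram =
  ivs :: "'i set"
  npl :: "'i \<Rightarrow> nat"
  lab :: "'i pt \<Rightarrow> nat"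

definition points :: "'i arc_diagram \<Rightarrow> 'i pt set" where
  "points Z = {(i, j). i \<in> ivs Z \<and> j \<le> npl Z i + 1}"

definition places :: "'i arc_diagram \<Rightarrow> 'i pt set" where
  "places Z = {(i, j). i \<in> ivs Z \<and> 1 \<le> j \<and> j \<le> npl Z i}"

definition steps :: "'i arc_diagram \<Rightarrow> 'i pt set" where
  "steps Z = {(i, j). i \<in> ivs Z \<and> j \<le> npl Z i}"

definition pt_le :: "'i pt \<Rightarrow> 'i pt \<Rightarrow> bool" where
  "pt_le x y \<longleftrightarrow> fst x = fst y \<and> snd x \<le> snd y"

definition pt_less :: "'i pt \<Rightarrow> 'i pt \<Rightarrow> bool" where
  "pt_less x y \<longleftrightarrow> fst x = fst y \<and> snd x < snd y"

definition step_to :: "'i pt \<Rightarrow> 'i pt" where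
  "step_to p = (fst p, snd p - 1)"

definition pairs :: "'i arc_diagram \<Rightarrow> nat set" where
  "pairs Z = lab Z ` places Z"

definition fibre :: "'i arc_diagram \<Rightarrow> nat \<Rightarrow> 'i pt set" where
  "fibre Z P = {p \<in> places Z. lab Z p = P}"

definition twin :: "'i arc_diagram \<Rightarrow> 'i pt \<Rightarrow> 'i pt" where
  "twin Z p = (THE q. q \<in> fibre Z (lab Z p) \<and> q \<noteq> p)"

text \<open>
  After oriented surgery at all matched pairs, the step ending at a place \<open>p\<close> is followed by the
  step starting at the twin of \<open>p\<close>.  The surgered manifold has a circle component iff
  this successor relation has a cycle.
\<close>

definition surgery_succ :: "'i arc_diagram \<Rightarrow> 'i pt rel" where
  "surgery_succ Z = {(step_to p, twin Z p) | p. p \<in> places Z}"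

definition arc_diagram :: "'i arc_diagram \<Rightarrow> bool" where
  "arc_diagram Z \<longleftrightarrow> finite (ivs Z) \<and> (\<forall>P \<in> pairs Z. card (fibre Z P) = 2) \<and>
     acyclic (surgery_succ Z)"

section \<open>Strand diagrams\<close>

text \<open>
  The strand diagram \<open>(S, T, \<phi>)\<close> is encoded by the graph of \<open>\<phi>\<close>, so that \<open>S\<close> is its domain and
  \<open>T\<close> its range.
\<close>

type_synonym 'i sd = "'i pt rel"

definition strand_diagram :: "'i arc_diagram \<Rightarrow> 'i sd \<Rightarrow> bool" where
  "strand_diagram Z \<mu> \<longleftrightarrow> \<mu> \<subseteq> points Z \<times> points Z \<and> inj_on fst \<mu> \<and> inj_on snd \<mu> \<and>
     (\<forall>(x, y) \<in> \<mu>. pt_le x y)"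

definition crossings :: "'i sd \<Rightarrow> (('i pt \<times> 'i pt) \<times> ('i pt \<times> 'i pt)) set" where
  "crossings \<mu> = {((x, x'), (y, y')). (x, x') \<in> \<mu> \<and> (y, y') \<in> \<mu> \<and> pt_less x y \<and> pt_less y' x'}"

definition inv_count :: "'i sd \<Rightarrow> nat" where
  "inv_count \<mu> = card (crossings \<mu>)"

definition resolve :: "'i sd \<Rightarrow> ('i pt \<times> 'i pt) \<times> ('i pt \<times> 'i pt) \<Rightarrow> 'i sd" where
  "resolve \<mu> c = (case c of ((x, x'), (y, y')) \<Rightarrow> (\<mu> - {(x, x'), (y, y')}) \<union> {(x, y'), (y, x')})"

text \<open>
  The vector space over the field with two elements spanned by strand diagrams; all coefficients
  in the support \<open>terms a\<close> of an element \<open>a\<close> are \<open>1\<close>.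
\<close>

type_synonym 'i elt = "'i sd \<Rightarrow>\<^sub>0 bit"

abbreviation terms :: "'i elt \<Rightarrow> 'i sd set" where
  "terms \<equiv> Poly_Mapping.keys"

abbreviation sd_of :: "'i sd \<Rightarrow> 'i elt" where
  "sd_of \<mu> \<equiv> Poly_Mapping.single \<mu> 1"

definition sd_mult :: "'i sd \<Rightarrow> 'i sd \<Rightarrow> 'i elt" where
  "sd_mult \<mu> \<nu> = (if Range \<mu> = Domain \<nu> \<and> inv_count (\<mu> O \<nu>) = inv_count \<mu> + inv_count \<nu>
     then sd_of (\<mu> O \<nu>) else 0)"

definition alg_mult :: "'i elt \<Rightarrow> 'i elt \<Rightarrow> 'i elt"  (infixl \<open>\<odot>\<close> 70) where
  "a \<odot> b = (\<Sum>\<mu> \<in> terms a. \<Sum>\<nu> \<in> terms b. sd_mult \<mu> \<nu>)"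

definition sd_diff :: "'i sd \<Rightarrow> 'i elt" where
  "sd_diff \<mu> = (\<Sum>c | c \<in> crossings \<mu> \<and> inv_count (resolve \<mu> c) + 1 = inv_count \<mu>.
     sd_of (resolve \<mu> c))"

definition diff :: "'i elt \<Rightarrow> 'i elt"  (\<open>\<partial>\<close>) where
  "\<partial> a = (\<Sum>\<mu> \<in> terms a. sd_diff \<mu>)"

section \<open>The strand algebra\<close>

definition idem :: "'i arc_diagram \<Rightarrow> nat set \<Rightarrow> 'i elt" where
  "idem Z s = (\<Sum>S | S \<subseteq> points Z \<and> inj_on (lab Z) (S \<inter> places Z) \<and> lab Z ` (S \<inter> places Z) = s.
     sd_of (Id_on S))"

definition add_horizontal :: "'i arc_diagram \<Rightarrow> 'i sd \<Rightarrow> 'i elt" where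
  "add_horizontal Z \<mu> = (\<Sum>U \<in> Pow (points Z - (Domain \<mu> \<union> Range \<mu>)). sd_of (\<mu> \<union> Id_on U))"

definition diag :: "'i arc_diagram \<Rightarrow> nat set \<Rightarrow> nat set \<Rightarrow> 'i sd \<Rightarrow> 'i elt" where
  "diag Z s t \<mu> = idem Z s \<odot> add_horizontal Z \<mu> \<odot> idem Z t"

definition diagrams :: "'i arc_diagram \<Rightarrow> 'i elt set" where
  "diagrams Z = {diag Z s t \<mu> | s t \<mu>. s \<subseteq> pairs Z \<and> t \<subseteq> pairs Z \<and>
     strand_diagram Z \<mu> \<and> (\<forall>(x, y) \<in> \<mu>. x \<noteq> y) \<and> diag Z s t \<mu> \<noteq> 0}"

definition lin_span :: "'i elt set \<Rightarrow> 'i elt set" where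
  "lin_span B = {\<Sum>D \<in> F. D | F. finite F \<and> F \<subseteq> B}"

definition strand_algebra :: "'i arc_diagram \<Rightarrow> 'i elt set" where
  "strand_algebra Z = lin_span (diagrams Z)"

text \<open>
  The quotient of an additive group by a subgroup \<open>N\<close> is formed by cosets.  Sums of cosets are
  the elementwise sums of \<^theory>\<open>HOL-Library.Set_Algebras\<close>.
\<close>

definition coset_of :: "'a::ab_group_add set \<Rightarrow> 'a \<Rightarrow> 'a set" where
  "coset_of N a = (\<lambda>b. a + b) ` N"

definition boundaries :: "'i arc_diagram \<Rightarrow> 'i elt set" where
  "boundaries Z = \<partial> ` strand_algebra Z"

definition cycles :: "'i arc_diagram \<Rightarrow> 'i elt set" where
  "cycles Z = {a \<in> strand_algebra Z. \<partial> a = 0}"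

definition hclass :: "'i arc_diagram \<Rightarrow> 'i elt \<Rightarrow> 'i elt set" where
  "hclass Z = coset_of (boundaries Z)"

definition homology :: "'i arc_diagram \<Rightarrow> 'i elt set set" where
  "homology Z = hclass Z ` cycles Z"

section \<open>Gradings\<close>

text \<open>
  An element of the relative first homology group is its multiplicity function on steps.
\<close>

type_synonym 'i hgr = "'i pt \<Rightarrow> int"
type_synonym 'i hdata = "'i hgr \<times> nat set \<times> nat set"

definition sd_hgr :: "'i sd \<Rightarrow> 'i hgr" where
  "sd_hgr \<mu> e = int (card {(x, y). (x, y) \<in> \<mu> \<and> pt_le x e \<and> pt_less e y})"

text \<open>
  All terms of a diagram have the same non-horizontal strands, and place sets on the left (right)
  with the same labels, so the following do not depend on the chosen term.
\<close>

definition some_term :: "'i elt \<Rightarrow> 'i sd" where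
  "some_term D = (SOME \<mu>. \<mu> \<in> terms D)"

definition moving :: "'i elt \<Rightarrow> 'i sd" where
  "moving D = some_term D - Id"

definition src :: "'i arc_diagram \<Rightarrow> 'i elt \<Rightarrow> nat set" where
  "src Z D = lab Z ` (Domain (some_term D) \<inter> places Z)"

definition tgt :: "'i arc_diagram \<Rightarrow> 'i elt \<Rightarrow> nat set" where
  "tgt Z D = lab Z ` (Range (some_term D) \<inter> places Z)"

definition hgrading :: "'i elt \<Rightarrow> 'i hgr" where
  "hgrading D = sd_hgr (moving D)"

definition hdata_of :: "'i arc_diagram \<Rightarrow> 'i elt \<Rightarrow> 'i hdata" where
  "hdata_of Z D = (hgrading D, src Z D, tgt Z D)"

definition alg_summand :: "'i arc_diagram \<Rightarrow> 'i hdata \<Rightarrow> 'i elt set" where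
  "alg_summand Z d = lin_span {D \<in> diagrams Z. hdata_of Z D = d}"

text \<open>The 0-chain \<open>c\<close> is given by its coefficients; those at the ends of the intervals are ignored.\<close>

definition avg_mult :: "'i arc_diagram \<Rightarrow> 'i hgr \<Rightarrow> ('i pt \<Rightarrow> int) \<Rightarrow> rat" where
  "avg_mult Z h c = (\<Sum>p \<in> places Z. of_int (c p) * (of_int (h (step_to p)) + of_int (h p)) / 2)"

definition chain_bd :: "'i hgr \<Rightarrow> 'i pt \<Rightarrow> int" where
  "chain_bd h p = h (step_to p) - h p"

definition sd_maslov :: "'i arc_diagram \<Rightarrow> 'i sd \<Rightarrow> rat" where
  "sd_maslov Z \<mu> = of_nat (inv_count \<mu>) - avg_mult Z (sd_hgr \<mu>) (\<lambda>p. if p \<in> Domain \<mu> then 1 else 0)"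

definition maslov :: "'i arc_diagram \<Rightarrow> 'i elt \<Rightarrow> rat" where
  "maslov Z D = sd_maslov Z (some_term D)"

definition homogeneous :: "'i arc_diagram \<Rightarrow> rat \<Rightarrow> 'i elt \<Rightarrow> bool" where
  "homogeneous Z d a \<longleftrightarrow> (\<forall>\<mu> \<in> terms a. sd_maslov Z \<mu> = d)"

section \<open>Viability and tightness of diagrams\<close>

definition viable_hgr :: "'i arc_diagram \<Rightarrow> 'i hgr \<Rightarrow> bool" where
  "viable_hgr Z h \<longleftrightarrow> (\<forall>e \<in> steps Z. h e = 0 \<or> h e = 1)"

definition viable_diag :: "'i arc_diagram \<Rightarrow> 'i elt \<Rightarrow> bool" where
  "viable_diag Z D \<longleftrightarrow> D \<in> diagrams Z \<and> viable_hgr Z (hgrading D)"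

text \<open>
  The picture of a diagram shows the horizontal strands at both places of a pair, whereas each term
  has only one of them: a crossing of the picture is a crossing of some term.
\<close>

definition has_crossing :: "'i elt \<Rightarrow> bool" where
  "has_crossing D \<longleftrightarrow> (\<exists>\<mu> \<in> terms D. crossings \<mu> \<noteq> {})"

definition tight_diag :: "'i arc_diagram \<Rightarrow> 'i elt \<Rightarrow> bool" where
  "tight_diag Z D \<longleftrightarrow> viable_diag Z D \<and> \<not> has_crossing D \<and> hclass Z D \<noteq> hclass Z 0"

definition twisted_diag :: "'i arc_diagram \<Rightarrow> 'i elt \<Rightarrow> bool" where
  "twisted_diag Z D \<longleftrightarrow> viable_diag Z D \<and> \<not> has_crossing D \<and> hclass Z D = hclass Z 0"

definition crossed_diag :: "'i arc_diagram \<Rightarrow> 'i elt \<Rightarrow> bool" where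
  "crossed_diag Z D \<longleftrightarrow> viable_diag Z D \<and> has_crossing D"

definition twisted_hdata :: "'i arc_diagram \<Rightarrow> 'i hdata \<Rightarrow> bool" where
  "twisted_hdata Z d \<longleftrightarrow> (\<exists>D. twisted_diag Z D \<and> hdata_of Z D = d)"

text \<open>
  The intervals of the fragment at \<open>P\<close> are indexed by the two places of \<open>P\<close>; the fragment around
  \<open>p\<close> has the points \<open>(p, 0)\<close>, \<open>(p, 1)\<close> (the place \<open>p\<close> itself) and \<open>(p, 2)\<close>.
\<close>

definition fragment :: "'i arc_diagram \<Rightarrow> nat \<Rightarrow> 'i pt arc_diagram" where
  "fragment Z P = \<lparr>ivs = fibre Z P, npl = (\<lambda>_. 1), lab = (\<lambda>_. P)\<rparr>"

definition clamp_pt :: "'i pt \<Rightarrow> 'i pt \<Rightarrow> 'i pt pt" where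
  "clamp_pt p x = (p, if snd x < snd p then 0 else if snd x = snd p then 1 else 2)"

definition cut_strands :: "'i arc_diagram \<Rightarrow> nat \<Rightarrow> 'i sd \<Rightarrow> 'i pt sd" where
  "cut_strands Z P \<mu> = {(clamp_pt p x, clamp_pt p y) | p x y.
     p \<in> fibre Z P \<and> (x, y) \<in> \<mu> \<and> fst x = fst p \<and> clamp_pt p x \<noteq> clamp_pt p y}"

definition local_diag :: "'i arc_diagram \<Rightarrow> nat \<Rightarrow> 'i elt \<Rightarrow> 'i pt elt" where
  "local_diag Z P D =
     diag (fragment Z P) (src Z D \<inter> {P}) (tgt Z D \<inter> {P}) (cut_strands Z P (moving D))"

definition tight_at :: "'i arc_diagram \<Rightarrow> nat \<Rightarrow> 'i elt \<Rightarrow> bool" where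
  "tight_at Z P D \<longleftrightarrow> viable_diag Z D \<and> tight_diag (fragment Z P) (local_diag Z P D)"

definition twisted_at :: "'i arc_diagram \<Rightarrow> nat \<Rightarrow> 'i elt \<Rightarrow> bool" where
  "twisted_at Z P D \<longleftrightarrow> viable_diag Z D \<and> twisted_diag (fragment Z P) (local_diag Z P D)"

definition crossed_at :: "'i arc_diagram \<Rightarrow> nat \<Rightarrow> 'i elt \<Rightarrow> bool" where
  "crossed_at Z P D \<longleftrightarrow> viable_diag Z D \<and> crossed_diag (fragment Z P) (local_diag Z P D)"

definition full_at :: "'i hgr \<Rightarrow> 'i pt \<Rightarrow> bool" where
  "full_at h p \<longleftrightarrow> h (step_to p) = 1 \<and> h p = 1"

definition once_occupied_at :: "'i arc_diagram \<Rightarrow> 'i hgr \<Rightarrow> 'i pt \<Rightarrow> bool" where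
  "once_occupied_at Z h p \<longleftrightarrow>
     p \<in> places Z \<and> full_at h p \<and> h (step_to (twin Z p)) = 0 \<and> h (twin Z p) = 0"

definition doubly_occupied :: "'i arc_diagram \<Rightarrow> 'i hgr \<Rightarrow> nat \<Rightarrow> bool" where
  "doubly_occupied Z h P \<longleftrightarrow> (\<forall>p \<in> fibre Z P. full_at h p)"

definition ideal_F :: "'i arc_diagram \<Rightarrow> 'i elt set" where
  "ideal_F Z = lin_span {D \<in> diagrams Z. \<not> viable_diag Z D \<or>
     (\<exists>P \<in> pairs Z. doubly_occupied Z (hgrading D) P \<and> crossed_at Z P D)}"

definition bar :: "'i arc_diagram \<Rightarrow> 'i elt \<Rightarrow> 'i elt set" where
  "bar Z = coset_of (ideal_F Z)"

section \<open>Tensor products of homology classes of diagrams\<close>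

text \<open>
  A pure tensor is the list of its factors.  H-data, Maslov grading and tightness do not depend on
  the representing diagrams.
\<close>

definition diag_classes :: "'i arc_diagram \<Rightarrow> 'i elt set set" where
  "diag_classes Z = {hclass Z D | D. D \<in> diagrams Z \<and> \<partial> D = 0} - {hclass Z 0}"

definition rep :: "'i arc_diagram \<Rightarrow> 'i elt set \<Rightarrow> 'i elt" where
  "rep Z C = (SOME D. D \<in> diagrams Z \<and> \<partial> D = 0 \<and> hclass Z D = C)"

definition tensor_hgr :: "'i arc_diagram \<Rightarrow> 'i elt set list \<Rightarrow> 'i hgr" where
  "tensor_hgr Z M e = (\<Sum>C \<leftarrow> M. hgrading (rep Z C) e)"

definition tensor_hdata :: "'i arc_diagram \<Rightarrow> 'i elt set list \<Rightarrow> 'i hdata" where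
  "tensor_hdata Z M = (tensor_hgr Z M, src Z (rep Z (hd M)), tgt Z (rep Z (last M)))"

definition mismatch :: "'i arc_diagram \<Rightarrow> 'i elt set list \<Rightarrow> bool" where
  "mismatch Z M \<longleftrightarrow>
     (\<exists>i. Suc i < length M \<and> tgt Z (rep Z (M ! i)) \<noteq> src Z (rep Z (M ! Suc i)))"

definition viable_tensor :: "'i arc_diagram \<Rightarrow> 'i elt set list \<Rightarrow> bool" where
  "viable_tensor Z M \<longleftrightarrow> \<not> mismatch Z M \<and> viable_hgr Z (tensor_hgr Z M)"

definition tensor_maslov :: "'i arc_diagram \<Rightarrow> 'i elt set list \<Rightarrow> rat" where
  "tensor_maslov Z M = (\<Sum>C \<leftarrow> M. maslov Z (rep Z C)) +
     (\<Sum>k < length M. \<Sum>j < k.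
        avg_mult Z (hgrading (rep Z (M ! k))) (chain_bd (hgrading (rep Z (M ! j)))))"

fun alg_prod :: "'i elt list \<Rightarrow> 'i elt" where
  "alg_prod [] = undefined"
| "alg_prod (D # Ds) = foldl (\<odot>) D Ds"

definition rep_prod :: "'i arc_diagram \<Rightarrow> 'i elt set list \<Rightarrow> 'i elt" where
  "rep_prod Z M = alg_prod (map (rep Z) M)"

definition tight_tensor :: "'i arc_diagram \<Rightarrow> 'i elt set list \<Rightarrow> bool" where
  "tight_tensor Z M \<longleftrightarrow> viable_tensor Z M \<and> rep_prod Z M \<noteq> 0 \<and> tight_diag Z (rep_prod Z M)"

definition twisted_tensor :: "'i arc_diagram \<Rightarrow> 'i elt set list \<Rightarrow> bool" where
  "twisted_tensor Z M \<longleftrightarrow> viable_tensor Z M \<and> rep_prod Z M \<noteq> 0 \<and> twisted_diag Z (rep_prod Z M)"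

definition critical_tensor :: "'i arc_diagram \<Rightarrow> 'i elt set list \<Rightarrow> bool" where
  "critical_tensor Z M \<longleftrightarrow>
     viable_tensor Z M \<and> rep_prod Z M = 0 \<and> alg_summand Z (tensor_hdata Z M) \<noteq> {0}"

definition local_tensor :: "'i arc_diagram \<Rightarrow> nat \<Rightarrow> 'i elt set list \<Rightarrow> 'i pt elt set list" where
  "local_tensor Z P M = map (\<lambda>C. hclass (fragment Z P) (local_diag Z P (rep Z C))) M"

definition tight_pairs :: "'i arc_diagram \<Rightarrow> 'i elt set list \<Rightarrow> nat set" where
  "tight_pairs Z M = {P \<in> pairs Z. tight_tensor (fragment Z P) (local_tensor Z P M)}"

definition twisted_pairs :: "'i arc_diagram \<Rightarrow> 'i elt set list \<Rightarrow> nat set" where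
  "twisted_pairs Z M = {P \<in> pairs Z. twisted_tensor (fragment Z P) (local_tensor Z P M)}"

definition critical_pairs :: "'i arc_diagram \<Rightarrow> 'i elt set list \<Rightarrow> nat set" where
  "critical_pairs Z M = {P \<in> pairs Z. critical_tensor (fragment Z P) (local_tensor Z P M)}"

section \<open>Pair orderings\<close>

type_synonym 'i pair_order = "nat rel \<times> (nat \<Rightarrow> 'i pt rel)"

definition pair_ordering :: "'i arc_diagram \<Rightarrow> 'i pair_order \<Rightarrow> bool" where
  "pair_ordering Z ord \<longleftrightarrow> linear_order_on (pairs Z) (fst ord) \<and>
     (\<forall>P \<in> pairs Z. linear_order_on (fibre Z P) (snd ord P))"

definition smaller_place :: "'i arc_diagram \<Rightarrow> 'i pair_order \<Rightarrow> nat \<Rightarrow> 'i pt" where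
  "smaller_place Z ord P = (THE p. p \<in> fibre Z P \<and> (\<forall>q \<in> fibre Z P. (p, q) \<in> snd ord P))"

definition standard_diag :: "'i arc_diagram \<Rightarrow> 'i pair_order \<Rightarrow> 'i elt \<Rightarrow> bool" where
  "standard_diag Z ord D \<longleftrightarrow> tight_diag Z D \<and>
     (\<forall>P \<in> src Z D \<inter> tgt Z D. doubly_occupied Z (hgrading D) P \<longrightarrow>
        smaller_place Z ord P \<in> Domain (moving D) \<and> smaller_place Z ord P \<in> Range (moving D))"

text \<open>
  \<open>Astar\<close> extends the operation \<open>Astar_diag\<close> on diagrams linearly: the diagrams
  occurring in an element \<open>a\<close> of the strand algebra are those whose terms all occur in \<open>a\<close>, because
  distinct diagrams have no common terms.
\<close>

definition Astar_pair :: "'i arc_diagram \<Rightarrow> 'i pair_order \<Rightarrow> 'i elt \<Rightarrow> nat" where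
  "Astar_pair Z ord D =
     (let C = {P \<in> src Z D \<inter> tgt Z D. \<exists>p \<in> fibre Z P. once_occupied_at Z (hgrading D) p}
      in THE P. P \<in> C \<and> (\<forall>P' \<in> C. (P, P') \<in> fst ord))"

definition Astar_diag :: "'i arc_diagram \<Rightarrow> 'i pair_order \<Rightarrow> 'i elt \<Rightarrow> 'i elt" where
  "Astar_diag Z ord D =
     (let P = Astar_pair Z ord D;
          p = (THE p. p \<in> fibre Z P \<and> once_occupied_at Z (hgrading D) p);
          \<mu> = moving D
      in if crossed_at Z P D then 0
         else diag Z (src Z D) (tgt Z D)
           ({(x, y) \<in> \<mu>. x \<noteq> p \<and> y \<noteq> p} \<union> {(x, y). (x, p) \<in> \<mu> \<and> (p, y) \<in> \<mu>}))"

definition Astar :: "'i arc_diagram \<Rightarrow> 'i pair_order \<Rightarrow> 'i elt \<Rightarrow> 'i elt" where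
  "Astar Z ord a = (\<Sum>D | D \<in> diagrams Z \<and> terms D \<subseteq> terms a. Astar_diag Z ord D)"

section \<open>The A-infinity structure and morphism arising from a pair ordering\<close>

text \<open>
  The operations of all arities are gathered in one function on nonempty lists, the arity being the
  length of the list.  Over the field with two elements, linear means additive.
\<close>

definition multilinear :: "'h::plus set \<Rightarrow> 'b::plus set \<Rightarrow> ('h list \<Rightarrow> 'b) \<Rightarrow> bool" where
  "multilinear H B g \<longleftrightarrow>
     (\<forall>M \<in> lists H. M \<noteq> [] \<longrightarrow> g M \<in> B) \<and>
     (\<forall>as \<in> lists H. \<forall>bs \<in> lists H. \<forall>c \<in> H. \<forall>c' \<in> H.
        g (as @ (c + c') # bs) = g (as @ c # bs) + g (as @ c' # bs))"

definition insert_op :: "('h list \<Rightarrow> 'h) \<Rightarrow> nat \<Rightarrow> nat \<Rightarrow> 'h list \<Rightarrow> 'h list" where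
  "insert_op X k j M = take k M @ X (take j (drop k M)) # drop (k + j) M"

text \<open>
  The sum is a nonempty sum of cosets, hence a coset, and \<open>hclass Z 0\<close> is the zero coset.
\<close>

definition A_infinity_algebra :: "'i arc_diagram \<Rightarrow> ('i elt set list \<Rightarrow> 'i elt set) \<Rightarrow> bool" where
  "A_infinity_algebra Z X \<longleftrightarrow> multilinear (homology Z) (homology Z) X \<and>
     (\<forall>M \<in> lists (homology Z). M \<noteq> [] \<longrightarrow>
        (\<Sum>j = 1..length M. \<Sum>k = 0..length M - j. X (insert_op X k j M)) = hclass Z 0)"

definition U_op :: "('i elt set list \<Rightarrow> 'i elt set) \<Rightarrow> ('i elt set list \<Rightarrow> 'i elt) \<Rightarrow>
    'i elt set list \<Rightarrow> 'i elt" where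
  "U_op X f M = (\<Sum>j = 1..length M - 1. f (take j M) \<odot> f (drop j M)) +
     (\<Sum>j = 2..length M - 1. \<Sum>k = 0..length M - j. f (insert_op X k j M))"

text \<open>
  As \<open>X\<close> vanishes in arity 1 and the strand algebra has no operations of arity at least 3, the
  relations of an A-infinity morphism are the ones below.
\<close>

definition A_infinity_morphism :: "'i arc_diagram \<Rightarrow> ('i elt set list \<Rightarrow> 'i elt set) \<Rightarrow>
    ('i elt set list \<Rightarrow> 'i elt) \<Rightarrow> bool" where
  "A_infinity_morphism Z X f \<longleftrightarrow> multilinear (homology Z) (strand_algebra Z) f \<and>
     (\<forall>M \<in> lists (homology Z). M \<noteq> [] \<longrightarrow> \<partial> (f M) = f [X M] - U_op X f M)"

text \<open>
  \<open>f\<close> itself is not unique, so the pair \<open>(X, f)\<close> is specified by its properties, which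
  determine \<open>X\<close> and \<open>f\<close> modulo \<open>ideal_F\<close>.  The condition on \<open>f [hclass Z D]\<close> says that \<open>f\<close> in
  arity 1 sends the generator of each nonzero summand of the homology to the unique standard tight
  diagram with the same H-data.
\<close>

definition arises_from :: "'i arc_diagram \<Rightarrow> 'i pair_order \<Rightarrow>
    ('i elt set list \<Rightarrow> 'i elt set) \<Rightarrow> ('i elt set list \<Rightarrow> 'i elt) \<Rightarrow> bool" where
  "arises_from Z ord X f \<longleftrightarrow>
     A_infinity_algebra Z X \<and> A_infinity_morphism Z X f \<and>
     (\<forall>C \<in> homology Z. X [C] = hclass Z 0) \<and>
     (\<forall>c \<in> cycles Z. \<forall>d \<in> cycles Z. X [hclass Z c, hclass Z d] = hclass Z (c \<odot> d)) \<and>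
     (\<forall>D D'. tight_diag Z D \<and> standard_diag Z ord D' \<and> hdata_of Z D' = hdata_of Z D \<longrightarrow>
        f [hclass Z D] = D') \<and>
     (\<forall>M \<in> lists (homology Z). 2 \<le> length M \<longrightarrow>
        U_op X f M \<in> cycles Z \<and> X M = hclass Z (U_op X f M)) \<and>
     (\<forall>M \<in> lists (diag_classes Z). M \<noteq> [] \<longrightarrow>
        (\<not> viable_tensor Z M \<longrightarrow> bar Z (f M) = bar Z 0 \<and> X M = hclass Z 0) \<and>
        (mismatch Z M \<longrightarrow> f M = 0) \<and>
        f M \<in> alg_summand Z (tensor_hdata Z M) \<and>
        homogeneous Z (tensor_maslov Z M + of_nat (length M) - 1) (f M) \<and>
        (\<exists>c \<in> alg_summand Z (tensor_hdata Z M). \<partial> c = 0 \<and>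
           homogeneous Z (tensor_maslov Z M + of_nat (length M) - 2) c \<and> X M = hclass Z c) \<and>
        (2 \<le> length M \<and> f [X M] - U_op X f M = 0 \<longrightarrow> f M = 0) \<and>
        (2 \<le> length M \<and> viable_tensor Z M \<and> twisted_hdata Z (tensor_hdata Z M) \<longrightarrow>
           f M = Astar Z ord (f [X M] - U_op X f M)))"

end

theory Submission
  imports Defs
begin

text \<open>
  A viable diagram is determined by its H-data \<open>(h, s, t)\<close> and the set \<open>B\<close> of places at which a strand
  ends and another one begins.  These places lie at the 11 pairs at which \<open>h\<close> is full (the core), at
  most one at each of them, and a pair of the core without a broken place is crossed.  Hence the
  Maslov grading is \<open>-card B\<close> plus a constant depending on \<open>h\<close>, and the differential breaks a strand at
  one crossed pair; if some pair of the core is once occupied, joining strands there is a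
  contracting homotopy, and otherwise the homology is generated by any diagram without crossings.

  For a viable tensor product \<open>M\<close> of generators with nonzero summand, an induction along the factors
  at each matched pair shows that the Maslov grading of \<open>M\<close> is that of a diagram without crossings
  with the H-data of \<open>M\<close>, minus the number \<open>m\<close> of critical pairs.  Both parts then are degree
  arguments: \<open>X\<^sub>n(M)\<close> has degree \<open>n - 2 - m\<close> above the diagrams without crossings, where the
  homology lives, and \<open>f\<^sub>n(M)\<close> is a sum of diagrams with \<open>n - 1 - m\<close> crossed pairs, which modulo \<open>\<F>\<close>
  are once occupied, that is twisted in \<open>M\<close>.  If \<open>m = n - 1\<close>, then \<open>f\<^sub>n(M)\<close> has no crossings, so it is a
  cycle, and property (c) of the construction gives \<open>f\<^sub>n(M) = 0\<close>.
\<close>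

section \<open>Linear extension over the field with two elements\<close>

text \<open>The type of a pair in \<open>M\<close> is defined in the fragment at that pair, through
  representatives chosen afresh there, whereas the gradings live on the whole diagram. The locale
  \<open>pre_arc_diagram\<close> therefore collects what \<open>Z\<close> and its fragments share,
  and the classification of diagrams and products is instantiated at both. The bridge is a count:
  the cross terms in the grading of \<open>M\<close> telescope, leaving one unit for each place
  broken in a factor and one for each place whose later step is covered by an earlier factor than
  its earlier step. At a single pair this number is 1 for a core pair, plus 1 exactly for a critical
  pair. The delicate case is a product that vanishes at a proper prefix. Factors without crossings
  multiply to zero only because a strand ends at one place of a pair and the next one starts at its
  twin; the remaining factors must still be counted although no diagram is left to follow.
  \<open>zero_state\<close> is the invariant for that phase, and since a pair has only four steps,
  every step of the induction is a finite check.\<close>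

lemma bit_pm_add_self [simp]: "(a :: 'a \<Rightarrow>\<^sub>0 bit) + a = 0"
  by (intro poly_mapping_eqI) (simp add: lookup_add)

lemma bit_pm_add_cancel [simp]: "(a :: 'a \<Rightarrow>\<^sub>0 bit) + (a + b) = b"
  by (simp flip: add.assoc)

lemma bit_pm_add_eq_0: "(a :: 'a \<Rightarrow>\<^sub>0 bit) + b = 0 \<longleftrightarrow> a = b"
  by (metis add.right_neutral bit_pm_add_cancel bit_pm_add_self)

lemma in_keys_bit: "x \<in> Poly_Mapping.keys (a :: 'a \<Rightarrow>\<^sub>0 bit) \<longleftrightarrow> Poly_Mapping.lookup a x = 1"
  by (simp add: in_keys_iff)

lemma keys_bit_add:
  "x \<in> Poly_Mapping.keys (a + b :: 'a \<Rightarrow>\<^sub>0 bit) \<longleftrightarrow>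
     (x \<in> Poly_Mapping.keys a) \<noteq> (x \<in> Poly_Mapping.keys b)"
  unfolding in_keys_bit by (cases "Poly_Mapping.lookup a x"; cases "Poly_Mapping.lookup b x") (auto simp: lookup_add)

lemma bit_pm_eqI: "Poly_Mapping.keys a = Poly_Mapping.keys b \<Longrightarrow> a = (b :: 'a \<Rightarrow>\<^sub>0 bit)"
proof (rule poly_mapping_eqI)
  fix k
  assume "Poly_Mapping.keys a = Poly_Mapping.keys b"
  then have "Poly_Mapping.lookup a k = 1 \<longleftrightarrow> Poly_Mapping.lookup b k = 1"
    by (simp flip: in_keys_bit)
  then show "Poly_Mapping.lookup a k = Poly_Mapping.lookup b k"
    by (cases "Poly_Mapping.lookup a k"; cases "Poly_Mapping.lookup b k") simp_all
qed

text \<open>Coefficients are 0 or 1, so a formal sum is its finite support and a linear map is a sum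
  over that support. The differential and, in each argument, the product are of this form.\<close>

definition lext :: "('a \<Rightarrow> 'b \<Rightarrow>\<^sub>0 bit) \<Rightarrow> ('a \<Rightarrow>\<^sub>0 bit) \<Rightarrow> 'b \<Rightarrow>\<^sub>0 bit" where
  "lext g a = (\<Sum>x \<in> Poly_Mapping.keys a. g x)"

lemma lext_0 [simp]: "lext g 0 = 0"
  by (simp add: lext_def)

lemma lext_single [simp]: "lext g (Poly_Mapping.single x 1) = g x"
  by (simp add: lext_def)

text \<open>The support of a sum is the symmetric difference of the supports; the values on the
  common part occur twice and cancel.\<close>

lemma lext_add: "lext g (a + b) = lext g a + lext g b"
proof -
  let ?A = "Poly_Mapping.keys a" and ?B = "Poly_Mapping.keys b"
  have k: "Poly_Mapping.keys (a + b) = (?A - ?B) \<union> (?B - ?A)"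
    by (auto simp: keys_bit_add)
  have "lext g (a + b) = sum g (?A - ?B) + sum g (?B - ?A)"
    unfolding lext_def k by (intro sum.union_disjoint) auto
  also have "\<dots> = (sum g (?A - ?B) + sum g (?A \<inter> ?B)) + (sum g (?B - ?A) + sum g (?A \<inter> ?B))"
    by (simp add: add.assoc add.left_commute)
  also have "sum g (?A - ?B) + sum g (?A \<inter> ?B) = sum g ?A"
    by (subst sum.union_disjoint[symmetric]) (auto intro!: arg_cong[of _ _ "sum g"])
  also have "sum g (?B - ?A) + sum g (?A \<inter> ?B) = sum g ?B"
    by (subst sum.union_disjoint[symmetric]) (auto intro!: arg_cong[of _ _ "sum g"])
  finally show ?thesis by (simp add: lext_def)
qed

lemma lext_sum: "lext g (\<Sum>i \<in> I. F i) = (\<Sum>i \<in> I. lext g (F i))"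
  by (induction I rule: infinite_finite_induct) (simp_all add: lext_add)

lemma lext_cong: "(\<And>x. x \<in> Poly_Mapping.keys a \<Longrightarrow> g x = g' x) \<Longrightarrow> lext g a = lext g' a"
  by (simp add: lext_def)

lemma lext_lext: "lext g (lext k a) = lext (\<lambda>x. lext g (k x)) a"
  by (simp only: lext_def[of k] lext_sum) (simp only: lext_def[of "\<lambda>x. lext g (k x)"])

lemma lext_fun_add: "lext (\<lambda>x. g x + k x) a = lext g a + lext k a"
  by (simp add: lext_def sum.distrib)

definition el :: "'a set \<Rightarrow> 'a \<Rightarrow>\<^sub>0 bit" where
  "el A = (\<Sum>x \<in> A. Poly_Mapping.single x 1)"

lemma keys_bit_add_eq:
  "Poly_Mapping.keys (a + b :: 'a \<Rightarrow>\<^sub>0 bit) =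
     (Poly_Mapping.keys a - Poly_Mapping.keys b) \<union> (Poly_Mapping.keys b - Poly_Mapping.keys a)"
  by (auto simp only: keys_bit_add)

lemma keys_el [simp]: "finite A \<Longrightarrow> Poly_Mapping.keys (el A) = A"
  unfolding el_def
proof (induction A rule: finite_induct)
  case (insert x A)
  then show ?case by (simp add: keys_bit_add_eq)
qed simp

lemma lext_single_eq: "lext (\<lambda>x. Poly_Mapping.single x 1) a = a"
proof (rule bit_pm_eqI)
  have "lext (\<lambda>x. Poly_Mapping.single x 1) a = el (Poly_Mapping.keys a)"
    unfolding lext_def el_def ..
  then show "Poly_Mapping.keys (lext (\<lambda>x. Poly_Mapping.single x 1) a) = Poly_Mapping.keys a"
    by (simp only: keys_el finite_keys)
qed

lemma el_empty [simp]: "el {} = 0"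
  by (simp add: el_def)

lemma el_eq_0: "finite A \<Longrightarrow> el A = 0 \<longleftrightarrow> A = {}"
  by (metis el_empty keys_el keys_zero)

lemma sum_el_image: "inj_on F A \<Longrightarrow> (\<Sum>x\<in>A. Poly_Mapping.single (F x) 1) = el (F ` A)"
  by (simp add: el_def sum.reindex)

lemma keys_sum_disjoint:
  fixes F :: "'i \<Rightarrow> 'a \<Rightarrow>\<^sub>0 bit"
  assumes "finite I"
    and "\<And>i j. i \<in> I \<Longrightarrow> j \<in> I \<Longrightarrow> i \<noteq> j \<Longrightarrow> Poly_Mapping.keys (F i) \<inter> Poly_Mapping.keys (F j) = {}"
  shows "Poly_Mapping.keys (\<Sum>i\<in>I. F i) = (\<Union>i\<in>I. Poly_Mapping.keys (F i))"
  using assms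
proof (induction I)
  case (insert i I)
  have "Poly_Mapping.keys (F i) \<inter> (\<Union>j\<in>I. Poly_Mapping.keys (F j)) = {}"
    using insert.prems insert.hyps by blast
  moreover have "Poly_Mapping.keys (\<Sum>i\<in>I. F i) = (\<Union>i\<in>I. Poly_Mapping.keys (F i))"
    using insert by simp
  ultimately show ?case using insert.hyps by (simp add: keys_bit_add_eq Diff_triv inf_commute)
qed simp

lemma alg_mult_lext: "a \<odot> b = lext (\<lambda>\<mu>. lext (sd_mult \<mu>) b) a"
  by (simp add: alg_mult_def lext_def)

lemma diff_lext: "\<partial> a = lext sd_diff a"
  by (simp add: diff_def lext_def)

lemma diff_0 [simp]: "\<partial> 0 = 0"
  by (simp add: diff_lext)

lemma diff_add: "\<partial> (a + b) = \<partial> a + \<partial> b"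
  by (simp add: diff_lext lext_add)

lemma diff_sum: "\<partial> (\<Sum>i\<in>I. F i) = (\<Sum>i\<in>I. \<partial> (F i))"
  by (simp add: diff_lext lext_sum)

lemma alg_mult_0 [simp]: "0 \<odot> b = 0" "a \<odot> 0 = 0"
  by (simp_all add: alg_mult_lext, simp add: lext_def)

section \<open>Spans and cosets\<close>

lemma lin_span_0: "0 \<in> lin_span B"
  unfolding lin_span_def by (rule CollectI, rule exI[of _ "{}"]) simp

lemma lin_span_base: "D \<in> B \<Longrightarrow> D \<in> lin_span B"
  unfolding lin_span_def by (rule CollectI, rule exI[of _ "{D}"]) simp

text \<open>\<open>lin_span\<close> sums over sets of generators, so a generator used on both sides
  has to disappear. Formal sums of generators do this bookkeeping: the support of
  \<open>el F + el G\<close> is the set to sum over.\<close>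

lemma lin_span_add:
  assumes "a \<in> lin_span B" "b \<in> lin_span B"
  shows "a + b \<in> lin_span B"
proof -
  obtain F where F: "finite F" "F \<subseteq> B" "a = (\<Sum>D\<in>F. D)" using assms(1) unfolding lin_span_def by blast
  obtain G where G: "finite G" "G \<subseteq> B" "b = (\<Sum>D\<in>G. D)" using assms(2) unfolding lin_span_def by blast
  have e: "(\<Sum>D\<in>F. D) = lext (\<lambda>D. D) (el F)" "(\<Sum>D\<in>G. D) = lext (\<lambda>D. D) (el G)"
    using F G by (simp_all add: lext_def)
  let ?K = "Poly_Mapping.keys (el F + el G)"
  have "a + b = lext (\<lambda>D. D) (el F + el G)"
    unfolding F(3) G(3) e lext_add ..
  then have "a + b = (\<Sum>D\<in>?K. D)" by (simp add: lext_def)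
  moreover have "?K \<subseteq> B" using F G by (auto simp: keys_bit_add)
  ultimately show ?thesis unfolding lin_span_def by (intro CollectI exI[of _ ?K]) simp
qed

lemma lin_span_sum: "(\<And>i. i \<in> I \<Longrightarrow> F i \<in> lin_span B) \<Longrightarrow> (\<Sum>i\<in>I. F i) \<in> lin_span B"
  by (induction I rule: infinite_finite_induct) (auto intro: lin_span_0 lin_span_add)

lemma lin_span_mono: "B \<subseteq> C \<Longrightarrow> lin_span B \<subseteq> lin_span C"
  unfolding lin_span_def by blast

text \<open>In characteristic two \<open>a + b\<close> is the difference of \<open>a\<close> and
  \<open>b\<close>.\<close>

lemma coset_of_eq_iff:
  fixes a b :: "'a \<Rightarrow>\<^sub>0 bit"
  assumes "0 \<in> N" "\<And>x y. x \<in> N \<Longrightarrow> y \<in> N \<Longrightarrow> x + y \<in> N"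
  shows "coset_of N a = coset_of N b \<longleftrightarrow> a + b \<in> N"
proof
  assume "coset_of N a = coset_of N b"
  then have "a + 0 \<in> coset_of N b" using assms(1) unfolding coset_of_def by blast
  then obtain n where "n \<in> N" "a = b + n" unfolding coset_of_def by auto
  then show "a + b \<in> N" by (simp add: add.commute)
next
  have *: "coset_of N a \<subseteq> coset_of N b" if "a + b \<in> N" for a b
  proof
    fix x assume "x \<in> coset_of N a"
    then obtain n where "n \<in> N" "x = a + n" unfolding coset_of_def by auto
    then have "x = b + ((a + b) + n)" "(a + b) + n \<in> N"
      using assms(2)[OF that] by (simp_all add: add.assoc add.left_commute)
    then show "x \<in> coset_of N b" unfolding coset_of_def by blast
  qed
  assume "a + b \<in> N"
  then show "coset_of N a = coset_of N b" using *[of a b] *[of b a] by (simp add: add.commute)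
qed

lemma bar_eq_iff: "bar Z a = bar Z b \<longleftrightarrow> a + b \<in> ideal_F Z"
  unfolding bar_def ideal_F_def by (rule coset_of_eq_iff) (auto intro: lin_span_0 lin_span_add)

lemma hclass_eq_iff: "hclass Z a = hclass Z b \<longleftrightarrow> a + b \<in> boundaries Z"
  unfolding hclass_def
proof (rule coset_of_eq_iff)
  show "0 \<in> boundaries Z"
    unfolding boundaries_def strand_algebra_def by (metis diff_0 imageI lin_span_0)
  show "x + y \<in> boundaries Z" if "x \<in> boundaries Z" "y \<in> boundaries Z" for x y
    using that unfolding boundaries_def strand_algebra_def
    by (smt (verit) diff_add image_iff lin_span_add)
qed

section \<open>Strand diagrams of multiplicity at most one\<close>

definition moving_sd :: "'i arc_diagram \<Rightarrow> 'i sd \<Rightarrow> bool" where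
  "moving_sd Z \<mu> \<longleftrightarrow> strand_diagram Z \<mu> \<and> (\<forall>(x, y) \<in> \<mu>. x \<noteq> y)"

text \<open>Gradings are functions on all of \<open>'i pt\<close>. Requiring the value 0 off the
  steps lets viable gradings be compared as functions.\<close>

definition viable01 :: "'i arc_diagram \<Rightarrow> 'i hgr \<Rightarrow> bool" where
  "viable01 Z h \<longleftrightarrow> (\<forall>e. h e = 0 \<or> h e = 1) \<and> (\<forall>e. e \<notin> steps Z \<longrightarrow> h e = 0)"

definition full :: "'i arc_diagram \<Rightarrow> 'i hgr \<Rightarrow> 'i pt set" where
  "full Z h = {a \<in> places Z. h (step_to a) = 1 \<and> h a = 1}"

text \<open>The moving strands of a viable diagram: the maximal runs of steps covered by
  \<open>h\<close>, cut at the places in \<open>B\<close>.\<close>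

definition strands :: "'i hgr \<Rightarrow> 'i pt set \<Rightarrow> 'i sd" where
  "strands h B = {((i, m), (i, n)) | i m n. m < n \<and> (\<forall>k. m \<le> k \<and> k < n \<longrightarrow> h (i, k) = 1) \<and>
     (\<forall>k. m < k \<and> k < n \<longrightarrow> (i, k) \<notin> B) \<and> (m = 0 \<or> h (i, m - 1) = 0 \<or> (i, m) \<in> B) \<and>
     (h (i, n) = 0 \<or> (i, n) \<in> B)}"

text \<open>A strand that starts at or before \<open>e\<close> either runs over the step
  \<open>e\<close> or has ended by then. So the grading depends only on the domain and the range,
  which makes its invariance under resolution and its additivity under composition
  immediate.\<close>

lemma sd_hgr_eq:
  assumes "finite \<mu>" "inj_on fst \<mu>" "inj_on snd \<mu>" "\<And>x y. (x, y) \<in> \<mu> \<Longrightarrow> pt_le x y"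
  shows "sd_hgr \<mu> e = int (card {x \<in> Domain \<mu>. pt_le x e}) - int (card {y \<in> Range \<mu>. pt_le y e})"
proof -
  let ?A = "{(x, y). (x, y) \<in> \<mu> \<and> pt_le x e \<and> pt_less e y}"
  let ?B = "{(x, y). (x, y) \<in> \<mu> \<and> pt_le y e}"
  have "card {x \<in> Domain \<mu>. pt_le x e} = card (fst ` (?A \<union> ?B))"
  proof (intro arg_cong[of _ _ card] equalityI subsetI)
    fix x assume "x \<in> {x \<in> Domain \<mu>. pt_le x e}"
    then obtain y where xy: "(x, y) \<in> \<mu>" "pt_le x e" by auto
    then have "(x, y) \<in> ?A \<union> ?B" using assms(4) by (auto simp: pt_le_def pt_less_def)
    then show "x \<in> fst ` (?A \<union> ?B)" by (rule rev_image_eqI) simp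
  next
    fix x assume "x \<in> fst ` (?A \<union> ?B)"
    then obtain y where y: "(x, y) \<in> ?A \<union> ?B" by (metis (no_types, lifting) imageE prod.collapse)
    then have "(x, y) \<in> \<mu>" by blast
    then have "pt_le x y" "(x, y) \<in> \<mu>" using assms(4) by blast+
    with y show "x \<in> {x \<in> Domain \<mu>. pt_le x e}" by (auto simp: pt_le_def)
  qed
  also have "\<dots> = card (?A \<union> ?B)"
    by (intro card_image inj_on_subset[OF assms(2)]) auto
  also have "\<dots> = card ?A + card ?B"
    by (intro card_Un_disjoint finite_subset[OF _ assms(1)]) (auto simp: pt_le_def pt_less_def)
  also have "card ?B = card (snd ` ?B)"
    by (intro card_image[symmetric] inj_on_subset[OF assms(3)]) auto
  also have "snd ` ?B = {y \<in> Range \<mu>. pt_le y e}"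
    unfolding Range_snd by (auto intro: rev_image_eqI)
  finally show ?thesis by (simp add: sd_hgr_def)
qed

lemma strand_diagram_inj:
  assumes "strand_diagram Z \<mu>"
  shows "(x, y) \<in> \<mu> \<Longrightarrow> (x, y') \<in> \<mu> \<Longrightarrow> y = y'" "(x, y) \<in> \<mu> \<Longrightarrow> (x', y) \<in> \<mu> \<Longrightarrow> x = x'"
  using assms unfolding strand_diagram_def inj_on_def by fastforce+

lemma fst_step_to [simp]: "fst (step_to p) = fst p" "step_to (i, j) = (i, j - 1)"
  by (simp_all add: step_to_def)

text \<open>Holds for arc diagrams and for their fragments, so that every result below can also be
  applied at a single matched pair.\<close>

locale pre_arc_diagram =
  fixes Z :: "'i arc_diagram"
  assumes finite_ivs: "finite (ivs Z)"
    and card_fibre: "P \<in> pairs Z \<Longrightarrow> card (fibre Z P) = 2"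
begin

lemma finite_points [simp]: "finite (points Z)"
proof -
  have "points Z = Sigma (ivs Z) (\<lambda>i. {..npl Z i + 1})" by (auto simp: points_def)
  then show ?thesis using finite_ivs by simp
qed

lemma places_subset: "places Z \<subseteq> points Z" and steps_subset: "steps Z \<subseteq> points Z"
  by (auto simp: places_def points_def steps_def)

lemma finite_places [simp]: "finite (places Z)"
  using finite_subset[OF places_subset] by simp

lemma finite_strand_diagram: "strand_diagram Z \<mu> \<Longrightarrow> finite \<mu>"
  unfolding strand_diagram_def by (metis finite_SigmaI finite_points finite_subset)

lemma sd_hgr_Domain_Range:
  assumes "strand_diagram Z \<mu>"
  shows "sd_hgr \<mu> e = int (card {x \<in> Domain \<mu>. pt_le x e}) - int (card {y \<in> Range \<mu>. pt_le y e})"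
  using assms by (intro sd_hgr_eq finite_strand_diagram) (auto simp: strand_diagram_def)

lemma viable01D: "viable01 Z h \<Longrightarrow> h e \<noteq> 1 \<Longrightarrow> h e = 0"
  "viable01 Z h \<Longrightarrow> h (i, m) = 1 \<Longrightarrow> i \<in> ivs Z \<and> m \<le> npl Z i"
proof -
  assume h: "viable01 Z h"
  show "h e \<noteq> 1 \<Longrightarrow> h e = 0" using h unfolding viable01_def by blast
  assume "h (i, m) = 1"
  then have "(i, m) \<in> steps Z" using h unfolding viable01_def by force
  then show "i \<in> ivs Z \<and> m \<le> npl Z i" by (simp add: steps_def)
qed

text \<open>The run of covered steps around \<open>k\<close> is followed in both directions up to
  the nearest gap, element of \<open>B\<close> or start of the interval.\<close>

lemma strand_through:
  assumes h: "viable01 Z h" and k: "h (i, k) = 1"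
  obtains m n where "m \<le> k" "k < n" "((i, m), (i, n)) \<in> strands h B"
proof -
  let ?R = "\<lambda>n. k < n \<and> (h (i, n) = 0 \<or> (i, n) \<in> B)"
  let ?L = "\<lambda>m. m \<le> k \<and> (m = 0 \<or> h (i, m - 1) = 0 \<or> (i, m) \<in> B)"
  define n where "n = (LEAST n. ?R n)"
  define m where "m = (GREATEST m. ?L m)"
  \<comment> \<open>The end of the interval names no step, so \<open>h\<close> vanishes there and
    the least \<open>n\<close> exists.\<close>
  have "?R (npl Z i + 1)"
  proof -
    have "h (i, npl Z i + 1) \<noteq> 1" using viable01D(2)[OF h, of i "npl Z i + 1"] by linarith
    then show ?thesis using viable01D(2)[OF h k] viable01D(1)[OF h] by simp
  qed
  then have n: "?R n" unfolding n_def by (rule LeastI[of ?R])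
  have n': "\<And>j. ?R j \<Longrightarrow> n \<le> j" unfolding n_def by (rule Least_le[of ?R])
  have m: "?L m" unfolding m_def by (rule GreatestI_nat[of ?L 0 k]) auto
  have m': "\<And>j. ?L j \<Longrightarrow> j \<le> m" unfolding m_def by (rule Greatest_le_nat[of ?L _ k]) auto
  have h1: "h (i, j) = 1" if "m \<le> j" "j < n" for j
  proof (cases "k < j")
    case True
    then have "h (i, j) \<noteq> 0" using n'[of j] that by auto
    then show ?thesis using viable01D(1)[OF h] by blast
  next
    case False
    show ?thesis
    proof (cases "j = k")
      case False
      then have "h (i, j) \<noteq> 0" using m'[of "Suc j"] that \<open>\<not> k < j\<close> by auto
      then show ?thesis using viable01D(1)[OF h] by blast
    qed (simp add: k)
  qed
  have "(i, j) \<notin> B" if "m < j" "j < n" for j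
    using m'[of j] n'[of j] that by (cases "k < j") auto
  then have "((i, m), (i, n)) \<in> strands h B" using h1 m n unfolding strands_def by auto
  with that m n show ?thesis by blast
qed

lemma strands_iff:
  "((i, m), (i, n)) \<in> strands h B \<longleftrightarrow> m < n \<and> (\<forall>k. m \<le> k \<and> k < n \<longrightarrow> h (i, k) = 1) \<and>
     (\<forall>k. m < k \<and> k < n \<longrightarrow> (i, k) \<notin> B) \<and> (m = 0 \<or> h (i, m - 1) = 0 \<or> (i, m) \<in> B) \<and>
     (h (i, n) = 0 \<or> (i, n) \<in> B)"
  unfolding strands_def by simp

lemma strands_inj:
  "((i, m), (i, n)) \<in> strands h B \<Longrightarrow> ((i, m'), (i, n')) \<in> strands h B \<Longrightarrow>
     m \<le> k \<Longrightarrow> k < n \<Longrightarrow> m' \<le> k \<Longrightarrow> k < n' \<Longrightarrow> m = m' \<and> n = n'"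
proof -
  have *: "m' \<le> m \<and> n' \<le> n" if "((i, m), (i, n)) \<in> strands h B" "((i, m'), (i, n')) \<in> strands h B"
     "m \<le> k" "k < n" "m' \<le> k" "k < n'" for m n m' n'
  proof
    note c = that(1)[unfolded strands_iff] and c' = that(2)[unfolded strands_iff]
    show "m' \<le> m"
    proof (rule ccontr)
      assume "\<not> m' \<le> m"
      then have "m \<le> m' - 1" "m' - 1 < n" "m < m'" "m' < n" using that by linarith+
      with c have "h (i, m' - 1) = 1" "(i, m') \<notin> B" by blast+
      with c' \<open>m < m'\<close> show False by simp
    qed
    show "n' \<le> n"
    proof (rule ccontr)
      assume "\<not> n' \<le> n"
      then have "m' \<le> n" "m' < n" "n < n'" using that by linarith+
      with c' have "h (i, n) = 1" "(i, n) \<notin> B" by blast+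
      with c show False by simp
    qed
  qed
  show "((i, m), (i, n)) \<in> strands h B \<Longrightarrow> ((i, m'), (i, n')) \<in> strands h B \<Longrightarrow>
     m \<le> k \<Longrightarrow> k < n \<Longrightarrow> m' \<le> k \<Longrightarrow> k < n' \<Longrightarrow> m = m' \<and> n = n'"
    using *[of m n m' n'] *[of m' n' m n] by (simp add: eq_iff)
qed

lemma strandsD:
  "(x, y) \<in> strands h B \<Longrightarrow> fst x = fst y \<and> snd x < snd y \<and> h x = 1"
  "(x, y) \<in> strands h B \<Longrightarrow> snd x \<le> k \<Longrightarrow> k < snd y \<Longrightarrow> h (fst x, k) = 1"
  unfolding strands_def by auto

lemma Domain_strands:
  assumes "viable01 Z h"
  shows "(i, m) \<in> Domain (strands h B) \<longleftrightarrow> h (i, m) = 1 \<and> (m = 0 \<or> h (i, m - 1) = 0 \<or> (i, m) \<in> B)"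
proof
  assume "(i, m) \<in> Domain (strands h B)"
  then show "h (i, m) = 1 \<and> (m = 0 \<or> h (i, m - 1) = 0 \<or> (i, m) \<in> B)"
    unfolding strands_def by auto
next
  assume *: "h (i, m) = 1 \<and> (m = 0 \<or> h (i, m - 1) = 0 \<or> (i, m) \<in> B)"
  then obtain m' n where s: "m' \<le> m" "m < n" "((i, m'), (i, n)) \<in> strands h B"
    using strand_through[OF assms] by metis
  have "\<not> m' < m"
  proof
    assume "m' < m"
    moreover from this s have "(i, m) \<notin> B" unfolding strands_def by auto
    moreover have "h (i, m - 1) = 1" using strandsD(2)[OF s(3), of "m - 1"] s(2) \<open>m' < m\<close> by auto
    ultimately show False using * by auto
  qed
  then show "(i, m) \<in> Domain (strands h B)" using s by auto
qed

lemma Range_strands: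
  assumes "viable01 Z h"
  shows "(i, n) \<in> Range (strands h B) \<longleftrightarrow> n > 0 \<and> h (i, n - 1) = 1 \<and> (h (i, n) = 0 \<or> (i, n) \<in> B)"
proof
  assume "(i, n) \<in> Range (strands h B)"
  then show "n > 0 \<and> h (i, n - 1) = 1 \<and> (h (i, n) = 0 \<or> (i, n) \<in> B)"
    unfolding strands_def by auto
next
  assume *: "n > 0 \<and> h (i, n - 1) = 1 \<and> (h (i, n) = 0 \<or> (i, n) \<in> B)"
  then obtain m n' where s: "m \<le> n - 1" "n - 1 < n'" "((i, m), (i, n')) \<in> strands h B"
    using strand_through[OF assms] by metis
  have "\<not> n < n'"
  proof
    assume "n < n'"
    moreover from this s * have "(i, n) \<notin> B" unfolding strands_def by auto
    moreover have "h (i, n) = 1" using strandsD(2)[OF s(3), of n] s \<open>n < n'\<close> by auto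
    ultimately show False using * by auto
  qed
  then have "n' = n" using s(2) * by linarith
  then show "(i, n) \<in> Range (strands h B)" using s(3) by auto
qed

lemma moving_strands:
  assumes h: "viable01 Z h"
  shows "moving_sd Z (strands h B)"
proof -
  let ?\<mu> = "strands h B"
  have mem: "\<exists>i m n. x = (i, m) \<and> y = (i, n) \<and> m < n" if "(x, y) \<in> ?\<mu>" for x y
    using that unfolding strands_def by auto
  have 1: "y = y'" if *: "(x, y) \<in> ?\<mu>" "(x, y') \<in> ?\<mu>" for x y y'
  proof -
    obtain i m n where e: "x = (i, m)" "y = (i, n)" "m < n" using mem[OF *(1)] by blast
    moreover from e obtain n' where e': "y' = (i, n')" "m < n'" using mem[OF *(2)] by blast
    ultimately show "y = y'" using strands_inj[of i m n h B m n' m] * by simp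
  qed
  have 2: "x = x'" if *: "(x, y) \<in> ?\<mu>" "(x', y) \<in> ?\<mu>" for x x' y
  proof -
    obtain i m n where e: "x = (i, m)" "y = (i, n)" "m < n" using mem[OF *(1)] by blast
    moreover from e obtain m' where e': "x' = (i, m')" "m' < n" using mem[OF *(2)] by blast
    ultimately show "x = x'" using strands_inj[of i m n h B m' n "n - 1"] * by simp
  qed
  have 3: "x \<in> points Z \<and> y \<in> points Z \<and> pt_le x y \<and> x \<noteq> y" if xy: "(x, y) \<in> ?\<mu>" for x y
  proof -
    obtain i m n where e: "x = (i, m)" "y = (i, n)" "m < n" using mem[OF xy] by blast
    have "h (i, m) = 1" "h (i, n - 1) = 1"
      using strandsD(2)[OF xy, of m] strandsD(2)[OF xy, of "n - 1"] e by auto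
    then show ?thesis using viable01D(2)[OF h, of i m] viable01D(2)[OF h, of i "n - 1"] e
      by (auto simp: points_def pt_le_def)
  qed
  have "inj_on fst ?\<mu>" "inj_on snd ?\<mu>" using 1 2 unfolding inj_on_def by auto
  with 3 show ?thesis unfolding moving_sd_def strand_diagram_def by auto
qed

lemma sd_hgr_strands:
  assumes h: "viable01 Z h"
  shows "sd_hgr (strands h B) = h"
proof
  fix e :: "'i pt"
  obtain i k where e: "e = (i, k)" by (cases e)
  let ?A = "{(x, y). (x, y) \<in> strands h B \<and> pt_le x e \<and> pt_less e y}"
  show "sd_hgr (strands h B) e = h e"
  proof (cases "h e = 1")
    case True
    then obtain m n where s: "m \<le> k" "k < n" "((i, m), (i, n)) \<in> strands h B"
      using strand_through[OF h] e by metis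
    have "?A = {((i, m), (i, n))}"
    proof (intro equalityI subsetI)
      fix p assume "p \<in> ?A"
      then obtain m' n' where "p = ((i, m'), (i, n'))" "p \<in> strands h B" "m' \<le> k" "k < n'"
        by (auto simp: pt_le_def pt_less_def e)
      then show "p \<in> {((i, m), (i, n))}" using strands_inj[of i m n h B m' n' k] s by simp
    qed (use s e in \<open>auto simp: pt_le_def pt_less_def\<close>)
    then show ?thesis using True by (simp add: sd_hgr_def)
  next
    case False
    have "h e = 1" if "(x, y) \<in> ?A" for x y
      using that strandsD(2)[of x y h B k] strandsD(1)[of x y h B] e by (simp add: pt_le_def pt_less_def)
    with False have "?A = {}" by blast
    then have "sd_hgr (strands h B) e = 0" unfolding sd_hgr_def by (simp only: card.empty of_nat_0)
    then show ?thesis using False viable01D(1)[OF h, of e] by simp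
  qed
qed


text \<open>Multiplicity at most one keeps the strands from overlapping, so a strand can only stop
  at a gap or where the next one begins. The places of the second kind are exactly those in the
  domain and the range, which is why \<open>h\<close> and this set determine the moving
  strands.\<close>

lemma strands_unique:
  assumes \<mu>: "moving_sd Z \<mu>" and h: "viable01 Z (sd_hgr \<mu>)"
  shows "\<mu> = strands (sd_hgr \<mu>) (Domain \<mu> \<inter> Range \<mu>)"
proof -
  let ?h = "sd_hgr \<mu>" and ?B = "Domain \<mu> \<inter> Range \<mu>"
  have sd: "strand_diagram Z \<mu>" using \<mu> by (simp add: moving_sd_def)
  have mem: "\<exists>i m n. x = (i, m) \<and> y = (i, n) \<and> m < n" if "(x, y) \<in> \<mu>" for x y
  proof -
    have "pt_le x y" "x \<noteq> y" using \<mu> that unfolding moving_sd_def strand_diagram_def by auto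
    then show ?thesis by (cases x; cases y) (auto simp: less_le pt_le_def)
  qed
  have fin: "finite {(x, y). (x, y) \<in> \<mu> \<and> pt_le x e \<and> pt_less e y}" for e
    by (rule finite_subset[OF _ finite_strand_diagram[OF sd]]) auto
  have card: "card {(x, y). (x, y) \<in> \<mu> \<and> pt_le x e \<and> pt_less e y} \<le> 1" for e
  proof -
    have "sd_hgr \<mu> e \<le> 1" using h unfolding viable01_def by (metis order_refl zero_le_one)
    then show ?thesis by (simp add: sd_hgr_def)
  qed
  have cov: "m = m' \<and> n = n'" if "((i, m), (i, n)) \<in> \<mu>" "((i, m'), (i, n')) \<in> \<mu>"
    "m \<le> k" "k < n" "m' \<le> k" "k < n'" for i m n m' n' k
  proof -
    have "((i, m), (i, n)) \<in> {(x, y). (x, y) \<in> \<mu> \<and> pt_le x (i, k) \<and> pt_less (i, k) y}"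
      "((i, m'), (i, n')) \<in> {(x, y). (x, y) \<in> \<mu> \<and> pt_le x (i, k) \<and> pt_less (i, k) y}"
      using that by (auto simp: pt_le_def pt_less_def)
    then have "((i, m), (i, n)) = ((i, m'), (i, n'))"
      using card_le_Suc0_iff_eq[OF fin[of "(i, k)"]] card[of "(i, k)"] unfolding One_nat_def by blast
    then show ?thesis by simp
  qed
  have h1: "?h (i, k) = 1" if "((i, m), (i, n)) \<in> \<mu>" "m \<le> k" "k < n" for i m n k
  proof -
    have "((i, m), (i, n)) \<in> {(x, y). (x, y) \<in> \<mu> \<and> pt_le x (i, k) \<and> pt_less (i, k) y}"
      using that by (auto simp: pt_le_def pt_less_def)
    then have "?h (i, k) \<noteq> 0" using fin[of "(i, k)"] unfolding sd_hgr_def by (auto simp: card_eq_0_iff)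
    then show ?thesis using h unfolding viable01_def by blast
  qed
  have ex: "\<exists>m n. ((i, m), (i, n)) \<in> \<mu> \<and> m \<le> k \<and> k < n" if "?h (i, k) = 1" for i k
  proof -
    have "{(x, y). (x, y) \<in> \<mu> \<and> pt_le x (i, k) \<and> pt_less (i, k) y} \<noteq> {}"
      using that unfolding sd_hgr_def by (intro notI) simp
    then obtain x y where "(x, y) \<in> \<mu>" "pt_le x (i, k)" "pt_less (i, k) y" by auto
    then show ?thesis by (cases x; cases y) (auto simp: pt_le_def pt_less_def)
  qed
  have sub: "((i, m), (i, n)) \<in> strands ?h ?B" if s: "((i, m), (i, n)) \<in> \<mu>" for i m n
  proof -
    have mn: "m < n" using mem[OF s] by auto
    have 2: "(i, k) \<notin> ?B" if "m < k" "k < n" for k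
    proof
      assume "(i, k) \<in> ?B"
      then obtain y where y: "((i, k), y) \<in> \<mu>" by auto
      then obtain n' where "y = (i, n')" "k < n'" using mem by blast
      then show False using cov[of i m n k n' k] s y that by auto
    qed
    have 3: "m = 0 \<or> ?h (i, m - 1) = 0 \<or> (i, m) \<in> ?B"
    proof (rule ccontr)
      assume c: "\<not> ?thesis"
      then have "?h (i, m - 1) = 1" using viable01D(1)[OF h] by blast
      then obtain m' n' where s': "((i, m'), (i, n')) \<in> \<mu>" "m' \<le> m - 1" "m - 1 < n'" using ex by blast
      have "n' = m"
      proof (rule ccontr)
        assume "n' \<noteq> m"
        then have "m < n'" using s' c by simp
        then have "m' = m" using cov[OF s s'(1), of m] s' mn by linarith
        moreover have "m \<noteq> 0" using c by simp
        ultimately show False using s'(2) by linarith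
      qed
      then have "(i, m) \<in> ?B" using s s' by blast
      then show False using c by blast
    qed
    have 4: "?h (i, n) = 0 \<or> (i, n) \<in> ?B"
    proof (rule ccontr)
      assume c: "\<not> ?thesis"
      then have "?h (i, n) = 1" using viable01D(1)[OF h] by blast
      then obtain m' n' where s': "((i, m'), (i, n')) \<in> \<mu>" "m' \<le> n" "n < n'" using ex by blast
      have "m' = n"
      proof (rule ccontr)
        assume "m' \<noteq> n"
        then have "n = n'" using cov[OF s s'(1), of "n - 1"] s' mn by linarith
        then show False using s' by simp
      qed
      then have "(i, n) \<in> ?B" using s s' by blast
      then show False using c by blast
    qed
    from mn h1[OF s] 2 3 4 show ?thesis unfolding strands_def by auto
  qed
  show ?thesis
  proof (intro equalityI subrelI)
    fix x y assume xy: "(x, y) \<in> \<mu>"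
    then obtain i m n where "x = (i, m)" "y = (i, n)" using mem by blast
    then show "(x, y) \<in> strands ?h ?B" using sub xy by simp
  next
    fix x y assume xy: "(x, y) \<in> strands ?h ?B"
    then obtain i m n where e: "x = (i, m)" "y = (i, n)" "m < n" and "?h (i, m) = 1"
      unfolding strands_def by auto
    then obtain m' n' where s: "((i, m'), (i, n')) \<in> \<mu>" "m' \<le> m" "m < n'" using ex by blast
    have "m = m' \<and> n = n'" using strands_inj[of i m n ?h ?B m' n' m] sub[OF s(1)] s xy e by auto
    then show "(x, y) \<in> \<mu>" using s e by simp
  qed
qed

lemma Domain_Int_Range_strands:
  assumes "viable01 Z h" "B \<subseteq> full Z h"
  shows "Domain (strands h B) \<inter> Range (strands h B) = B"
proof (intro equalityI subsetI)
  fix x assume "x \<in> Domain (strands h B) \<inter> Range (strands h B)"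
  then show "x \<in> B" by (cases x) (auto simp: Domain_strands[OF assms(1)] Range_strands[OF assms(1)])
next
  fix x assume "x \<in> B"
  moreover from this have "x \<in> full Z h" using assms(2) by blast
  ultimately show "x \<in> Domain (strands h B) \<inter> Range (strands h B)"
    by (cases x) (auto simp: Domain_strands[OF assms(1)] Range_strands[OF assms(1)] full_def places_def)
qed

lemma strands_eqI:
  assumes "moving_sd Z \<mu>" "sd_hgr \<mu> = h" "viable01 Z h" "Domain \<mu> \<inter> Range \<mu> = B"
  shows "\<mu> = strands h B"
  using strands_unique[OF assms(1)] assms by simp

end

section \<open>Terms of diagrams\<close>

definition sect :: "'i arc_diagram \<Rightarrow> nat set \<Rightarrow> 'i pt set \<Rightarrow> bool" where
  "sect Z s A \<longleftrightarrow> A \<subseteq> points Z \<and> inj_on (lab Z) (A \<inter> places Z) \<and> lab Z ` (A \<inter> places Z) = s"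

text \<open>The sets of horizontal strands that complete the moving strands \<open>\<mu>\<close> to
  a term of the diagram from \<open>s\<close> to \<open>t\<close>; the diagram is nonzero iff there
  is one (\<open>diag_eq_0\<close>).\<close>

definition hset :: "'i arc_diagram \<Rightarrow> nat set \<Rightarrow> nat set \<Rightarrow> 'i sd \<Rightarrow> 'i pt set set" where
  "hset Z s t \<mu> = {U. U \<subseteq> points Z - (Domain \<mu> \<union> Range \<mu>) \<and> sect Z s (Domain \<mu> \<union> U) \<and>
     sect Z t (Range \<mu> \<union> U)}"

lemma crossings_Id_on [simp]: "crossings (Id_on S) = {}"
  by (auto simp: crossings_def pt_less_def)

lemma sd_mult_Id_on:
  "sd_mult (Id_on S) \<nu> = (if S = Domain \<nu> then sd_of \<nu> else 0)"
  "sd_mult \<nu> (Id_on S) = (if S = Range \<nu> then sd_of \<nu> else 0)"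
proof -
  have "Id_on (Domain \<nu>) O \<nu> = \<nu>" "\<nu> O Id_on (Range \<nu>) = \<nu>" by auto
  moreover have "inv_count (Id_on S) = 0" by (simp add: inv_count_def)
  ultimately show "sd_mult (Id_on S) \<nu> = (if S = Domain \<nu> then sd_of \<nu> else 0)"
    "sd_mult \<nu> (Id_on S) = (if S = Range \<nu> then sd_of \<nu> else 0)"
    by (auto simp: sd_mult_def)
qed

lemma alg_mult_el:
  "finite A \<Longrightarrow> finite B \<Longrightarrow> el A \<odot> el B = (\<Sum>\<mu>\<in>A. \<Sum>\<nu>\<in>B. sd_mult \<mu> \<nu>)"
  by (simp add: alg_mult_def)

lemma el_filter: "finite A \<Longrightarrow> (\<Sum>x\<in>A. if P x then Poly_Mapping.single x 1 else 0) = el {x \<in> A. P x}"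
  by (simp add: el_def sum.inter_filter)

text \<open>Different horizontal sets give different terms, so nothing cancels modulo 2 when a
  diagram is written as a sum over \<open>hset\<close>.\<close>

lemma inj_on_add_Id: "inj_on (\<lambda>U. \<mu> \<union> Id_on U) {U. U \<inter> (Domain \<mu> \<union> Range \<mu>) = {}}"
proof (rule inj_on_inverseI)
  fix U assume "U \<in> {U. U \<inter> (Domain \<mu> \<union> Range \<mu>) = {}}"
  then have "U \<inter> Domain \<mu> = {}" by blast
  then show "Domain (\<mu> \<union> Id_on U) - Domain \<mu> = U" by (simp add: Domain_Un_eq) blast
qed

lemma pt_le_less_neq: "pt_le x e \<Longrightarrow> pt_less e y \<Longrightarrow> x \<noteq> y"
  by (auto simp: pt_le_def pt_less_def)

lemma sd_hgr_minus_Id: "sd_hgr (\<kappa> - Id) = sd_hgr \<kappa>"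
proof
  fix e
  have "{(x, y). (x, y) \<in> \<kappa> - Id \<and> pt_le x e \<and> pt_less e y} = {(x, y). (x, y) \<in> \<kappa> \<and> pt_le x e \<and> pt_less e y}"
    using pt_le_less_neq[of _ e] by blast
  then show "sd_hgr (\<kappa> - Id) e = sd_hgr \<kappa> e" by (simp only: sd_hgr_def)
qed

lemma sd_hgr_add_Id: "sd_hgr (\<mu> \<union> Id_on U) = sd_hgr \<mu>"
proof -
  have "\<mu> \<union> Id_on U - Id = \<mu> - Id" by blast
  then show ?thesis using sd_hgr_minus_Id by metis
qed

lemma moving_sd_minus_Id: "moving_sd Z \<mu> \<Longrightarrow> (\<mu> \<union> Id_on U) - Id = \<mu>"
  unfolding moving_sd_def by blast

context pre_arc_diagram
begin

lemma finite_sects: "finite {S. sect Z s S}"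
  by (rule finite_subset[of _ "Pow (points Z)"]) (auto simp: sect_def)

lemma finite_hset [simp]: "finite (hset Z s t \<mu>)"
  by (rule finite_subset[of _ "Pow (points Z)"]) (auto simp: hset_def)

lemma idem_el: "idem Z s = el (Id_on ` {S. sect Z s S})"
proof -
  have "inj_on Id_on {S. sect Z s S}" by (metis Domain_Id_on inj_onI)
  then show ?thesis unfolding idem_def sect_def by (subst sum_el_image[symmetric]) (simp_all add: sect_def)
qed

lemma idem_mult_left: "finite B \<Longrightarrow> idem Z s \<odot> el B = el {\<nu> \<in> B. sect Z s (Domain \<nu>)}"
proof -
  assume B: "finite B"
  have "inj_on Id_on {S. sect Z s S}" by (metis Domain_Id_on inj_onI)
  then have "idem Z s \<odot> el B = (\<Sum>S | sect Z s S. \<Sum>\<nu>\<in>B. sd_mult (Id_on S) \<nu>)"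
    unfolding idem_el using B finite_sects by (subst alg_mult_el) (simp_all add: sum.reindex)
  also have "\<dots> = (\<Sum>\<nu>\<in>B. \<Sum>S | sect Z s S. sd_mult (Id_on S) \<nu>)" by (rule sum.swap)
  also have "\<dots> = (\<Sum>\<nu>\<in>B. if sect Z s (Domain \<nu>) then sd_of \<nu> else 0)"
    using finite_sects by (intro sum.cong) (auto simp: sd_mult_Id_on sum.delta)
  finally show ?thesis using B by (simp add: el_filter)
qed

lemma idem_mult_right: "finite B \<Longrightarrow> el B \<odot> idem Z s = el {\<nu> \<in> B. sect Z s (Range \<nu>)}"
proof -
  assume B: "finite B"
  have "inj_on Id_on {S. sect Z s S}" by (metis Domain_Id_on inj_onI)
  then have "el B \<odot> idem Z s = (\<Sum>\<nu>\<in>B. \<Sum>S | sect Z s S. sd_mult \<nu> (Id_on S))"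
    unfolding idem_el using B finite_sects by (subst alg_mult_el) (simp_all add: sum.reindex)
  also have "\<dots> = (\<Sum>\<nu>\<in>B. if sect Z s (Range \<nu>) then sd_of \<nu> else 0)"
    using finite_sects by (intro sum.cong) (auto simp: sd_mult_Id_on sum.delta)
  finally show ?thesis using B by (simp add: el_filter)
qed

lemma diag_el:
  assumes "\<mu> \<subseteq> points Z \<times> points Z"
  shows "diag Z s t \<mu> = el ((\<lambda>U. \<mu> \<union> Id_on U) ` hset Z s t \<mu>)"
proof -
  let ?P = "Pow (points Z - (Domain \<mu> \<union> Range \<mu>))" and ?F = "\<lambda>U. \<mu> \<union> Id_on U"
  have "inj_on ?F ?P" by (rule inj_on_subset[OF inj_on_add_Id]) auto
  then have "add_horizontal Z \<mu> = el (?F ` ?P)"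
    unfolding add_horizontal_def by (rule sum_el_image)
  then have "diag Z s t \<mu> = el {\<kappa> \<in> {\<kappa> \<in> ?F ` ?P. sect Z s (Domain \<kappa>)}. sect Z t (Range \<kappa>)}"
    unfolding diag_def by (simp add: idem_mult_left idem_mult_right)
  also have "{\<kappa> \<in> {\<kappa> \<in> ?F ` ?P. sect Z s (Domain \<kappa>)}. sect Z t (Range \<kappa>)} =
      ?F ` {U \<in> ?P. sect Z s (Domain (?F U)) \<and> sect Z t (Range (?F U))}"
    by blast
  also have "{U \<in> ?P. sect Z s (Domain (?F U)) \<and> sect Z t (Range (?F U))} = hset Z s t \<mu>"
    unfolding hset_def by (simp add: Domain_Un_eq Range_Un_eq Range_Id_on)
  finally show ?thesis .
qed

lemma moving_sdD:
  assumes "moving_sd Z \<mu>"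
  shows "strand_diagram Z \<mu>" "\<mu> \<subseteq> points Z \<times> points Z" "finite \<mu>"
  using assms finite_strand_diagram unfolding moving_sd_def strand_diagram_def by auto

lemma terms_diag: "moving_sd Z \<mu> \<Longrightarrow> terms (diag Z s t \<mu>) = (\<lambda>U. \<mu> \<union> Id_on U) ` hset Z s t \<mu>"
  by (simp add: diag_el moving_sdD)

lemma diag_eq_0: "moving_sd Z \<mu> \<Longrightarrow> diag Z s t \<mu> = 0 \<longleftrightarrow> hset Z s t \<mu> = {}"
  by (simp add: diag_el moving_sdD el_eq_0)

lemma diag_sum: "moving_sd Z \<mu> \<Longrightarrow> diag Z s t \<mu> = (\<Sum>U\<in>hset Z s t \<mu>. sd_of (\<mu> \<union> Id_on U))"
  unfolding diag_el[OF moving_sdD(2)]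
  by (rule sum_el_image[symmetric], rule inj_on_subset[OF inj_on_add_Id]) (auto simp: hset_def)

lemma hset_nonempty_subset: "hset Z s t \<mu> \<noteq> {} \<Longrightarrow> s \<subseteq> pairs Z \<and> t \<subseteq> pairs Z"
proof -
  assume "hset Z s t \<mu> \<noteq> {}"
  then obtain U where "sect Z s (Domain \<mu> \<union> U)" "sect Z t (Range \<mu> \<union> U)" by (auto simp: hset_def)
  moreover have "s \<subseteq> pairs Z" if "sect Z s A" for s A using that by (auto simp: sect_def pairs_def)
  ultimately show ?thesis by simp
qed

lemma diagrams_iff:
  "D \<in> diagrams Z \<longleftrightarrow> (\<exists>s t \<mu>. moving_sd Z \<mu> \<and> hset Z s t \<mu> \<noteq> {} \<and> D = diag Z s t \<mu>)"
proof
  assume "D \<in> diagrams Z"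
  then obtain s t \<mu> where "moving_sd Z \<mu>" "D = diag Z s t \<mu>" "D \<noteq> 0"
    unfolding diagrams_def moving_sd_def by blast
  then show "\<exists>s t \<mu>. moving_sd Z \<mu> \<and> hset Z s t \<mu> \<noteq> {} \<and> D = diag Z s t \<mu>"
    using diag_eq_0 by blast
next
  assume "\<exists>s t \<mu>. moving_sd Z \<mu> \<and> hset Z s t \<mu> \<noteq> {} \<and> D = diag Z s t \<mu>"
  then obtain s t \<mu> where *: "moving_sd Z \<mu>" "hset Z s t \<mu> \<noteq> {}" "D = diag Z s t \<mu>" by blast
  then have "s \<subseteq> pairs Z" "t \<subseteq> pairs Z" "diag Z s t \<mu> \<noteq> 0" using hset_nonempty_subset diag_eq_0 by auto
  with * show "D \<in> diagrams Z" unfolding diagrams_def moving_sd_def by blast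
qed

lemma term_of_diag:
  assumes \<mu>: "moving_sd Z \<mu>" and \<kappa>: "\<kappa> \<in> terms (diag Z s t \<mu>)"
  shows "\<kappa> - Id = \<mu>" "lab Z ` (Domain \<kappa> \<inter> places Z) = s" "lab Z ` (Range \<kappa> \<inter> places Z) = t"
    "sd_hgr \<kappa> = sd_hgr \<mu>" "strand_diagram Z \<kappa>"
proof -
  obtain U where U: "U \<in> hset Z s t \<mu>" "\<kappa> = \<mu> \<union> Id_on U" using assms by (auto simp: terms_diag)
  show "\<kappa> - Id = \<mu>" using U \<mu> by (simp add: moving_sd_minus_Id)
  show "lab Z ` (Domain \<kappa> \<inter> places Z) = s" "lab Z ` (Range \<kappa> \<inter> places Z) = t"
    using U by (auto simp: hset_def sect_def Domain_Un_eq Range_Un_eq)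
  show "sd_hgr \<kappa> = sd_hgr \<mu>" using U by (simp add: sd_hgr_add_Id)
  have UP: "U \<subseteq> points Z" "U \<inter> Domain \<mu> = {}" "U \<inter> Range \<mu> = {}" using U(1) by (auto simp: hset_def)
  note inj = strand_diagram_inj[OF moving_sdD(1)[OF \<mu>]]
  have "v = v'" if "(u, v) \<in> \<kappa>" "(u, v') \<in> \<kappa>" for u v v'
    using that inj(1) UP unfolding U(2) by blast
  moreover have "u = u'" if "(u, v) \<in> \<kappa>" "(u', v) \<in> \<kappa>" for u u' v
    using that inj(2) UP unfolding U(2) by blast
  ultimately have "inj_on fst \<kappa>" "inj_on snd \<kappa>"
    unfolding inj_on_def by (metis prod.collapse)+
  moreover have "\<kappa> \<subseteq> points Z \<times> points Z" using moving_sdD(2)[OF \<mu>] UP unfolding U(2) by blast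
  moreover have "\<forall>(x, y)\<in>\<kappa>. pt_le x y"
    using moving_sdD(1)[OF \<mu>] unfolding U(2) strand_diagram_def by (auto simp: pt_le_def)
  ultimately show "strand_diagram Z \<kappa>" unfolding strand_diagram_def by blast
qed

lemma some_term_in: "D \<noteq> 0 \<Longrightarrow> some_term D \<in> terms D"
  unfolding some_term_def by (metis keys_eq_empty ex_in_conv someI)

lemma data_of_diag:
  assumes "moving_sd Z \<mu>" "diag Z s t \<mu> \<noteq> 0"
  shows "moving (diag Z s t \<mu>) = \<mu>" "src Z (diag Z s t \<mu>) = s" "tgt Z (diag Z s t \<mu>) = t"
    "hgrading (diag Z s t \<mu>) = sd_hgr \<mu>" "hdata_of Z (diag Z s t \<mu>) = (sd_hgr \<mu>, s, t)"
  using term_of_diag[OF assms(1) some_term_in[OF assms(2)]]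
  by (simp_all add: moving_def src_def tgt_def hgrading_def hdata_of_def)

text \<open>One term reveals its whole diagram: removing the identity gives the moving strands, and
  the labels of domain and range give the idempotents.\<close>

lemma diagrams_disjoint:
  assumes "D \<in> diagrams Z" "D' \<in> diagrams Z" "\<kappa> \<in> terms D" "\<kappa> \<in> terms D'"
  shows "D = D'"
proof -
  have "E = diag Z (lab Z ` (Domain \<kappa> \<inter> places Z)) (lab Z ` (Range \<kappa> \<inter> places Z)) (\<kappa> - Id)"
    if E: "E \<in> diagrams Z" "\<kappa> \<in> terms E" for E
  proof -
    obtain s t \<mu> where *: "moving_sd Z \<mu>" "E = diag Z s t \<mu>"
      using E(1)[unfolded diagrams_iff] by (elim exE conjE)
    show ?thesis using term_of_diag[OF *(1) E(2)[unfolded *(2)]] *(2) by simp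
  qed
  from this[OF assms(1,3)] this[OF assms(2,4)] show ?thesis by simp
qed

lemma term_of_diagram:
  assumes "D \<in> diagrams Z" "\<kappa> \<in> terms D"
  shows "sd_hgr \<kappa> = hgrading D" "lab Z ` (Domain \<kappa> \<inter> places Z) = src Z D"
    "lab Z ` (Range \<kappa> \<inter> places Z) = tgt Z D" "strand_diagram Z \<kappa>"
proof -
  obtain s t \<mu> where *: "moving_sd Z \<mu>" "D = diag Z s t \<mu>"
    using assms(1)[unfolded diagrams_iff] by (elim exE conjE)
  have "diag Z s t \<mu> \<noteq> 0" using assms(2) *(2) by (metis empty_iff keys_zero)
  note d = data_of_diag[OF *(1) this, folded *(2)]
  note t = term_of_diag[OF *(1) assms(2)[unfolded *(2)]]
  show "sd_hgr \<kappa> = hgrading D" "lab Z ` (Domain \<kappa> \<inter> places Z) = src Z D"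
    "lab Z ` (Range \<kappa> \<inter> places Z) = tgt Z D" "strand_diagram Z \<kappa>"
    by (simp_all only: d t)
qed

end

context pre_arc_diagram
begin

section \<open>The differential of viable diagrams\<close>

lemma full_insert_strands:
  assumes h: "viable01 Z h" and a: "a \<in> full Z h"
  shows "Domain (strands h (insert a B)) = insert a (Domain (strands h B))"
    "Range (strands h (insert a B)) = insert a (Range (strands h B))"
proof -
  obtain i m where [simp]: "a = (i, m)" by (cases a)
  have "h (i, m) = 1" "h (i, m - 1) = 1" "m > 0" using a by (auto simp: full_def places_def)
  then show "Domain (strands h (insert a B)) = insert a (Domain (strands h B))"
    "Range (strands h (insert a B)) = insert a (Range (strands h B))"
    by (intro set_eqI; case_tac x; auto simp: Domain_strands[OF h] Range_strands[OF h])+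
qed

lemma not_full_insert:
  assumes h: "viable01 Z h" and a: "a \<in> full Z h" "a \<notin> B"
  shows "a \<notin> Domain (strands h B)" "a \<notin> Range (strands h B)"
  using a by (cases a; auto simp: Domain_strands[OF h] Range_strands[OF h] full_def places_def)+

lemma covered_horizontal:
  assumes h: "viable01 Z h" and a: "a \<notin> Domain (strands h B)" "h a = 1"
  shows "a \<in> full Z h - B"
proof -
  obtain i m where [simp]: "a = (i, m)" by (cases a)
  have "m > 0" "h (i, m - 1) = 1" "(i, m) \<notin> B"
    using a viable01D(1)[OF h] by (auto simp: Domain_strands[OF h])
  then show ?thesis using a viable01D(2)[OF h, of i m] by (simp add: full_def places_def)
qed

lemma strand_over:
  assumes h: "viable01 Z h" and a: "a \<notin> Domain (strands h B)" "h a = 1"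
  shows "\<exists>!p. p \<in> strands h B \<and> pt_less (fst p) a \<and> pt_less a (snd p)"
proof -
  obtain i k where e: "a = (i, k)" by (cases a)
  obtain m n where s: "m \<le> k" "k < n" "((i, m), (i, n)) \<in> strands h B"
    using strand_through[OF h] a(2) e by metis
  have "m \<noteq> k" using s a e by auto
  show ?thesis
  proof (rule ex1I)
    show "((i, m), (i, n)) \<in> strands h B \<and> pt_less (fst ((i, m), (i, n))) a \<and> pt_less a (snd ((i, m), (i, n)))"
      using s \<open>m \<noteq> k\<close> e by (simp add: pt_less_def)
    fix p assume p: "p \<in> strands h B \<and> pt_less (fst p) a \<and> pt_less a (snd p)"
    then obtain m' n' where p': "p = ((i, m'), (i, n'))" "m' < k" "k < n'"
      by (cases p) (auto simp: pt_less_def e)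
    then show "p = ((i, m), (i, n))" using strands_inj[of i m n h B m' n' k] s p by simp
  qed
qed

definition over :: "'i hgr \<Rightarrow> 'i pt set \<Rightarrow> 'i pt \<Rightarrow> 'i pt \<times> 'i pt" where
  "over h B a = (THE p. p \<in> strands h B \<and> pt_less (fst p) a \<and> pt_less a (snd p))"

text \<open>Two moving strands never cross, since that would need a step covered twice. A crossing
  is thus a horizontal strand at a covered place together with the unique strand running past
  it.\<close>

lemma crossings_term:
  assumes h: "viable01 Z h" and U: "U \<inter> Domain (strands h B) = {}"
  shows "crossings (strands h B \<union> Id_on U) = (\<lambda>a. (over h B a, (a, a))) ` {a \<in> U. h a = 1}"
proof (intro equalityI subsetI)
  fix c assume c: "c \<in> crossings (strands h B \<union> Id_on U)"
  obtain u v where uv: "c = (u, v)" by (cases c)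
  obtain x x' where u: "u = (x, x')" by (cases u)
  obtain y y' where v: "v = (y, y')" by (cases v)
  note e = uv[unfolded u v]
  have xx: "(x, x') \<in> strands h B \<or> x = x' \<and> x \<in> U" and yy: "(y, y') \<in> strands h B \<or> y = y' \<and> y \<in> U"
    and less: "pt_less x y" "pt_less y' x'"
    using c unfolding crossings_def e by auto
  have yl: "fst y = fst y' \<and> snd y \<le> snd y'" using yy strandsD(1)[of y y' h B] by auto
  have x: "(x, x') \<in> strands h B" using xx yl less by (auto simp: pt_less_def)
  have y: "y = y' \<and> y \<in> U"
  proof (rule ccontr)
    assume "\<not> ?thesis"
    then have y: "(y, y') \<in> strands h B" using yy by blast
    have "snd x \<le> snd y" "snd y < snd x'" "snd y < snd y'" using less yl strandsD(1)[OF y] by (auto simp: pt_less_def)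
    then have "snd x = snd y" using strands_inj[of "fst x" "snd x" "snd x'" h B "snd y" "snd y'" "snd y"]
      x y strandsD(1)[OF x] strandsD(1)[OF y] less(1) by (simp add: pt_less_def) (metis prod.collapse)
    then show False using less by (simp add: pt_less_def)
  qed
  have "h (fst x, snd y) = 1" "fst x = fst y"
    using strandsD(2)[OF x, of "snd y"] less yl y by (simp_all add: pt_less_def)
  then have hy: "h y = 1" by simp
  have "y \<notin> Domain (strands h B)" using y U by blast
  note ex1 = strand_over[OF h this hy]
  have "(x, x') \<in> strands h B \<and> pt_less (fst (x, x')) y \<and> pt_less y (snd (x, x'))"
    using x less y by simp
  with ex1 have "over h B y = (x, x')"
    unfolding over_def by (rule the1_equality)
  then have "c = (over h B y, (y, y))" using e y by simp
  then show "c \<in> (\<lambda>a. (over h B a, (a, a))) ` {a \<in> U. h a = 1}" using y hy by blast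
next
  fix c assume "c \<in> (\<lambda>a. (over h B a, (a, a))) ` {a \<in> U. h a = 1}"
  then obtain a where a: "a \<in> U" "h a = 1" "c = (over h B a, (a, a))" by blast
  then have "a \<notin> Domain (strands h B)" using U by blast
  from theI'[OF strand_over[OF h this a(2)]]
  have "over h B a \<in> strands h B \<and> pt_less (fst (over h B a)) a \<and> pt_less a (snd (over h B a))"
    unfolding over_def .
  moreover obtain x x' where "over h B a = (x, x')" by (cases "over h B a")
  ultimately show "c \<in> crossings (strands h B \<union> Id_on U)" using a(1,3)
    unfolding crossings_def by (simp add: Id_onI)
qed

lemma inv_count_term:
  assumes "viable01 Z h" "U \<inter> Domain (strands h B) = {}"
  shows "inv_count (strands h B \<union> Id_on U) = card {a \<in> U. h a = 1}"
  unfolding inv_count_def crossings_term[OF assms] by (rule card_image) (auto intro: inj_onI)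

text \<open>Cutting adds \<open>a\<close> to both the domain and the range, so the grading is
  unchanged and the set of broken places grows by \<open>a\<close>; the uniqueness of strands with
  given grading and breaks does the rest.\<close>

lemma split_strand:
  assumes h: "viable01 Z h" and B: "B \<subseteq> full Z h" and a: "a \<in> full Z h" "a \<notin> B"
    and o: "over h B a = (x, x')"
  shows "strands h B - {(x, x')} \<union> {(x, a), (a, x')} = strands h (insert a B)"
proof -
  let ?\<mu> = "strands h B" and ?\<nu> = "strands h B - {(x, x')} \<union> {(x, a), (a, x')}"
  have nD: "a \<notin> Domain ?\<mu>" "a \<notin> Range ?\<mu>" using not_full_insert[OF h a] by auto
  have ha: "h a = 1" using a by (simp add: full_def)
  have ov: "(x, x') \<in> ?\<mu>" "pt_less x a" "pt_less a x'"
    using theI'[OF strand_over[OF h nD(1) ha]] o unfolding over_def by simp_all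
  have m: "moving_sd Z ?\<mu>" by (rule moving_strands[OF h])
  have D: "Domain ?\<nu> = insert a (Domain ?\<mu>)" and R: "Range ?\<nu> = insert a (Range ?\<mu>)"
    using ov strand_diagram_inj[OF moving_sdD(1)[OF m]] by blast+
  have aP: "a \<in> points Z" using a places_subset by (auto simp: full_def)
  have P: "?\<mu> \<subseteq> points Z \<times> points Z" using moving_sdD(2)[OF m] .
  note inj = strand_diagram_inj[OF moving_sdD(1)[OF m]]
  have "v = v'" if "(u, v) \<in> ?\<nu>" "(u, v') \<in> ?\<nu>" for u v v'
    using that inj(1) nD ov(1) by blast
  moreover have "u = u'" if "(u, v) \<in> ?\<nu>" "(u', v) \<in> ?\<nu>" for u u' v
    using that inj(2) nD ov(1) by blast
  ultimately have "inj_on fst ?\<nu>" "inj_on snd ?\<nu>"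
    unfolding inj_on_def by (metis prod.collapse)+
  moreover have "pt_le u v \<and> u \<noteq> v" if "(u, v) \<in> ?\<nu>" for u v
    using m ov that unfolding moving_sd_def strand_diagram_def by (auto simp: pt_le_def pt_less_def)
  moreover have "?\<nu> \<subseteq> points Z \<times> points Z" using P aP ov(1) by blast
  ultimately have n: "moving_sd Z ?\<nu>"
    unfolding moving_sd_def strand_diagram_def by blast
  have fin: "finite (Domain ?\<mu>)" "finite (Range ?\<mu>)"
    using moving_sdD(3)[OF m] by (simp_all add: finite_Domain finite_Range)
  have "sd_hgr ?\<nu> e = sd_hgr ?\<mu> e" for e
  proof -
    have "{y \<in> insert a A. pt_le y e} = (if pt_le a e then insert a {y \<in> A. pt_le y e} else {y \<in> A. pt_le y e})" for A
      by auto
    then show ?thesis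
      unfolding sd_hgr_Domain_Range[OF moving_sdD(1)[OF n]] sd_hgr_Domain_Range[OF moving_sdD(1)[OF m]] D R
      using fin nD by simp
  qed
  then have "sd_hgr ?\<nu> = h" using sd_hgr_strands[OF h] by (metis ext)
  moreover have "Domain ?\<nu> \<inter> Range ?\<nu> = insert a B"
    unfolding D R using Domain_Int_Range_strands[OF h B] nD by blast
  ultimately show ?thesis by (rule strands_eqI[OF n _ h])
qed

text \<open>Resolving the crossing at \<open>a\<close> removes one horizontal strand at a covered
  place and nothing else from the inversion count. Every resolution therefore lowers it by exactly
  1, and the differential runs over all crossings.\<close>

lemma sd_diff_term:
  assumes h: "viable01 Z h" and B: "B \<subseteq> full Z h" and U: "U \<inter> (Domain (strands h B) \<union> Range (strands h B)) = {}"
    and fin: "finite U"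
  shows "sd_diff (strands h B \<union> Id_on U) =
    (\<Sum>a | a \<in> U \<and> h a = 1. sd_of (strands h (insert a B) \<union> Id_on (U - {a})))"
proof -
  let ?\<kappa> = "strands h B \<union> Id_on U" and ?c = "\<lambda>a. (over h B a, (a, a))"
  have U': "U \<inter> Domain (strands h B) = {}" using U by blast
  have res: "resolve ?\<kappa> (?c a) = strands h (insert a B) \<union> Id_on (U - {a})"
    and inv: "inv_count (resolve ?\<kappa> (?c a)) + 1 = inv_count ?\<kappa>" if a: "a \<in> U" "h a = 1" for a
  proof -
    have nD: "a \<notin> Domain (strands h B)" using U a by blast
    have af: "a \<in> full Z h" "a \<notin> B" using covered_horizontal[OF h nD a(2)] by auto
    obtain x x' where o: "over h B a = (x, x')" by (cases "over h B a")
    have ov: "(x, x') \<in> strands h B" "pt_less x a" "pt_less a x'"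
      using theI'[OF strand_over[OF h nD a(2)]] o unfolding over_def by simp_all
    have "(x, x') \<notin> Id_on U" using ov U by auto
    moreover have "(a, a) \<notin> strands h B" using nD by auto
    ultimately show r: "resolve ?\<kappa> (?c a) = strands h (insert a B) \<union> Id_on (U - {a})"
      unfolding split_strand[OF h B af o, symmetric] resolve_def o by auto
    have "(U - {a}) \<inter> Domain (strands h (insert a B)) = {}"
      using U full_insert_strands[OF h af(1)] by auto
    then have "inv_count (resolve ?\<kappa> (?c a)) = card {b \<in> U - {a}. h b = 1}"
      unfolding r by (rule inv_count_term[OF h])
    also have "{b \<in> U - {a}. h b = 1} = {b \<in> U. h b = 1} - {a}" by auto
    finally show "inv_count (resolve ?\<kappa> (?c a)) + 1 = inv_count ?\<kappa>"
      using a fin card_Suc_Diff1[of "{b \<in> U. h b = 1}" a] by (simp add: inv_count_term[OF h U'])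
  qed
  have "sd_diff ?\<kappa> = (\<Sum>c \<in> ?c ` {a \<in> U. h a = 1}. sd_of (resolve ?\<kappa> c))"
    unfolding sd_diff_def crossings_term[OF h U'] using inv by (intro sum.cong) auto
  also have "\<dots> = (\<Sum>a \<in> {a \<in> U. h a = 1}. sd_of (resolve ?\<kappa> (?c a)))"
    by (subst sum.reindex) (auto intro: inj_onI)
  also have "\<dots> = (\<Sum>a \<in> {a \<in> U. h a = 1}. sd_of (strands h (insert a B) \<union> Id_on (U - {a})))"
    using res by (intro sum.cong) auto
  finally show ?thesis by simp
qed

definition Dg :: "'i hgr \<Rightarrow> nat set \<Rightarrow> nat set \<Rightarrow> 'i pt set \<Rightarrow> 'i elt" where
  "Dg h s t B = diag Z s t (strands h B)"

text \<open>The double sum over horizontal sets and covered places in them is exchanged: a set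
  containing \<open>a\<close> corresponds to the same set without \<open>a\<close> once
  \<open>a\<close> has become the common end of two strands. Summands whose idempotents do not allow
  the break are zero by themselves.\<close>

lemma diff_Dg:
  assumes h: "viable01 Z h" and B: "B \<subseteq> full Z h"
  shows "\<partial> (Dg h s t B) = (\<Sum>a \<in> full Z h - B. Dg h s t (insert a B))"
proof -
  let ?F = "\<lambda>a U. sd_of (strands h (insert a B) \<union> Id_on (U - {a}))"
  let ?H = "\<lambda>B. hset Z s t (strands h B)"
  have fin: "finite (full Z h - B)" by (rule finite_subset[OF _ finite_places]) (auto simp: full_def)
  have U: "U \<inter> (Domain (strands h B) \<union> Range (strands h B)) = {}" "finite U" if "U \<in> ?H B" for U
    using that by (auto simp: hset_def intro: finite_subset[OF _ finite_points])
  have "\<partial> (Dg h s t B) = (\<Sum>U\<in>?H B. sd_diff (strands h B \<union> Id_on U))"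
    unfolding Dg_def diag_sum[OF moving_strands[OF h]] by (simp add: diff_sum) (simp add: diff_lext)
  also have "\<dots> = (\<Sum>U\<in>?H B. \<Sum>a | a \<in> U \<and> h a = 1. ?F a U)"
    by (intro sum.cong sd_diff_term[OF h B] U) auto
  also have "\<dots> = (\<Sum>U\<in>?H B. \<Sum>a | a \<in> full Z h - B \<and> a \<in> U. ?F a U)"
  proof (rule sum.cong[OF refl])
    fix U assume *: "U \<in> ?H B"
    have "{a \<in> U. h a = 1} = {a \<in> full Z h - B. a \<in> U}"
    proof (intro equalityI subsetI)
      fix a assume a: "a \<in> {a \<in> U. h a = 1}"
      then have "a \<notin> Domain (strands h B)" using U(1)[OF *] by blast
      then show "a \<in> {a \<in> full Z h - B. a \<in> U}" using covered_horizontal[OF h] a by blast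
    qed (auto simp: full_def)
    then show "(\<Sum>a | a \<in> U \<and> h a = 1. ?F a U) = (\<Sum>a | a \<in> full Z h - B \<and> a \<in> U. ?F a U)"
      by simp
  qed
  also have "\<dots> = (\<Sum>a\<in>full Z h - B. \<Sum>U | U \<in> ?H B \<and> a \<in> U. ?F a U)"
    using fin by (rule sum.swap_restrict[OF finite_hset])
  also have "\<dots> = (\<Sum>a\<in>full Z h - B. Dg h s t (insert a B))"
  proof (intro sum.cong refl)
    fix a assume a: "a \<in> full Z h - B"
    then have af: "a \<in> full Z h" "a \<notin> B" by auto
    have nD: "a \<notin> Domain (strands h B)" "a \<notin> Range (strands h B)" using not_full_insert[OF h af] by auto
    have aP: "a \<in> points Z" using af places_subset by (auto simp: full_def)
    note ins = full_insert_strands[OF h af(1), of B]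
    have eq: "insert a (A \<union> (U - {a})) = A \<union> U" if "a \<in> U" for A U :: "'i pt set" using that by auto
    have eq': "insert a A \<union> U = A \<union> insert a U" for A U :: "'i pt set" by auto
    show "(\<Sum>U | U \<in> ?H B \<and> a \<in> U. ?F a U) = Dg h s t (insert a B)"
      unfolding Dg_def diag_sum[OF moving_strands[OF h]]
    proof (rule sum.reindex_bij_witness[of _ "insert a" "\<lambda>U. U - {a}"])
      fix U assume "U \<in> ?H (insert a B)"
      then show "insert a U - {a} = U" "insert a U \<in> {U \<in> ?H B. a \<in> U}"
        using nD aP unfolding hset_def ins by (auto simp: eq')
    qed (auto simp: hset_def ins eq)
  qed
  finally show ?thesis .
qed

end

section \<open>The local structure of viable diagrams\<close>

text \<open>
  The condition at a pair with places \<open>p\<close>, \<open>q\<close> under which a viable diagram exists: \<open>u\<close>, \<open>v\<close> tell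
  whether the steps before and after \<open>p\<close> are covered, \<open>b\<close> tells whether the strand through \<open>p\<close> is
  broken there, the primed variables refer to \<open>q\<close>, and \<open>s\<close>, \<open>t\<close> to the idempotents.
\<close>

definition local_ok :: "bool \<Rightarrow> bool \<Rightarrow> bool \<Rightarrow> bool \<Rightarrow> bool \<Rightarrow> bool \<Rightarrow> bool \<Rightarrow> bool \<Rightarrow> bool" where
  "local_ok u v u' v' b b' s t \<longleftrightarrow>
     (let S = v \<and> (u \<longrightarrow> b); S' = v' \<and> (u' \<longrightarrow> b'); T = u \<and> (v \<longrightarrow> b); T' = u' \<and> (v' \<longrightarrow> b')
      in \<not> (S \<and> S') \<and> \<not> (T \<and> T') \<and> (S \<or> S' \<longrightarrow> s) \<and> (T \<or> T' \<longrightarrow> t) \<and>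
         ((s \<and> \<not> S \<and> \<not> S') \<longleftrightarrow> (t \<and> \<not> T \<and> \<not> T')))"

text \<open>A break at \<open>p\<close> makes \<open>p\<close> both an initial and a final place, so
  the pair is occupied on both sides and no strand may start or end at its twin. This forces
  \<open>u' = v'\<close> there, and symmetrically; \<open>u = v\<close> at \<open>p\<close> itself
  holds because a broken place has both steps covered.\<close>

lemma local_ok_broken:
  assumes "b \<longrightarrow> u \<and> v" "b' \<longrightarrow> u' \<and> v'"
  shows "local_ok u v u' v' b b' s t \<longleftrightarrow> local_ok u v u' v' False False s t \<and>
    (b \<or> b' \<longrightarrow> s \<and> t \<and> u = v \<and> u' = v') \<and> \<not> (b \<and> b')"
  using assms unfolding local_ok_def Let_def by blast

context pre_arc_diagram
begin

lemma fibre_twin: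
  assumes "a \<in> places Z"
  shows "fibre Z (lab Z a) = {a, twin Z a}" "twin Z a \<noteq> a"
proof -
  have "card (fibre Z (lab Z a)) = 2" using assms by (intro card_fibre) (simp add: pairs_def)
  then obtain x y where xy: "fibre Z (lab Z a) = {x, y}" "x \<noteq> y" by (auto simp: card_2_iff)
  have a: "a \<in> fibre Z (lab Z a)" using assms by (simp add: fibre_def)
  obtain b where b: "fibre Z (lab Z a) = {a, b}" "b \<noteq> a"
  proof (cases "a = x")
    case True
    then show ?thesis using that[of y] xy by simp
  next
    case False
    then have "a = y" using xy a by simp
    then show ?thesis using that[of x] xy by (simp add: insert_commute)
  qed
  have "twin Z a = b" unfolding twin_def b(1) by (rule the_equality) (use b(2) in auto)
  then show "fibre Z (lab Z a) = {a, twin Z a}" "twin Z a \<noteq> a" using b by auto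
qed

lemma twin_place:
  assumes "a \<in> places Z"
  shows "twin Z a \<in> places Z" "lab Z (twin Z a) = lab Z a"
  using fibre_twin(1)[OF assms] unfolding fibre_def by auto

lemma twin_twin: "a \<in> places Z \<Longrightarrow> twin Z (twin Z a) = a"
  using fibre_twin[of a] fibre_twin[of "twin Z a"] twin_place[of a] by auto

lemma same_lab: "a \<in> places Z \<Longrightarrow> b \<in> places Z \<Longrightarrow> lab Z b = lab Z a \<longleftrightarrow> b = a \<or> b = twin Z a"
  using fibre_twin(1)[of a] unfolding fibre_def by blast

text \<open>Horizontal strands must sit at exactly those pairs of \<open>s\<close> that have no
  initial place in \<open>SA\<close>, and at exactly those of \<open>t\<close> that have no final
  place in \<open>TA\<close>. The two sets of pairs have to agree, and then one place from each may
  be chosen freely.\<close>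

lemma sections_iff:
  assumes SA: "SA \<subseteq> places Z" and TA: "TA \<subseteq> places Z" and st: "s \<subseteq> pairs Z" "t \<subseteq> pairs Z"
  shows "(\<exists>U \<subseteq> places Z - (SA \<union> TA). inj_on (lab Z) (SA \<union> U) \<and> lab Z ` (SA \<union> U) = s \<and>
      inj_on (lab Z) (TA \<union> U) \<and> lab Z ` (TA \<union> U) = t) \<longleftrightarrow>
    (\<forall>a \<in> places Z. \<not> (a \<in> SA \<and> twin Z a \<in> SA) \<and> \<not> (a \<in> TA \<and> twin Z a \<in> TA) \<and>
      (a \<in> SA \<or> twin Z a \<in> SA \<longrightarrow> lab Z a \<in> s) \<and> (a \<in> TA \<or> twin Z a \<in> TA \<longrightarrow> lab Z a \<in> t) \<and>
      ((lab Z a \<in> s \<and> a \<notin> SA \<and> twin Z a \<notin> SA) \<longleftrightarrow> (lab Z a \<in> t \<and> a \<notin> TA \<and> twin Z a \<notin> TA)))"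
    (is "?L \<longleftrightarrow> (\<forall>a \<in> places Z. ?R a)")
proof
  assume ?L
  then obtain U where U: "U \<subseteq> places Z - (SA \<union> TA)" "inj_on (lab Z) (SA \<union> U)" "lab Z ` (SA \<union> U) = s"
    "inj_on (lab Z) (TA \<union> U)" "lab Z ` (TA \<union> U) = t" by auto
  have key: "\<not> (a \<in> A \<and> twin Z a \<in> A) \<and> (a \<in> A \<or> twin Z a \<in> A \<longrightarrow> lab Z a \<in> r) \<and>
      (lab Z a \<in> r \<and> a \<notin> A \<and> twin Z a \<notin> A \<longleftrightarrow> a \<in> U \<or> twin Z a \<in> U)"
    if a: "a \<in> places Z" and A: "A \<subseteq> places Z" "A \<inter> U = {}" "inj_on (lab Z) (A \<union> U)" "lab Z ` (A \<union> U) = r" for a A r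
  proof (intro conjI impI)
    note tw = fibre_twin[OF a] twin_place[OF a]
    show "\<not> (a \<in> A \<and> twin Z a \<in> A)" using A(3) tw(2,4) by (auto simp: inj_on_def)
    show "lab Z a \<in> r" if "a \<in> A \<or> twin Z a \<in> A" using that A(4) tw(4) by (metis UnI1 imageI)
    show "lab Z a \<in> r \<and> a \<notin> A \<and> twin Z a \<notin> A \<longleftrightarrow> a \<in> U \<or> twin Z a \<in> U"
    proof
      assume l: "lab Z a \<in> r \<and> a \<notin> A \<and> twin Z a \<notin> A"
      then have "lab Z a \<in> lab Z ` (A \<union> U)" using A(4) by blast
      then obtain x where x: "x \<in> A \<union> U" "lab Z x = lab Z a" by (metis imageE)
      then have "x \<in> places Z" using A(1) U(1) by blast
      then have "x = a \<or> x = twin Z a" using same_lab[OF a] x(2) by blast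
      then show "a \<in> U \<or> twin Z a \<in> U" using x(1) l by blast
    next
      assume r: "a \<in> U \<or> twin Z a \<in> U"
      then have "lab Z a \<in> r" using A(4) tw(4) by (metis UnI2 imageI)
      moreover have "x \<notin> A" if x: "x = a \<or> x = twin Z a" for x
      proof
        assume xA: "x \<in> A"
        obtain y where y: "y \<in> U" "y = a \<or> y = twin Z a" using r by blast
        then have "lab Z x = lab Z y" using x tw(4) by metis
        then have "x = y" using inj_onD[OF A(3)] xA y(1) by blast
        then show False using xA y(1) A(2) by blast
      qed
      ultimately show "lab Z a \<in> r \<and> a \<notin> A \<and> twin Z a \<notin> A" by blast
    qed
  qed
  show "\<forall>a \<in> places Z. ?R a"
  proof
    fix a assume a: "a \<in> places Z"
    have d: "SA \<inter> U = {}" "TA \<inter> U = {}" using U(1) by blast+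
    show "?R a" using key[OF a SA d(1) U(2,3)] key[OF a TA d(2) U(4,5)] by blast
  qed
next
  assume R: "\<forall>a \<in> places Z. ?R a"
  define ch where "ch P = (SOME a. a \<in> fibre Z P)" for P
  have ch: "ch P \<in> places Z" "lab Z (ch P) = P" if "P \<in> pairs Z" for P
  proof -
    have "\<exists>a. a \<in> fibre Z P" using that by (auto simp: pairs_def fibre_def)
    from someI_ex[OF this] show "ch P \<in> places Z" "lab Z (ch P) = P" unfolding ch_def fibre_def by auto
  qed
  \<comment> \<open>One arbitrarily chosen place of every pair of \<open>s\<close> at which no
    moving strand starts.\<close>
  define U where "U = ch ` {P \<in> pairs Z. P \<in> s \<and> (\<forall>a \<in> fibre Z P. a \<notin> SA)}"
  have U: "a \<in> places Z \<and> a = ch (lab Z a) \<and> lab Z a \<in> s \<and> a \<notin> SA \<and> twin Z a \<notin> SA" if "a \<in> U" for a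
  proof -
    obtain P where P: "P \<in> pairs Z" "P \<in> s" "\<forall>a \<in> fibre Z P. a \<notin> SA" "a = ch P"
      using \<open>a \<in> U\<close> unfolding U_def by blast
    have a: "a \<in> places Z" "lab Z a = P" using ch[OF P(1)] P(4) by auto
    then have "fibre Z P = {a, twin Z a}" using fibre_twin(1) by blast
    then show ?thesis using P a by auto
  qed
  have U': "ch (lab Z a) \<in> U" if "a \<in> places Z" "lab Z a \<in> s" "a \<notin> SA" "twin Z a \<notin> SA" for a
    unfolding U_def using that fibre_twin(1)[OF that(1)] by (intro imageI) (auto simp: pairs_def)
  have ok: "inj_on (lab Z) (A \<union> U) \<and> lab Z ` (A \<union> U) = r"
    if A: "A \<subseteq> places Z" and r: "r \<subseteq> pairs Z"
      and a1: "\<And>a. a \<in> places Z \<Longrightarrow> \<not> (a \<in> A \<and> twin Z a \<in> A)"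
      and a2: "\<And>a. a \<in> places Z \<Longrightarrow> a \<in> A \<or> twin Z a \<in> A \<Longrightarrow> lab Z a \<in> r"
      and a3: "\<And>a. a \<in> places Z \<Longrightarrow> (lab Z a \<in> r \<and> a \<notin> A \<and> twin Z a \<notin> A) \<longleftrightarrow>
         (lab Z a \<in> s \<and> a \<notin> SA \<and> twin Z a \<notin> SA)" for A r
  proof
    have UA: "a \<notin> A \<and> twin Z a \<notin> A \<and> lab Z a \<in> r" if "a \<in> U" for a using U[OF that] a3[of a] by blast
    show "inj_on (lab Z) (A \<union> U)"
    proof (rule inj_onI)
      fix x y assume xy: "x \<in> A \<union> U" "y \<in> A \<union> U" "lab Z x = lab Z y"
      then have p: "x \<in> places Z" "y \<in> places Z" using A U by blast+
      then have "y = x \<or> y = twin Z x" using same_lab[OF p] xy(3) by simp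
      moreover have "y = x" if "x \<in> U" "y \<in> U" using U[OF that(1)] U[OF that(2)] xy(3) by metis
      moreover have "y \<noteq> twin Z x" if "x \<in> U" "y \<in> A" using UA[OF that(1)] that(2) by blast
      moreover have "y \<noteq> twin Z x" if "x \<in> A" "y \<in> U" using UA[OF that(2)] that(1) twin_twin[OF p(1)] by metis
      moreover have "y \<noteq> twin Z x" if "x \<in> A" "y \<in> A" using a1[OF p(1)] that by blast
      ultimately show "x = y" using xy(1,2) by (metis Un_iff)
    qed
    show "lab Z ` (A \<union> U) = r"
    proof (intro equalityI subsetI)
      fix P assume "P \<in> lab Z ` (A \<union> U)"
      then obtain x where x: "x \<in> A \<union> U" "P = lab Z x" by blast
      then show "P \<in> r" using a2[of x] A UA by blast
    next
      fix P assume P: "P \<in> r"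
      then obtain a where a: "a \<in> places Z" "P = lab Z a" using r by (auto simp: pairs_def)
      show "P \<in> lab Z ` (A \<union> U)"
      proof (cases "a \<in> A \<or> twin Z a \<in> A")
        case True
        then show ?thesis using a twin_place(2)[OF a(1)] by (metis UnI1 imageI)
      next
        case False
        then have "ch P \<in> U" using a3[OF a(1)] U'[OF a(1)] P a(2) by blast
        moreover have "lab Z (ch P) = P" using ch(2) P r by blast
        ultimately show ?thesis by (metis UnI2 imageI)
      qed
    qed
  qed
  have R': "?R a" if "a \<in> places Z" for a using R that by blast
  have "inj_on (lab Z) (SA \<union> U) \<and> lab Z ` (SA \<union> U) = s"
    by (rule ok[OF SA st(1)]) (use R' in blast)+
  moreover have "inj_on (lab Z) (TA \<union> U) \<and> lab Z ` (TA \<union> U) = t"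
    by (rule ok[OF TA st(2)]) (use R' in blast)+
  moreover have "U \<subseteq> places Z - (SA \<union> TA)" using U R' by blast
  ultimately show ?L by blast
qed

lemma Domain_places:
  assumes h: "viable01 Z h" and B: "B \<subseteq> full Z h" and a: "a \<in> places Z"
  shows "a \<in> Domain (strands h B) \<longleftrightarrow> h a = 1 \<and> (h (step_to a) = 1 \<longrightarrow> a \<in> B)"
    "a \<in> Range (strands h B) \<longleftrightarrow> h (step_to a) = 1 \<and> (h a = 1 \<longrightarrow> a \<in> B)"
  using a B viable01D(1)[OF h, of a] viable01D(1)[OF h, of "step_to a"]
  by (cases a; auto simp: Domain_strands[OF h] Range_strands[OF h] places_def)+

definition config_ok :: "'i hgr \<Rightarrow> nat set \<Rightarrow> nat set \<Rightarrow> 'i pt set \<Rightarrow> bool" where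
  "config_ok h s t B \<longleftrightarrow> s \<subseteq> pairs Z \<and> t \<subseteq> pairs Z \<and>
     (\<forall>a \<in> places Z. local_ok (h (step_to a) = 1) (h a = 1) (h (step_to (twin Z a)) = 1) (h (twin Z a) = 1)
        (a \<in> B) (twin Z a \<in> B) (lab Z a \<in> s) (lab Z a \<in> t))"

text \<open>\<open>sect\<close> puts no condition on the ends of the intervals, so a horizontal set
  may be reduced to its places, and the question becomes the pairwise one of
  \<open>sections_iff\<close>.\<close>

lemma hset_nonempty_iff:
  assumes h: "viable01 Z h" and B: "B \<subseteq> full Z h"
  shows "hset Z s t (strands h B) \<noteq> {} \<longleftrightarrow> config_ok h s t B"
proof -
  let ?D = "Domain (strands h B)" and ?R = "Range (strands h B)"
  let ?SA = "?D \<inter> places Z" and ?TA = "?R \<inter> places Z"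
  have P: "?D \<subseteq> points Z" "?R \<subseteq> points Z" using moving_sdD(2)[OF moving_strands[OF h, of B]] by auto
  let ?E = "\<exists>U \<subseteq> places Z - (?SA \<union> ?TA). inj_on (lab Z) (?SA \<union> U) \<and> lab Z ` (?SA \<union> U) = s \<and>
      inj_on (lab Z) (?TA \<union> U) \<and> lab Z ` (?TA \<union> U) = t"
  have eq: "hset Z s t (strands h B) \<noteq> {} \<longleftrightarrow> ?E"
  proof
    assume "hset Z s t (strands h B) \<noteq> {}"
    then obtain U where U: "U \<subseteq> points Z - (?D \<union> ?R)" "sect Z s (?D \<union> U)" "sect Z t (?R \<union> U)"
      by (auto simp: hset_def)
    have "(?D \<union> U) \<inter> places Z = ?SA \<union> (U \<inter> places Z)" "(?R \<union> U) \<inter> places Z = ?TA \<union> (U \<inter> places Z)" by blast+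
    moreover have "U \<inter> places Z \<subseteq> places Z - (?SA \<union> ?TA)" using U(1) by blast
    ultimately show ?E using U(2,3) unfolding sect_def by metis
  next
    assume ?E
    then obtain U where U: "U \<subseteq> places Z - (?SA \<union> ?TA)" "inj_on (lab Z) (?SA \<union> U)" "lab Z ` (?SA \<union> U) = s"
      "inj_on (lab Z) (?TA \<union> U)" "lab Z ` (?TA \<union> U) = t" by (elim exE conjE)
    have e: "(?D \<union> U) \<inter> places Z = ?SA \<union> U" "(?R \<union> U) \<inter> places Z = ?TA \<union> U" using U(1) by blast+
    have "U \<subseteq> points Z - (?D \<union> ?R)" using U(1) places_subset by blast
    moreover from this have "?D \<union> U \<subseteq> points Z" "?R \<union> U \<subseteq> points Z" using P by blast+
    ultimately have "U \<in> hset Z s t (strands h B)" using U(2-5) unfolding hset_def sect_def mem_Collect_eq e by blast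
    then show "hset Z s t (strands h B) \<noteq> {}" by blast
  qed
  show ?thesis
  proof (cases "s \<subseteq> pairs Z \<and> t \<subseteq> pairs Z")
    case True
    have "?E \<longleftrightarrow> config_ok h s t B"
    proof (subst sections_iff)
      have "(a \<in> ?SA \<longleftrightarrow> h a = 1 \<and> (h (step_to a) = 1 \<longrightarrow> a \<in> B)) \<and> (a \<in> ?TA \<longleftrightarrow> h (step_to a) = 1 \<and> (h a = 1 \<longrightarrow> a \<in> B))"
        if "a \<in> places Z" for a using Domain_places[OF h B that] that by blast
      then have m: "a \<in> ?SA \<longleftrightarrow> h a = 1 \<and> (h (step_to a) = 1 \<longrightarrow> a \<in> B)"
        "a \<in> ?TA \<longleftrightarrow> h (step_to a) = 1 \<and> (h a = 1 \<longrightarrow> a \<in> B)"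
        "twin Z a \<in> ?SA \<longleftrightarrow> h (twin Z a) = 1 \<and> (h (step_to (twin Z a)) = 1 \<longrightarrow> twin Z a \<in> B)"
        "twin Z a \<in> ?TA \<longleftrightarrow> h (step_to (twin Z a)) = 1 \<and> (h (twin Z a) = 1 \<longrightarrow> twin Z a \<in> B)"
        if "a \<in> places Z" for a using that twin_place(1)[OF that] by blast+
      show "(\<forall>a \<in> places Z. \<not> (a \<in> ?SA \<and> twin Z a \<in> ?SA) \<and> \<not> (a \<in> ?TA \<and> twin Z a \<in> ?TA) \<and>
        (a \<in> ?SA \<or> twin Z a \<in> ?SA \<longrightarrow> lab Z a \<in> s) \<and> (a \<in> ?TA \<or> twin Z a \<in> ?TA \<longrightarrow> lab Z a \<in> t) \<and>
        ((lab Z a \<in> s \<and> a \<notin> ?SA \<and> twin Z a \<notin> ?SA) \<longleftrightarrow> (lab Z a \<in> t \<and> a \<notin> ?TA \<and> twin Z a \<notin> ?TA))) \<longleftrightarrow> config_ok h s t B"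
        unfolding config_ok_def local_ok_def Let_def using True
        by (simp only: m simp_thms cong: ball_cong)
    qed (use True in auto)
    then show ?thesis using eq by blast
  next
    case False
    then show ?thesis using hset_nonempty_subset[of s t "strands h B"] unfolding config_ok_def by blast
  qed
qed

text \<open>Equal multiplicities at both places exclude the pairs at which every diagram with this
  grading has a strand starting or ending anyway; such a strand occupies the pair and leaves no room
  for a break.\<close>

definition core :: "'i hgr \<Rightarrow> nat set \<Rightarrow> nat set \<Rightarrow> nat set" where
  "core h s t = {P \<in> pairs Z. P \<in> s \<and> P \<in> t \<and> (\<forall>a \<in> fibre Z P. h (step_to a) = h a) \<and> (\<exists>a \<in> fibre Z P. h a = 1)}"

definition brk :: "'i hgr \<Rightarrow> nat set \<Rightarrow> nat set \<Rightarrow> 'i pt set" where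
  "brk h s t = {a \<in> full Z h. lab Z a \<in> core h s t}"

lemma full_places: "a \<in> full Z h \<Longrightarrow> a \<in> places Z" "a \<in> full Z h \<Longrightarrow> h a = 1" "a \<in> full Z h \<Longrightarrow> h (step_to a) = 1"
  by (simp_all add: full_def)

lemma brk_places: "a \<in> brk h s t \<Longrightarrow> a \<in> places Z" "a \<in> brk h s t \<Longrightarrow> a \<in> full Z h"
  by (simp_all add: full_def brk_def)

lemma finite_brk [simp]: "finite (brk h s t)" "finite (full Z h)"
  by (rule finite_subset[OF _ finite_places], auto simp: full_def brk_def)+

lemma in_core_iff:
  "a \<in> places Z \<Longrightarrow> lab Z a \<in> core h s t \<longleftrightarrow> lab Z a \<in> s \<and> lab Z a \<in> t \<and> h (step_to a) = h a \<and>
     h (step_to (twin Z a)) = h (twin Z a) \<and> (h a = 1 \<or> h (twin Z a) = 1)"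
  unfolding core_def using fibre_twin(1)[of a] by (auto simp: pairs_def)

lemma core_brk: "P \<in> core h s t \<longleftrightarrow> P \<in> lab Z ` brk h s t"
  unfolding brk_def core_def full_def fibre_def by force

lemma finite_core [simp]: "finite (core h s t)"
  using finite_imageI[OF finite_brk(1)] core_brk by (metis finite_subset subsetI)

text \<open>By \<open>local_ok_broken\<close> the condition at each pair splits into one that does
  not see \<open>B\<close> and one on \<open>B\<close> alone. So once some diagram exists, breaks
  can be chosen independently, at most one at each core pair.\<close>

lemma config_ok_iff:
  assumes h: "viable01 Z h" and B: "B \<subseteq> full Z h"
  shows "config_ok h s t B \<longleftrightarrow> config_ok h s t {} \<and> B \<subseteq> brk h s t \<and> inj_on (lab Z) B"
proof -
  let ?u = "\<lambda>a. h (step_to a) = 1" and ?v = "\<lambda>a. h a = 1"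
  have BP: "a \<in> places Z \<and> ?u a \<and> ?v a" if "a \<in> B" for a using that B full_places by blast
  have l: "local_ok (?u a) (?v a) (?u (twin Z a)) (?v (twin Z a)) (a \<in> B) (twin Z a \<in> B) (lab Z a \<in> s) (lab Z a \<in> t) \<longleftrightarrow>
      local_ok (?u a) (?v a) (?u (twin Z a)) (?v (twin Z a)) (a \<in> {}) (twin Z a \<in> {}) (lab Z a \<in> s) (lab Z a \<in> t) \<and>
      ((a \<in> B \<or> twin Z a \<in> B \<longrightarrow> lab Z a \<in> core h s t) \<and> \<not> (a \<in> B \<and> twin Z a \<in> B))" if a: "a \<in> places Z" for a
  proof -
    have "?u x = ?v x \<longleftrightarrow> h (step_to x) = h x" for x using viable01D(1)[OF h, of x] viable01D(1)[OF h, of "step_to x"] by fastforce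
    then show ?thesis
      unfolding in_core_iff[OF a] empty_iff using BP by (subst local_ok_broken) blast+
  qed
  have "(\<forall>a \<in> places Z. (a \<in> B \<or> twin Z a \<in> B \<longrightarrow> lab Z a \<in> core h s t) \<and> \<not> (a \<in> B \<and> twin Z a \<in> B)) \<longleftrightarrow>
      B \<subseteq> brk h s t \<and> inj_on (lab Z) B" (is "?L \<longleftrightarrow> ?R")
  proof
    assume L: ?L
    have "B \<subseteq> brk h s t" using L BP B unfolding brk_def by blast
    moreover have "inj_on (lab Z) B"
    proof (rule inj_onI)
      fix x y assume "x \<in> B" "y \<in> B" "lab Z x = lab Z y"
      then show "x = y" using L same_lab[of x y] BP by metis
    qed
    ultimately show ?R ..
  next
    assume R: ?R
    show ?L
    proof (intro ballI conjI impI)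
      fix a assume a: "a \<in> places Z"
      show "lab Z a \<in> core h s t" if "a \<in> B \<or> twin Z a \<in> B"
        using that R twin_place(2)[OF a] unfolding brk_def by auto
      show "\<not> (a \<in> B \<and> twin Z a \<in> B)"
        using R twin_place(2)[OF a] fibre_twin(2)[OF a] unfolding inj_on_def by metis
    qed
  qed
  then show ?thesis unfolding config_ok_def by (simp only: l ball_conj_distrib cong: ball_cong) blast
qed

lemma Dg_eq_0: "viable01 Z h \<Longrightarrow> B \<subseteq> full Z h \<Longrightarrow> Dg h s t B = 0 \<longleftrightarrow> \<not> config_ok h s t B"
  unfolding Dg_def diag_eq_0[OF moving_strands] by (simp flip: hset_nonempty_iff)

lemma hgrading_off_steps:
  assumes "D \<in> diagrams Z" and e: "e \<notin> steps Z"
  shows "hgrading D e = 0"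
proof -
  obtain s t \<mu> where \<mu>: "moving_sd Z \<mu>" "hset Z s t \<mu> \<noteq> {}" "D = diag Z s t \<mu>"
    using assms(1)[unfolded diagrams_iff] by (elim exE conjE)
  have "diag Z s t \<mu> \<noteq> 0" using diag_eq_0[OF \<mu>(1)] \<mu>(2) by blast
  then have hD: "hgrading D = sd_hgr \<mu>" using data_of_diag(4)[OF \<mu>(1)] \<mu>(3) by simp
  have "\<not> pt_less e y" if xy: "(x, y) \<in> \<mu>" "pt_le x e" for x y
  proof
    assume "pt_less e y"
    moreover have "y \<in> points Z" using moving_sdD(2)[OF \<mu>(1)] xy(1) by blast
    ultimately have "e \<in> steps Z" unfolding points_def steps_def pt_less_def by (cases e; cases y) auto
    then show False using e by blast
  qed
  then have "{(x, y). (x, y) \<in> \<mu> \<and> pt_le x e \<and> pt_less e y} = {}" by blast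
  then show ?thesis unfolding hD sd_hgr_def by (simp only: card.empty of_nat_0)
qed

lemma viable_hgr_diagram:
  "D \<in> diagrams Z \<Longrightarrow> viable_hgr Z (hgrading D) \<longleftrightarrow> viable01 Z (hgrading D)"
  using hgrading_off_steps[of D] unfolding viable_hgr_def viable01_def by blast

text \<open>The classification of viable diagrams: \<open>B\<close> is the set of places common to
  the domain and the range of the moving strands.\<close>

lemma viable_diagram_Dg:
  assumes D: "D \<in> diagrams Z" and h: "viable01 Z (hgrading D)"
  obtains B where "B \<subseteq> brk (hgrading D) (src Z D) (tgt Z D)" "inj_on (lab Z) B"
    "D = Dg (hgrading D) (src Z D) (tgt Z D) B" "config_ok (hgrading D) (src Z D) (tgt Z D) {}"
    "moving D = strands (hgrading D) B"
proof -
  obtain s t \<mu> where \<mu>: "moving_sd Z \<mu>" "hset Z s t \<mu> \<noteq> {}" "D = diag Z s t \<mu>"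
    using D[unfolded diagrams_iff] by (elim exE conjE)
  have "diag Z s t \<mu> \<noteq> 0" using diag_eq_0[OF \<mu>(1)] \<mu>(2) by blast
  note dat = data_of_diag[OF \<mu>(1) this, folded \<mu>(3)]
  define B where "B = Domain \<mu> \<inter> Range \<mu>"
  have h': "viable01 Z (sd_hgr \<mu>)" using h dat by simp
  have \<mu>e: "\<mu> = strands (sd_hgr \<mu>) B" unfolding B_def by (rule strands_unique[OF \<mu>(1) h'])
  have Bf: "B \<subseteq> full Z (sd_hgr \<mu>)"
  proof
    fix a assume a: "a \<in> B"
    obtain i m where [simp]: "a = (i, m)" by (cases a)
    have "a \<in> Domain (strands (sd_hgr \<mu>) B)" "a \<in> Range (strands (sd_hgr \<mu>) B)"
      using a \<mu>e B_def by auto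
    then have "sd_hgr \<mu> (i, m) = 1" "sd_hgr \<mu> (i, m - 1) = 1" "m > 0"
      by (auto simp: Domain_strands[OF h'] Range_strands[OF h'])
    then show "a \<in> full Z (sd_hgr \<mu>)" using viable01D(2)[OF h', of i m] by (simp add: full_def places_def)
  qed
  have "config_ok (sd_hgr \<mu>) s t B" using \<mu>(2) hset_nonempty_iff[OF h' Bf] \<mu>e by metis
  then have "config_ok (sd_hgr \<mu>) s t {}" "B \<subseteq> brk (sd_hgr \<mu>) s t" "inj_on (lab Z) B"
    unfolding config_ok_iff[OF h' Bf] by blast+
  moreover have "D = Dg (sd_hgr \<mu>) s t B" unfolding Dg_def \<mu>e[symmetric] by (rule \<mu>(3))
  ultimately show ?thesis using that[of B] \<mu>e unfolding dat by blast
qed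

lemma Dg_diagram:
  assumes h: "viable01 Z h" and B: "B \<subseteq> full Z h" and ok: "config_ok h s t B"
  shows "Dg h s t B \<in> diagrams Z" "hdata_of Z (Dg h s t B) = (h, s, t)" "hgrading (Dg h s t B) = h"
    "src Z (Dg h s t B) = s" "tgt Z (Dg h s t B) = t" "moving (Dg h s t B) = strands h B" "Dg h s t B \<noteq> 0"
proof -
  have ne: "hset Z s t (strands h B) \<noteq> {}" using hset_nonempty_iff[OF h B] ok by blast
  then show "Dg h s t B \<in> diagrams Z" unfolding diagrams_iff Dg_def using moving_strands[OF h] by blast
  show nz: "Dg h s t B \<noteq> 0" using Dg_eq_0[OF h B] ok by blast
  show "hdata_of Z (Dg h s t B) = (h, s, t)" "hgrading (Dg h s t B) = h"
    "src Z (Dg h s t B) = s" "tgt Z (Dg h s t B) = t" "moving (Dg h s t B) = strands h B"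
    using data_of_diag[OF moving_strands[OF h] nz[unfolded Dg_def]] sd_hgr_strands[OF h]
    unfolding Dg_def by simp_all
qed

end

section \<open>Homology of the viable summands\<close>

locale viable_data = pre_arc_diagram Z for Z :: "'i arc_diagram" +
  fixes h :: "'i hgr" and s t :: "nat set"
  assumes viable: "viable01 Z h" and ok: "config_ok h s t {}"
begin

abbreviation "F \<equiv> brk h s t"
abbreviation "K \<equiv> core h s t"

text \<open>
  A diagram with H-data \<open>(h, s, t)\<close> is given by the set of its broken places in \<open>F\<close>, at most one of
  each pair.  Chains are formal sums of such sets.
\<close>

definition configs :: "'i pt set set" where
  "configs = {B. B \<subseteq> F \<and> inj_on (lab Z) B}"

definition unbroken :: "'i pt set \<Rightarrow> 'i pt set" where
  "unbroken B = {a \<in> F. lab Z a \<notin> lab Z ` B}"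

text \<open>The complex of configurations is a tensor product over the core pairs. Its factor at a
  pair has one unbroken generator, mapped to the sum of the broken ones: one of these if the pair is
  once occupied, which makes the factor acyclic, and two if it is doubly occupied, which leaves one
  homology class.\<close>

definition chain_diff :: "('i pt set \<Rightarrow>\<^sub>0 bit) \<Rightarrow> 'i pt set \<Rightarrow>\<^sub>0 bit" where
  "chain_diff = lext (\<lambda>B. \<Sum>a \<in> unbroken B. Poly_Mapping.single (insert a B) 1)"

definition realize :: "('i pt set \<Rightarrow>\<^sub>0 bit) \<Rightarrow> 'i elt" where
  "realize = lext (Dg h s t)"

definition join :: "'i pt \<Rightarrow> ('i pt set \<Rightarrow>\<^sub>0 bit) \<Rightarrow> 'i pt set \<Rightarrow>\<^sub>0 bit" where
  "join a = lext (\<lambda>B. if a \<in> B then Poly_Mapping.single (B - {a}) 1 else 0)"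

text \<open>The chain map that \<open>join a\<close> compares with the identity: it moves a break at
  \<open>a\<close> to the twin and discards configurations unbroken at the pair. If the twin is not
  in \<open>F\<close> it vanishes on chains of configurations.\<close>

definition retract :: "'i pt \<Rightarrow> ('i pt set \<Rightarrow>\<^sub>0 bit) \<Rightarrow> 'i pt set \<Rightarrow>\<^sub>0 bit" where
  "retract a = lext (\<lambda>B.
     if a \<in> B then (if twin Z a \<in> F then Poly_Mapping.single (insert (twin Z a) (B - {a})) 1 else 0)
     else if twin Z a \<in> B then Poly_Mapping.single B 1 else 0)"

definition doubled :: bool where
  "doubled \<longleftrightarrow> (\<forall>a \<in> F. twin Z a \<in> F)"

lemma configsD: "B \<in> configs \<Longrightarrow> B \<subseteq> F" "B \<in> configs \<Longrightarrow> inj_on (lab Z) B" "B \<in> configs \<Longrightarrow> B \<subseteq> full Z h"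
  unfolding configs_def brk_def by auto

lemma configs_config_ok: "B \<in> configs \<Longrightarrow> config_ok h s t B"
  using configsD[of B] config_ok_iff[OF viable configsD(3)] ok by blast

lemma F_places: "a \<in> F \<Longrightarrow> a \<in> places Z"
  by (rule brk_places)

lemma F_core: "a \<in> F \<Longrightarrow> lab Z a \<in> K"
  by (simp add: brk_def)

lemma finite_unbroken [simp]: "finite (unbroken B)"
  unfolding unbroken_def by simp

lemma finite_config: "B \<in> configs \<Longrightarrow> finite B"
  using configsD(1) finite_brk(1) finite_subset by metis

lemma insert_unbroken: "B \<in> configs \<Longrightarrow> a \<in> unbroken B \<Longrightarrow> insert a B \<in> configs \<and> a \<notin> B"
  unfolding configs_def unbroken_def by auto

lemma delete_config: "B \<in> configs \<Longrightarrow> B - {a} \<in> configs"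
  unfolding configs_def by (auto intro: inj_on_subset)

text \<open>The general formula breaks at every full place; at pairs off the core and at pairs
  already broken the result is the zero diagram.\<close>

lemma diff_Dg_configs:
  assumes B: "B \<in> configs"
  shows "\<partial> (Dg h s t B) = (\<Sum>a \<in> unbroken B. Dg h s t (insert a B))"
proof -
  have "\<partial> (Dg h s t B) = (\<Sum>a \<in> full Z h - B. Dg h s t (insert a B))"
    by (rule diff_Dg[OF viable configsD(3)[OF B]])
  also have "\<dots> = (\<Sum>a \<in> unbroken B. Dg h s t (insert a B))"
  proof (rule sum.mono_neutral_right)
    show "unbroken B \<subseteq> full Z h - B" unfolding unbroken_def brk_def by auto
    show "\<forall>a \<in> full Z h - B - unbroken B. Dg h s t (insert a B) = 0"
    proof
      fix a assume a: "a \<in> full Z h - B - unbroken B"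
      then have sub: "insert a B \<subseteq> full Z h" using configsD(3)[OF B] by blast
      have "\<not> (insert a B \<subseteq> F \<and> inj_on (lab Z) (insert a B))"
        using a unfolding unbroken_def by auto
      then show "Dg h s t (insert a B) = 0" using Dg_eq_0[OF viable sub] config_ok_iff[OF viable sub] by blast
    qed
  qed simp
  finally show ?thesis .
qed

lemma realize_chain_diff:
  assumes "Poly_Mapping.keys v \<subseteq> configs"
  shows "\<partial> (realize v) = realize (chain_diff v)"
proof -
  have "\<partial> (realize v) = lext (\<lambda>B. \<partial> (Dg h s t B)) v"
    unfolding realize_def diff_lext lext_lext ..
  also have "\<dots> = lext (\<lambda>B. lext (Dg h s t) (\<Sum>a \<in> unbroken B. Poly_Mapping.single (insert a B) 1)) v"
    using assms by (intro lext_cong) (auto simp: diff_Dg_configs lext_sum)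
  finally show ?thesis unfolding realize_def chain_diff_def lext_lext .
qed

lemma keys_lext_subset:
  "(\<And>x. x \<in> Poly_Mapping.keys v \<Longrightarrow> Poly_Mapping.keys (g x) \<subseteq> A) \<Longrightarrow> Poly_Mapping.keys (lext g v) \<subseteq> A"
proof -
  assume *: "\<And>x. x \<in> Poly_Mapping.keys v \<Longrightarrow> Poly_Mapping.keys (g x) \<subseteq> A"
  have "Poly_Mapping.keys (\<Sum>x\<in>I. g x) \<subseteq> A" if "finite I" "I \<subseteq> Poly_Mapping.keys v" for I
    using that
  proof (induction I)
    case (insert x I)
    then show ?case using * by (simp add: keys_bit_add_eq) blast
  qed simp
  then show ?thesis unfolding lext_def by simp
qed

lemma keys_chain_diff: "Poly_Mapping.keys v \<subseteq> configs \<Longrightarrow> Poly_Mapping.keys (chain_diff v) \<subseteq> configs"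
  unfolding chain_diff_def
proof (rule keys_lext_subset)
  fix B assume "Poly_Mapping.keys v \<subseteq> configs" "B \<in> Poly_Mapping.keys v"
  then have B: "B \<in> configs" by blast
  have "Poly_Mapping.keys (\<Sum>a\<in>unbroken B. Poly_Mapping.single (insert a B) (1::bit)) \<subseteq>
      (\<Union>a\<in>unbroken B. Poly_Mapping.keys (Poly_Mapping.single (insert a B) (1::bit)))"
    by (rule keys_sum)
  then show "Poly_Mapping.keys (\<Sum>a\<in>unbroken B. Poly_Mapping.single (insert a B) (1::bit)) \<subseteq> configs"
    using insert_unbroken[OF B] by auto
qed

lemma keys_join: "Poly_Mapping.keys v \<subseteq> configs \<Longrightarrow> Poly_Mapping.keys (join a v) \<subseteq> configs"
  unfolding join_def by (rule keys_lext_subset) (auto intro: delete_config)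

section \<open>Joining strands as a homotopy, and the homology of chains of configurations\<close>

lemma single_chain_diff: "chain_diff (Poly_Mapping.single B 1) = (\<Sum>a \<in> unbroken B. Poly_Mapping.single (insert a B) 1)"
  by (simp add: chain_diff_def)

text \<open>If \<open>a\<close> is broken, joining leaves the pair unbroken and the differential
  breaks it again, at \<open>a\<close>, giving \<open>B\<close>, or at the twin, giving the retract;
  breaks at other pairs cancel against \<open>join\<close> after the differential. If the twin is
  broken, \<open>join a\<close> kills everything and the retract is the identity. If the pair is
  unbroken, only the break at \<open>a\<close> survives joining, and it returns
  \<open>B\<close>.\<close>

lemma homotopy_basis:
  assumes B: "B \<in> configs" and a: "a \<in> F"
  shows "chain_diff (join a (Poly_Mapping.single B 1)) + join a (chain_diff (Poly_Mapping.single B 1)) =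
    Poly_Mapping.single B 1 + retract a (Poly_Mapping.single B 1)"
proof -
  let ?s = "\<lambda>B. Poly_Mapping.single B (1::bit)" and ?tw = "twin Z a"
  have ap: "a \<in> places Z" using F_places[OF a] .
  note tw = twin_place[OF ap] fibre_twin(2)[OF ap]
  have jd: "join a (chain_diff (?s B)) = (\<Sum>c \<in> unbroken B. join a (?s (insert c B)))"
    unfolding single_chain_diff join_def lext_sum ..
  have jdn: "join a (?s C) = (if a \<in> C then ?s (C - {a}) else 0)" for C by (simp add: join_def)
  show ?thesis
  proof (cases "a \<in> B")
    case True
    have un: "unbroken (B - {a}) = unbroken B \<union> ({a, ?tw} \<inter> F)"
    proof (intro equalityI subsetI)
      fix c assume c: "c \<in> unbroken (B - {a})"
      then have cF: "c \<in> F" "lab Z c \<notin> lab Z ` (B - {a})" by (auto simp: unbroken_def)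
      show "c \<in> unbroken B \<union> ({a, ?tw} \<inter> F)"
      proof (cases "lab Z c = lab Z a")
        case True
        then show ?thesis using same_lab[OF ap F_places[OF cF(1)]] cF(1) by blast
      next
        case False
        then show ?thesis using cF by (auto simp: unbroken_def)
      qed
    next
      fix c assume c: "c \<in> unbroken B \<union> ({a, ?tw} \<inter> F)"
      have "lab Z a \<notin> lab Z ` (B - {a})" using configsD(2)[OF B] True by (auto simp: inj_on_def)
      moreover have "lab Z c = lab Z a \<and> c \<in> F" if "c \<in> {a, ?tw} \<inter> F" using that tw(2) by auto
      ultimately show "c \<in> unbroken (B - {a})" using c unfolding unbroken_def by (cases "c \<in> {a, ?tw} \<inter> F") auto
    qed
    have nb: "a \<notin> unbroken B" "?tw \<notin> unbroken B" using True tw(2) by (auto simp: unbroken_def image_iff)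
    have "chain_diff (join a (?s B)) = (\<Sum>c \<in> unbroken B \<union> ({a, ?tw} \<inter> F). ?s (insert c (B - {a})))"
      using True un by (simp add: jdn single_chain_diff)
    also have "\<dots> = (\<Sum>c \<in> unbroken B. ?s (insert c (B - {a}))) + (\<Sum>c \<in> {a, ?tw} \<inter> F. ?s (insert c (B - {a})))"
      using nb by (intro sum.union_disjoint) auto
    also have "(\<Sum>c \<in> {a, ?tw} \<inter> F. ?s (insert c (B - {a}))) =
        ?s B + (if ?tw \<in> F then ?s (insert ?tw (B - {a})) else 0)"
    proof -
      have "{a, ?tw} \<inter> F = (if ?tw \<in> F then {a, ?tw} else {a})" using a by auto
      then show ?thesis using tw(3) insert_Diff[OF True] by simp
    qed
    finally have d: "chain_diff (join a (?s B)) = (\<Sum>c \<in> unbroken B. ?s (insert c (B - {a}))) +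
      (?s B + (if ?tw \<in> F then ?s (insert ?tw (B - {a})) else 0))" .
    have "join a (chain_diff (?s B)) = (\<Sum>c \<in> unbroken B. ?s (insert c (B - {a})))"
      unfolding jd using True nb(1) by (intro sum.cong refl) (auto simp: jdn insert_Diff_if)
    then show ?thesis unfolding d retract_def using True
      by (simp add: add.commute add.left_commute)
  next
    case False
    have j0: "join a (?s B) = 0" using False by (simp add: jdn)
    show ?thesis
    proof (cases "?tw \<in> B")
      case True
      have "lab Z a \<in> lab Z ` B" using True tw(2) by (metis imageI)
      then have "a \<notin> unbroken B" by (simp add: unbroken_def)
      then have "join a (chain_diff (?s B)) = 0"
        unfolding jd using False by (intro sum.neutral) (auto simp: jdn)
      then show ?thesis unfolding j0 retract_def chain_diff_def using True False by simp
    next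
      case tF: False
      have "lab Z a \<notin> lab Z ` B"
      proof
        assume "lab Z a \<in> lab Z ` B"
        then obtain b where b: "b \<in> B" "lab Z b = lab Z a" by (metis imageE)
        then have "b \<in> places Z" using configsD(1)[OF B] F_places by blast
        then show False using same_lab[OF ap] b False tF by blast
      qed
      then have au: "a \<in> unbroken B" using a by (simp add: unbroken_def)
      have "join a (chain_diff (?s B)) = (\<Sum>c \<in> unbroken B. if c = a then ?s B else 0)"
        unfolding jd using False by (intro sum.cong refl) (auto simp: jdn)
      also have "\<dots> = ?s B" using au by simp
      finally show ?thesis unfolding j0 retract_def chain_diff_def using tF False by simp
    qed
  qed
qed

lemma homotopy:
  assumes v: "Poly_Mapping.keys v \<subseteq> configs" and a: "a \<in> F"
  shows "chain_diff (join a v) + join a (chain_diff v) = v + retract a v"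
proof -
  let ?s = "\<lambda>B. Poly_Mapping.single B (1::bit)"
  have l: "g v = lext (\<lambda>B. g (?s B)) v" if "g = lext g'" for g g' using that by simp
  have "chain_diff (join a v) = lext (\<lambda>B. chain_diff (join a (?s B))) v"
    "join a (chain_diff v) = lext (\<lambda>B. join a (chain_diff (?s B))) v"
    unfolding chain_diff_def join_def lext_lext lext_single by simp_all
  moreover have "lext (\<lambda>B. chain_diff (join a (?s B)) + join a (chain_diff (?s B))) v =
      lext (\<lambda>B. ?s B + retract a (?s B)) v"
    using v homotopy_basis[OF _ a] by (intro lext_cong) auto
  moreover have "retract a v = lext (\<lambda>B. retract a (?s B)) v" unfolding retract_def by simp
  ultimately show ?thesis by (simp add: lext_fun_add lext_single_eq)
qed

lemma chain_diff_add: "chain_diff (v + w) = chain_diff v + chain_diff w"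
  by (simp add: chain_diff_def lext_add)

lemma chain_diff_chain_diff:
  assumes "Poly_Mapping.keys v \<subseteq> configs"
  shows "chain_diff (chain_diff v) = 0"
proof -
  let ?s = "\<lambda>B. Poly_Mapping.single B (1::bit)"
  have "chain_diff (chain_diff (?s B)) = 0" if B: "B \<in> configs" for B
  proof -
    let ?G = "\<lambda>a b. ?s (insert b (insert a B))"
    have e: "unbroken (insert a B) = {b \<in> unbroken B. lab Z b \<noteq> lab Z a}" for a
      unfolding unbroken_def by auto
    have "chain_diff (chain_diff (?s B)) = (\<Sum>a\<in>unbroken B. \<Sum>b | b \<in> unbroken B \<and> lab Z b \<noteq> lab Z a. ?G a b)" (is "_ = ?S")
      unfolding single_chain_diff by (simp add: chain_diff_def lext_sum e)
    also have "\<dots> = (\<Sum>(a, b) \<in> {(a, b). a \<in> unbroken B \<and> b \<in> unbroken B \<and> lab Z b \<noteq> lab Z a}. ?G a b)"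
      by (subst sum.Sigma) (auto intro: sum.cong)
    also have "\<dots> = 0"
    proof -
      let ?P = "{(a, b). a \<in> unbroken B \<and> b \<in> unbroken B \<and> lab Z b \<noteq> lab Z a}"
      \<comment> \<open>Labels are natural numbers, so comparing them splits the ordered pairs of
        breaks into two halves that are exchanged by swapping and contribute equally.\<close>
      let ?P1 = "{(a, b) \<in> ?P. lab Z a < lab Z b}" and ?P2 = "{(a, b) \<in> ?P. lab Z b < lab Z a}"
      have fin: "finite ?P" by (rule finite_subset[of _ "unbroken B \<times> unbroken B"]) auto
      have "(\<Sum>(a, b) \<in> ?P. ?G a b) = (\<Sum>(a, b) \<in> ?P1 \<union> ?P2. ?G a b)"
        by (rule arg_cong[of _ _ "sum _"]) auto
      also have "\<dots> = (\<Sum>(a, b) \<in> ?P1. ?G a b) + (\<Sum>(a, b) \<in> ?P2. ?G a b)"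
        by (rule sum.union_disjoint) (auto intro: finite_subset[OF _ fin])
      also have "(\<Sum>(a, b) \<in> ?P2. ?G a b) = (\<Sum>(a, b) \<in> ?P1. ?G a b)"
        by (rule sum.reindex_bij_witness[of _ "\<lambda>(a, b). (b, a)" "\<lambda>(a, b). (b, a)"]) (auto simp: insert_commute)
      finally show ?thesis by simp
    qed
    finally show ?thesis .
  qed
  then have "lext (\<lambda>B. chain_diff (chain_diff (?s B))) v = lext (\<lambda>B. 0) v"
    using assms by (intro lext_cong) auto
  moreover have "lext (\<lambda>B. chain_diff (chain_diff (?s B))) v = chain_diff (chain_diff v)"
    unfolding chain_diff_def lext_lext lext_single ..
  ultimately show ?thesis by (simp add: lext_def)
qed

text \<open>At a core pair with only one place in \<open>F\<close> the retract is zero, so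
  \<open>join\<close> there is a contracting homotopy.\<close>

lemma once_occupied_acyclic:
  assumes v: "Poly_Mapping.keys v \<subseteq> configs" "chain_diff v = 0" and nd: "\<not> doubled"
  obtains w where "Poly_Mapping.keys w \<subseteq> configs" "v = chain_diff w"
proof -
  obtain a where a: "a \<in> F" "twin Z a \<notin> F" using nd unfolding doubled_def by blast
  have "retract a v = lext (\<lambda>B. 0) v"
    unfolding retract_def using v(1) configsD(1) a(2) by (intro lext_cong) auto
  then have "retract a v = 0" by (simp add: lext_def)
  moreover have "join a (chain_diff v) = 0" using v(2) by (simp add: join_def)
  ultimately have "v = chain_diff (join a v)" using homotopy[OF v(1) a(1)] by simp
  then show ?thesis using that keys_join[OF v(1)] by blast
qed

text \<open>Retracting pair by pair changes a cycle by boundaries only and pushes all breaks to the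
  places selected by \<open>g\<close>. The number of breaks is preserved because configurations
  unbroken at the pair are discarded.\<close>

lemma retract_cycle:
  assumes d: doubled and g: "\<And>P. P \<in> K \<Longrightarrow> g P \<in> F \<and> lab Z (g P) = P" and Q: "finite Q" "Q \<subseteq> K"
    and v: "Poly_Mapping.keys v \<subseteq> {B \<in> configs. card B = r}" "chain_diff v = 0"
  shows "\<exists>v' w. Poly_Mapping.keys v' \<subseteq> {B \<in> configs. card B = r \<and> g ` Q \<subseteq> B} \<and> Poly_Mapping.keys w \<subseteq> configs \<and>
    v + v' = chain_diff w"
  using Q
proof (induction Q)
  case empty
  then show ?case using v by (intro exI[of _ v] exI[of _ 0]) (auto simp: chain_diff_def)
next
  case (insert P Q)
  then obtain v' w where IH: "Poly_Mapping.keys v' \<subseteq> {B \<in> configs. card B = r \<and> g ` Q \<subseteq> B}"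
    "Poly_Mapping.keys w \<subseteq> configs" "v + v' = chain_diff w" by auto
  have gP: "g P \<in> F" "lab Z (g P) = P" "g P \<in> places Z" using g insert.prems F_places by auto
  \<comment> \<open>\<open>retract a\<close> moves breaks away from \<open>a\<close>, so it is
    applied at the twin of the selected place.\<close>
  define a where "a = twin Z (g P)"
  have a: "a \<in> F" "twin Z a = g P" "lab Z a = P" "a \<noteq> g P"
    using d gP twin_twin[OF gP(3)] twin_place[OF gP(3)] fibre_twin(2)[OF gP(3)] unfolding doubled_def a_def by auto
  have v'c: "Poly_Mapping.keys v' \<subseteq> configs" using IH(1) by auto
  have "chain_diff (v + v') = 0" unfolding IH(3) by (rule chain_diff_chain_diff[OF IH(2)])
  then have dv': "chain_diff v' = 0" using v(2) by (simp add: chain_diff_add)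
  have "v' + retract a v' = chain_diff (join a v')"
    using homotopy[OF v'c a(1)] dv' by (simp add: join_def)
  then have "v + retract a v' = chain_diff w + chain_diff (join a v')"
    unfolding IH(3)[symmetric] by (metis add.assoc bit_pm_add_cancel)
  then have "v + retract a v' = chain_diff (w + join a v')" by (simp add: chain_diff_add)
  moreover have "Poly_Mapping.keys (w + join a v') \<subseteq> configs"
    using IH(2) keys_join[OF v'c, of a] by (auto simp: keys_bit_add_eq)
  moreover have "Poly_Mapping.keys (retract a v') \<subseteq> {B \<in> configs. card B = r \<and> g ` insert P Q \<subseteq> B}"
    unfolding retract_def
  proof (rule keys_lext_subset)
    fix B assume "B \<in> Poly_Mapping.keys v'"
    then have B: "B \<in> configs" "card B = r" "g ` Q \<subseteq> B" using IH(1) by auto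
    show "Poly_Mapping.keys (if a \<in> B then if twin Z a \<in> F then Poly_Mapping.single (insert (twin Z a) (B - {a})) 1 else 0
        else if twin Z a \<in> B then Poly_Mapping.single B 1 else 0 :: 'i pt set \<Rightarrow>\<^sub>0 bit)
        \<subseteq> {B \<in> configs. card B = r \<and> g ` insert P Q \<subseteq> B}"
    proof (cases "a \<in> B")
      case True
      have inj: "inj_on (lab Z) B" using configsD(2)[OF B(1)] .
      have ng: "g P \<notin> B" using inj True gP(2) a(3,4) by (metis inj_onD)
      have anQ: "a \<notin> g ` Q" using insert.hyps(2) insert.prems g a(3) by auto
      have "insert (g P) (B - {a}) \<subseteq> F" using configsD(1)[OF B(1)] gP(1) by blast
      moreover have "inj_on (lab Z) (insert (g P) (B - {a}))"
        using inj True gP(2) a(3) unfolding inj_on_def by auto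
      moreover have "card (insert (g P) (B - {a})) = r"
        using ng True B(2) finite_config[OF B(1)] by (metis Diff_iff card_Suc_Diff1 card_insert_disjoint finite_Diff)
      ultimately show ?thesis using True a(2) gP(1) B(3) anQ by (auto simp: configs_def)
    next
      case False
      then show ?thesis using a(2) B by auto
    qed
  qed
  ultimately show ?case by blast
qed

text \<open>After retraction at all core pairs, the only configuration that can remain is the one
  broken exactly at the selected places. So a cycle bounds or is homologous to that configuration,
  and the latter is possible only in the degree in which no crossing is left.\<close>

lemma cycle_doubled:
  assumes d: doubled and g: "\<And>P. P \<in> K \<Longrightarrow> g P \<in> F \<and> lab Z (g P) = P"
    and v: "Poly_Mapping.keys v \<subseteq> {B \<in> configs. card B = r}" "chain_diff v = 0"
  obtains w where "Poly_Mapping.keys w \<subseteq> configs" "v = chain_diff w"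
  | w where "r = card K" "Poly_Mapping.keys w \<subseteq> configs" "v + Poly_Mapping.single (g ` K) 1 = chain_diff w"
proof -
  have "\<exists>v' w. Poly_Mapping.keys v' \<subseteq> {B \<in> configs. card B = r \<and> g ` K \<subseteq> B} \<and>
    Poly_Mapping.keys w \<subseteq> configs \<and> v + v' = chain_diff w"
    by (rule retract_cycle[OF d g finite_core order_refl v])
  then obtain v' w where w: "Poly_Mapping.keys v' \<subseteq> {B \<in> configs. card B = r \<and> g ` K \<subseteq> B}"
    "Poly_Mapping.keys w \<subseteq> configs" "v + v' = chain_diff w"
    by (elim exE conjE)
  have eq: "B = g ` K" if "B \<in> configs" "g ` K \<subseteq> B" for B
  proof
    show "B \<subseteq> g ` K"
    proof
      fix b assume b: "b \<in> B"
      then have "lab Z b \<in> K" using configsD(1)[OF that(1)] F_core by blast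
      then have "g (lab Z b) \<in> B" "lab Z (g (lab Z b)) = lab Z b" using g that(2) by auto
      then have "b = g (lab Z b)" using configsD(2)[OF that(1)] b by (metis inj_onD)
      then show "b \<in> g ` K" using \<open>lab Z b \<in> K\<close> by (metis imageI)
    qed
  qed (use that in blast)
  have k: "Poly_Mapping.keys v' \<subseteq> {g ` K}"
  proof
    fix B assume "B \<in> Poly_Mapping.keys v'"
    then have "B \<in> {B \<in> configs. card B = r \<and> g ` K \<subseteq> B}" by (rule subsetD[OF w(1)])
    then have "B = g ` K" by (intro eq) simp_all
    then show "B \<in> {g ` K}" by simp
  qed
  show ?thesis
  proof (cases "v' = 0")
    case True
    then show ?thesis using that(1) w by simp
  next
    case False
    then have kv: "Poly_Mapping.keys v' = {g ` K}" using k by (metis keys_eq_empty subset_singletonD)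
    then have "v' = Poly_Mapping.single (g ` K) 1" by (intro bit_pm_eqI) simp
    moreover have "card (g ` K) = r" using w(1) kv by auto
    moreover have "inj_on g K" using g by (metis inj_on_inverseI)
    ultimately show ?thesis using that(2) w by (simp add: card_image)
  qed
qed

lemma unbroken_empty_iff: "B \<in> configs \<Longrightarrow> unbroken B = {} \<longleftrightarrow> lab Z ` B = K"
proof
  assume B: "B \<in> configs" and u: "unbroken B = {}"
  show "lab Z ` B = K"
  proof (intro equalityI subsetI)
    fix P assume "P \<in> K"
    then obtain a where "a \<in> F" "P = lab Z a" by (metis core_brk imageE)
    then show "P \<in> lab Z ` B" using u unfolding unbroken_def by blast
  qed (use configsD(1)[OF B] F_core in blast)
next
  assume "lab Z ` B = K"
  then show "unbroken B = {}" using F_core unfolding unbroken_def by auto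
qed

text \<open>The sum of the coefficients of the diagrams without crossings vanishes on boundaries.\<close>

lemma crossingless_not_boundary:
  assumes d: doubled and B: "B \<in> configs" "lab Z ` B = K" and w: "Poly_Mapping.keys w \<subseteq> configs"
  shows "Poly_Mapping.single B 1 \<noteq> chain_diff w"
proof
  define e where "e = lext (\<lambda>B. if lab Z ` B = K then Poly_Mapping.single () (1::bit) else 0)"
  assume "Poly_Mapping.single B 1 = chain_diff w"
  moreover have "e (Poly_Mapping.single B 1) = Poly_Mapping.single () 1" using B(2) by (simp add: e_def)
  moreover have "e (chain_diff w) = 0"
  proof -
    have z: "e (chain_diff (Poly_Mapping.single C 1)) = 0" if C: "C \<in> configs" for C
    proof -
      have "e (chain_diff (Poly_Mapping.single C 1)) =
          (\<Sum>a\<in>unbroken C. if insert (lab Z a) (lab Z ` C) = K then Poly_Mapping.single () (1::bit) else 0)"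
        by (simp add: single_chain_diff e_def lext_sum)
      also have "\<dots> = 0"
      proof (cases "\<exists>a \<in> unbroken C. insert (lab Z a) (lab Z ` C) = K")
        case False
        then show ?thesis by (intro sum.neutral) auto
      next
        case True
        then obtain a where a: "a \<in> unbroken C" "insert (lab Z a) (lab Z ` C) = K" by blast
        have aF: "a \<in> F" "lab Z a \<notin> lab Z ` C" using a(1) by (auto simp: unbroken_def)
        have ap: "a \<in> places Z" using F_places[OF aF(1)] .
        \<comment> \<open>If one break leads to no crossings, a single pair was still unbroken. It
          is doubly occupied, so it can be broken at either place, and the two contributions
          cancel.\<close>
        have "unbroken C = {a, twin Z a}"
        proof (intro equalityI subsetI)
          fix b assume "b \<in> unbroken C"
          then have b: "b \<in> F" "lab Z b \<notin> lab Z ` C" by (auto simp: unbroken_def)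
          then have "lab Z b = lab Z a" using F_core[OF b(1)] a(2) by auto
          then show "b \<in> {a, twin Z a}" using same_lab[OF ap F_places[OF b(1)]] by blast
        next
          fix b assume "b \<in> {a, twin Z a}"
          then have "b \<in> F" "lab Z b = lab Z a" using aF(1) d twin_place(2)[OF ap] unfolding doubled_def by auto
          then show "b \<in> unbroken C" using aF(2) unfolding unbroken_def by simp
        qed
        then show ?thesis using a(2) twin_place(2)[OF ap] fibre_twin(2)[OF ap] by simp
      qed
      finally show ?thesis .
    qed
    have "e (chain_diff w) = lext (\<lambda>C. e (chain_diff (Poly_Mapping.single C 1))) w"
      unfolding e_def chain_diff_def lext_lext lext_single ..
    also have "\<dots> = lext (\<lambda>C. 0) w" using z w by (intro lext_cong) auto
    finally show ?thesis by (simp add: lext_def)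
  qed
  ultimately show False by (metis lookup_single_eq lookup_zero zero_neq_one)
qed

section \<open>Chains of configurations as elements of the algebra\<close>

lemma realize_add: "realize (v + w) = realize v + realize w"
  by (simp add: realize_def lext_add)

lemma realize_single [simp]: "realize (Poly_Mapping.single B 1) = Dg h s t B"
  by (simp add: realize_def)

lemma Dg_configs:
  assumes "B \<in> configs"
  shows "Dg h s t B \<in> diagrams Z" "hdata_of Z (Dg h s t B) = (h, s, t)" "hgrading (Dg h s t B) = h"
    "src Z (Dg h s t B) = s" "tgt Z (Dg h s t B) = t" "moving (Dg h s t B) = strands h B" "Dg h s t B \<noteq> 0"
  using Dg_diagram[OF viable configsD(3)[OF assms] configs_config_ok[OF assms]] by auto

lemma Dg_inj:
  assumes "B \<in> configs" "C \<in> configs" "Dg h s t B = Dg h s t C"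
  shows "B = C"
proof -
  have "strands h B = strands h C" using Dg_configs(6)[OF assms(1)] Dg_configs(6)[OF assms(2)] assms(3) by simp
  then have "Domain (strands h B) \<inter> Range (strands h B) = Domain (strands h C) \<inter> Range (strands h C)"
    by (rule arg_cong)
  then show ?thesis
    unfolding Domain_Int_Range_strands[OF viable configsD(3)[OF assms(1)]]
      Domain_Int_Range_strands[OF viable configsD(3)[OF assms(2)]] .
qed

text \<open>Diagrams of different configurations share no terms. Hence nothing cancels,
  \<open>realize\<close> is injective on chains, and a condition on the terms of an element can be
  checked on each configuration.\<close>

lemma terms_realize:
  assumes "Poly_Mapping.keys v \<subseteq> configs"
  shows "terms (realize v) = (\<Union>B \<in> Poly_Mapping.keys v. terms (Dg h s t B))"
  unfolding realize_def lext_def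
proof (rule keys_sum_disjoint)
  fix B C assume BC: "B \<in> Poly_Mapping.keys v" "C \<in> Poly_Mapping.keys v" "B \<noteq> C"
  then have c: "B \<in> configs" "C \<in> configs" using assms by auto
  show "terms (Dg h s t B) \<inter> terms (Dg h s t C) = {}"
    using diagrams_disjoint[OF Dg_configs(1)[OF c(1)] Dg_configs(1)[OF c(2)]] Dg_inj[OF c] BC(3) by blast
qed simp

lemma realize_eq_0:
  assumes "Poly_Mapping.keys v \<subseteq> configs" "realize v = 0"
  shows "v = 0"
proof (rule ccontr)
  assume "v \<noteq> 0"
  then obtain B where B: "B \<in> Poly_Mapping.keys v" by (metis ex_in_conv keys_eq_empty)
  then have "Dg h s t B \<noteq> 0" using assms(1) Dg_configs(7) by blast
  then obtain \<kappa> where "\<kappa> \<in> terms (Dg h s t B)" by (metis ex_in_conv keys_eq_empty)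
  then have "\<kappa> \<in> terms (realize v)" using terms_realize[OF assms(1)] B by blast
  then show False using assms(2) by simp
qed

lemma realize_inj:
  assumes "Poly_Mapping.keys v \<subseteq> configs" "Poly_Mapping.keys w \<subseteq> configs" "realize v = realize w"
  shows "v = w"
proof -
  have "Poly_Mapping.keys (v + w) \<subseteq> configs" using assms(1,2) by (auto simp: keys_bit_add_eq)
  moreover have "realize (v + w) = 0" using assms(3) by (simp add: realize_add)
  ultimately show ?thesis using realize_eq_0 bit_pm_add_eq_0 by blast
qed

lemma diagram_with_data:
  assumes "D \<in> diagrams Z" "hdata_of Z D = (h, s, t)"
  obtains B where "B \<in> configs" "D = Dg h s t B"
proof -
  have e: "hgrading D = h" "src Z D = s" "tgt Z D = t" using assms(2) by (auto simp: hdata_of_def)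
  have "viable01 Z (hgrading D)" using viable e by simp
  from viable_diagram_Dg[OF assms(1) this] obtain B where "B \<subseteq> F" "inj_on (lab Z) B" "D = Dg h s t B"
    unfolding e by metis
  then show ?thesis using that[of B] unfolding configs_def by blast
qed

lemma alg_summand_iff: "x \<in> alg_summand Z (h, s, t) \<longleftrightarrow> (\<exists>v. Poly_Mapping.keys v \<subseteq> configs \<and> x = realize v)"
proof
  assume "x \<in> alg_summand Z (h, s, t)"
  then obtain G where G: "finite G" "G \<subseteq> {D \<in> diagrams Z. hdata_of Z D = (h, s, t)}" "x = (\<Sum>D\<in>G. D)"
    unfolding alg_summand_def lin_span_def by blast
  have "\<forall>D \<in> G. \<exists>B. B \<in> configs \<and> D = Dg h s t B" 
  proof
    fix D assume "D \<in> G"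
    then have "D \<in> diagrams Z" "hdata_of Z D = (h, s, t)" using G(2) by auto
    then show "\<exists>B. B \<in> configs \<and> D = Dg h s t B" by (rule diagram_with_data) blast
  qed
  then obtain b where b: "\<And>D. D \<in> G \<Longrightarrow> b D \<in> configs \<and> D = Dg h s t (b D)" by metis
  have inj: "inj_on b G" using b by (metis inj_onI)
  have "realize (el (b ` G)) = (\<Sum>D\<in>G. Dg h s t (b D))"
    using G(1) inj by (simp add: realize_def lext_def sum.reindex)
  also have "\<dots> = x" unfolding G(3) using b by (intro sum.cong) auto
  finally have "x = realize (el (b ` G))" ..
  moreover have "Poly_Mapping.keys (el (b ` G)) \<subseteq> configs" using G(1) b by auto
  ultimately show "\<exists>v. Poly_Mapping.keys v \<subseteq> configs \<and> x = realize v" by blast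
next
  assume "\<exists>v. Poly_Mapping.keys v \<subseteq> configs \<and> x = realize v"
  then obtain v where v: "Poly_Mapping.keys v \<subseteq> configs" "x = realize v" by blast
  have "Dg h s t B \<in> lin_span {D \<in> diagrams Z. hdata_of Z D = (h, s, t)}" if "B \<in> Poly_Mapping.keys v" for B
  proof (rule lin_span_base)
    have "B \<in> configs" using that v(1) by blast
    then show "Dg h s t B \<in> {D \<in> diagrams Z. hdata_of Z D = (h, s, t)}" using Dg_configs(1,2) by simp
  qed
  then show "x \<in> alg_summand Z (h, s, t)"
    unfolding v(2) alg_summand_def realize_def lext_def by (rule lin_span_sum)
qed

end

section \<open>Boundaries respect H-data\<close>

text \<open>H-data read off a single term. It serves to split elements of the whole algebra, since a
  boundary need not come from an element of one summand.\<close>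

definition term_data :: "'i arc_diagram \<Rightarrow> 'i sd \<Rightarrow> 'i hdata" where
  "term_data Z \<kappa> = (sd_hgr \<kappa>, lab Z ` (Domain \<kappa> \<inter> places Z), lab Z ` (Range \<kappa> \<inter> places Z))"

context pre_arc_diagram
begin

lemma term_data_diagram: "D \<in> diagrams Z \<Longrightarrow> \<kappa> \<in> terms D \<Longrightarrow> term_data Z \<kappa> = hdata_of Z D"
  using term_of_diagram[of D \<kappa>] by (simp add: term_data_def hdata_of_def)

text \<open>A resolution exchanges two final places and keeps domain and range, on which all of the
  H-data depends.\<close>

lemma term_data_resolve:
  assumes \<kappa>: "strand_diagram Z \<kappa>" and c: "c \<in> crossings \<kappa>"
  shows "term_data Z (resolve \<kappa> c) = term_data Z \<kappa>"
proof -
  obtain u v where uv: "c = (u, v)" by (cases c)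
  obtain x x' where u: "u = (x, x')" by (cases u)
  obtain y y' where v: "v = (y, y')" by (cases v)
  note e = uv[unfolded u v]
  have m: "(x, x') \<in> \<kappa>" "(y, y') \<in> \<kappa>" and l: "pt_less x y" "pt_less y' x'"
    using c unfolding crossings_def e by auto
  let ?\<rho> = "(\<kappa> - {(x, x'), (y, y')}) \<union> {(x, y'), (y, x')}"
  note inj = strand_diagram_inj[OF \<kappa>]
  have r: "resolve \<kappa> c = ?\<rho>" by (simp add: resolve_def e)
  have le: "pt_le x x'" "pt_le y y'" using \<kappa> m unfolding strand_diagram_def by auto
  have ne: "x \<noteq> y" "x' \<noteq> y'" using l by (auto simp: pt_less_def)
  have D: "Domain ?\<rho> = Domain \<kappa>" and R: "Range ?\<rho> = Range \<kappa>" using m by blast+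
  have "w = w'" if "(z, w) \<in> ?\<rho>" "(z, w') \<in> ?\<rho>" for z w w'
    using that inj(1) m ne by blast
  moreover have "z = z'" if "(z, w) \<in> ?\<rho>" "(z', w) \<in> ?\<rho>" for z z' w
    using that inj(2) m ne by blast
  ultimately have "inj_on fst ?\<rho>" "inj_on snd ?\<rho>"
    unfolding inj_on_def by (metis prod.collapse)+
  moreover have "pt_le z w" if "(z, w) \<in> ?\<rho>" for z w
  proof -
    have "pt_le x y'" "pt_le y x'" using le l by (auto simp: pt_le_def pt_less_def)
    then show ?thesis using that \<kappa> unfolding strand_diagram_def by auto
  qed
  moreover have "?\<rho> \<subseteq> points Z \<times> points Z"
  proof -
    have "\<kappa> \<subseteq> points Z \<times> points Z" using \<kappa> unfolding strand_diagram_def by blast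
    then show ?thesis using m by blast
  qed
  ultimately have "strand_diagram Z ?\<rho>" unfolding strand_diagram_def by blast
  then have "sd_hgr ?\<rho> = sd_hgr \<kappa>"
    by (intro ext) (simp only: sd_hgr_Domain_Range \<kappa> D R)
  then show ?thesis unfolding r term_data_def D R by simp
qed

lemma term_data_diff:
  assumes D: "D \<in> diagrams Z" and \<kappa>: "\<kappa> \<in> terms (\<partial> D)"
  shows "term_data Z \<kappa> = hdata_of Z D"
proof -
  have "terms (\<partial> D) \<subseteq> (\<Union>\<mu>\<in>terms D. terms (sd_diff \<mu>))"
    unfolding diff_def by (rule keys_sum)
  then obtain \<mu> where \<mu>: "\<mu> \<in> terms D" "\<kappa> \<in> terms (sd_diff \<mu>)" using \<kappa> by blast
  have "terms (sd_diff \<mu>) \<subseteq> (\<Union>c\<in>{c \<in> crossings \<mu>. inv_count (resolve \<mu> c) + 1 = inv_count \<mu>}. terms (sd_of (resolve \<mu> c)))"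
    unfolding sd_diff_def by (rule keys_sum)
  then obtain c where c: "c \<in> crossings \<mu>" "\<kappa> = resolve \<mu> c" using \<mu>(2) by (auto split: if_splits)
  show ?thesis
    unfolding c(2) using term_data_resolve[OF term_of_diagram(4)[OF D \<mu>(1)] c(1)] term_data_diagram[OF D \<mu>(1)] by simp
qed

lemma terms_sum_data:
  assumes "\<And>i x. i \<in> I \<Longrightarrow> x \<in> terms (g i) \<Longrightarrow> Q (term_data Z x)" and "x \<in> terms (\<Sum>i\<in>I. g i)"
  shows "Q (term_data Z x)"
  using assms keys_sum[of g I] by blast

text \<open>\<open>y\<close> consists of the diagrams with H-data \<open>d\<close> in an element
  bounded by \<open>x\<close>; the boundaries of the others contain no term with these data.\<close>

lemma boundary_part:
  assumes bd: "x \<in> boundaries Z"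
  obtains y where "y \<in> alg_summand Z d" "\<forall>\<kappa> \<in> terms (\<partial> y). term_data Z \<kappa> = d"
    "\<forall>\<kappa> \<in> terms (x + \<partial> y). term_data Z \<kappa> \<noteq> d"
proof -
  obtain e where e: "e \<in> strand_algebra Z" "x = \<partial> e" using bd unfolding boundaries_def by blast
  obtain G where G: "finite G" "G \<subseteq> diagrams Z" "e = (\<Sum>D\<in>G. D)"
    using e(1) unfolding strand_algebra_def lin_span_def by blast
  let ?G1 = "{D \<in> G. hdata_of Z D = d}" and ?G2 = "{D \<in> G. hdata_of Z D \<noteq> d}"
  have "x = (\<Sum>D\<in>G. \<partial> D)" unfolding e(2) G(3) diff_sum ..
  also have "\<dots> = (\<Sum>D\<in>?G2. \<partial> D) + (\<Sum>D\<in>?G1. \<partial> D)"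
    using G(1) by (subst sum.union_disjoint[symmetric]) (auto intro: arg_cong[of _ _ "sum \<partial>"])
  finally have eq: "x + (\<Sum>D\<in>?G1. \<partial> D) = (\<Sum>D\<in>?G2. \<partial> D)"
    by (simp only: add.assoc bit_pm_add_self add_0_right)
  have t1: "term_data Z \<kappa> = d" if \<kappa>: "\<kappa> \<in> terms (\<Sum>D\<in>?G1. \<partial> D)" for \<kappa>
    by (rule terms_sum_data[OF _ \<kappa>]) (use term_data_diff G(2) in auto)
  have t2: "term_data Z \<kappa> \<noteq> d" if \<kappa>: "\<kappa> \<in> terms (\<Sum>D\<in>?G2. \<partial> D)" for \<kappa>
    by (rule terms_sum_data[OF _ \<kappa>]) (use term_data_diff G(2) in auto)
  show ?thesis
  proof (rule that[of "\<Sum>D\<in>?G1. D"])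
    show "(\<Sum>D\<in>?G1. D) \<in> alg_summand Z d"
      unfolding alg_summand_def by (rule lin_span_sum, rule lin_span_base) (use G(2) in auto)
    show "\<forall>\<kappa> \<in> terms (\<partial> (\<Sum>D\<in>?G1. D)). term_data Z \<kappa> = d"
      using t1 unfolding diff_sum by blast
    show "\<forall>\<kappa> \<in> terms (x + \<partial> (\<Sum>D\<in>?G1. D)). term_data Z \<kappa> \<noteq> d"
      using t2 unfolding diff_sum eq by blast
  qed
qed

lemma boundary_summand:
  assumes x: "\<And>\<kappa>. \<kappa> \<in> terms x \<Longrightarrow> term_data Z \<kappa> = d" and bd: "x \<in> boundaries Z"
  obtains y where "y \<in> alg_summand Z d" "x = \<partial> y"
proof -
  obtain y where y: "y \<in> alg_summand Z d" "\<forall>\<kappa> \<in> terms (\<partial> y). term_data Z \<kappa> = d"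
    "\<forall>\<kappa> \<in> terms (x + \<partial> y). term_data Z \<kappa> \<noteq> d"
    by (rule boundary_part[OF bd, where d = d])
  have "terms (x + \<partial> y) = {}"
    using x y(2,3) unfolding keys_bit_add_eq by blast
  then have "x = \<partial> y" by (simp only: keys_eq_empty bit_pm_add_eq_0)
  with that y(1) show ?thesis .
qed

lemma alg_summand_term_data:
  assumes x: "x \<in> alg_summand Z d" and \<kappa>: "\<kappa> \<in> terms x"
  shows "term_data Z \<kappa> = d"
proof -
  obtain G where G: "G \<subseteq> {D \<in> diagrams Z. hdata_of Z D = d}" "x = (\<Sum>D\<in>G. D)"
    using x unfolding alg_summand_def lin_span_def by blast
  show ?thesis
    by (rule terms_sum_data[OF _ \<kappa>[unfolded G(2)]]) (use term_data_diagram G(1) in auto)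
qed

lemma alg_summand_strand_algebra: "alg_summand Z d \<subseteq> strand_algebra Z"
  unfolding alg_summand_def strand_algebra_def by (rule lin_span_mono) auto

text \<open>Makes the H-data of a nonzero class independent of the diagram picked by
  \<open>rep\<close>. If the data differed, the part of the bounding element with the data of
  \<open>D\<close> would already bound \<open>D\<close>.\<close>

lemma diagrams_hclass_data:
  assumes D: "D \<in> diagrams Z" and D': "D' \<in> diagrams Z" and e: "hclass Z D = hclass Z D'" and n: "hclass Z D \<noteq> hclass Z 0"
  shows "hdata_of Z D = hdata_of Z D'"
proof (rule ccontr)
  assume ne: "hdata_of Z D \<noteq> hdata_of Z D'"
  have bd: "D + D' \<in> boundaries Z" using e hclass_eq_iff by blast
  obtain y where y: "y \<in> alg_summand Z (hdata_of Z D)" "\<forall>\<kappa> \<in> terms (\<partial> y). term_data Z \<kappa> = hdata_of Z D"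
    "\<forall>\<kappa> \<in> terms (D + D' + \<partial> y). term_data Z \<kappa> \<noteq> hdata_of Z D"
    by (rule boundary_part[OF bd, where d = "hdata_of Z D"])
  have "terms (D + \<partial> y) = {}"
  proof (rule ccontr)
    assume "terms (D + \<partial> y) \<noteq> {}"
    then obtain \<kappa> where \<kappa>: "\<kappa> \<in> terms (D + \<partial> y)" by blast
    then have d: "term_data Z \<kappa> = hdata_of Z D"
      using term_data_diagram[OF D] y(2) unfolding keys_bit_add_eq by blast
    then have "\<kappa> \<notin> terms D'" using term_data_diagram[OF D'] ne by metis
    then have "\<kappa> \<in> terms (D + D' + \<partial> y)" using \<kappa> unfolding keys_bit_add by blast
    then show False using y(3) d by blast
  qed
  then have "D + 0 = \<partial> y" by (simp only: keys_eq_empty bit_pm_add_eq_0 add_0_right)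
  then have "D + 0 \<in> boundaries Z"
    using y(1) alg_summand_strand_algebra unfolding boundaries_def by blast
  then show False using n hclass_eq_iff by blast
qed

end

context viable_data
begin

text \<open>An element of the summand that bounds in the whole algebra bounds inside the summand, so
  homology can be computed with chains of configurations.\<close>

lemma boundary_iff:
  assumes v: "Poly_Mapping.keys v \<subseteq> configs"
  shows "realize v \<in> boundaries Z \<longleftrightarrow> (\<exists>w. Poly_Mapping.keys w \<subseteq> configs \<and> v = chain_diff w)"
proof
  have vs: "realize v \<in> alg_summand Z (h, s, t)" using alg_summand_iff v by blast
  assume b: "realize v \<in> boundaries Z"
  obtain y where y: "y \<in> alg_summand Z (h, s, t)" "realize v = \<partial> y"
    by (rule boundary_summand[OF alg_summand_term_data[OF vs] b])
  obtain w where w: "Poly_Mapping.keys w \<subseteq> configs" "y = realize w" using y(1) alg_summand_iff by blast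
  have "realize v = realize (chain_diff w)" using y(2) w realize_chain_diff by simp
  then have "v = chain_diff w" by (rule realize_inj[OF v keys_chain_diff[OF w(1)]])
  then show "\<exists>w. Poly_Mapping.keys w \<subseteq> configs \<and> v = chain_diff w" using w by blast
next
  assume "\<exists>w. Poly_Mapping.keys w \<subseteq> configs \<and> v = chain_diff w"
  then obtain w where w: "Poly_Mapping.keys w \<subseteq> configs" "v = chain_diff w" by blast
  have "realize w \<in> strand_algebra Z" using alg_summand_iff w alg_summand_strand_algebra by blast
  moreover have "realize v = \<partial> (realize w)" unfolding w(2) by (rule realize_chain_diff[OF w(1), symmetric])
  ultimately show "realize v \<in> boundaries Z" unfolding boundaries_def by blast
qed

lemma cycle_iff:
  assumes v: "Poly_Mapping.keys v \<subseteq> configs"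
  shows "\<partial> (realize v) = 0 \<longleftrightarrow> chain_diff v = 0"
  unfolding realize_chain_diff[OF v] using realize_eq_0[OF keys_chain_diff[OF v]] by (auto simp: realize_def)

text \<open>Breaks at different places give different configurations, so the terms in the
  differential of a single one cannot cancel.\<close>

lemma chain_diff_single_eq_0:
  assumes B: "B \<in> configs"
  shows "chain_diff (Poly_Mapping.single B 1) = 0 \<longleftrightarrow> lab Z ` B = K"
proof -
  have inj: "inj_on (\<lambda>a. insert a B) (unbroken B)"
  proof (rule inj_onI)
    fix a b assume "a \<in> unbroken B" "b \<in> unbroken B" "insert a B = insert b B"
    then show "a = b" using insert_unbroken[OF B] by blast
  qed
  have "chain_diff (Poly_Mapping.single B 1) = el ((\<lambda>a. insert a B) ` unbroken B)"
    unfolding single_chain_diff by (rule sum_el_image[OF inj])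
  then show ?thesis using unbroken_empty_iff[OF B] by (simp add: el_eq_0)
qed

lemma single_configs: "B \<in> configs \<Longrightarrow> Poly_Mapping.keys (Poly_Mapping.single B (1::bit)) \<subseteq> configs"
  by simp

lemma Dg_cycle_iff: "B \<in> configs \<Longrightarrow> \<partial> (Dg h s t B) = 0 \<longleftrightarrow> lab Z ` B = K"
  using cycle_iff[OF single_configs] chain_diff_single_eq_0 by simp

lemma Dg_hclass:
  assumes B: "B \<in> configs" "lab Z ` B = K"
  shows "hclass Z (Dg h s t B) \<noteq> hclass Z 0 \<longleftrightarrow> doubled"
proof -
  have b: "hclass Z (Dg h s t B) = hclass Z 0 \<longleftrightarrow>
      (\<exists>w. Poly_Mapping.keys w \<subseteq> configs \<and> Poly_Mapping.single B 1 = chain_diff w)"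
    using boundary_iff[OF single_configs[OF B(1)]] hclass_eq_iff[of Z "Dg h s t B" 0] by simp
  show ?thesis
  proof (cases doubled)
    case True
    then show ?thesis using b crossingless_not_boundary[OF True B] by blast
  next
    case False
    have "chain_diff (Poly_Mapping.single B 1) = 0" using chain_diff_single_eq_0[OF B(1)] B(2) by blast
    from once_occupied_acyclic[OF single_configs[OF B(1)] this False] show ?thesis using b False by metis
  qed
qed

text \<open>The horizontal strand in a crossing can be traded for a break at its place, so its pair
  is a core pair that is not yet broken. Conversely an unbroken core pair gives a nonzero
  differential, which needs a crossing.\<close>

lemma has_crossing_Dg:
  assumes B: "B \<in> configs"
  shows "has_crossing (Dg h s t B) \<longleftrightarrow> lab Z ` B \<noteq> K"
proof
  assume "has_crossing (Dg h s t B)"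
  then obtain \<kappa> where \<kappa>: "\<kappa> \<in> terms (Dg h s t B)" "crossings \<kappa> \<noteq> {}" unfolding has_crossing_def by blast
  then obtain U where U: "U \<in> hset Z s t (strands h B)" "\<kappa> = strands h B \<union> Id_on U"
    unfolding Dg_def terms_diag[OF moving_strands[OF viable]] by blast
  then have d: "U \<inter> Domain (strands h B) = {}" by (auto simp: hset_def)
  then obtain a where a: "a \<in> U" "h a = 1" using \<kappa>(2) unfolding U(2) crossings_term[OF viable d] by blast
  then have "a \<notin> Domain (strands h B)" using d by blast
  then have af: "a \<in> full Z h" "a \<notin> B" using covered_horizontal[OF viable _ a(2)] by blast+
  have "U - {a} \<in> hset Z s t (strands h (insert a B))"
  proof -
    have "insert a A \<union> (U - {a}) = A \<union> U" for A using a(1) by blast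
    then show ?thesis using U(1) unfolding hset_def full_insert_strands[OF viable af(1)] by auto
  qed
  moreover have sub: "insert a B \<subseteq> full Z h" using configsD(3)[OF B] af(1) by blast
  ultimately have "config_ok h s t (insert a B)" using hset_nonempty_iff[OF viable sub] by blast
  then have "insert a B \<subseteq> F" "inj_on (lab Z) (insert a B)" using config_ok_iff[OF viable sub] by blast+
  then have "a \<in> unbroken B" using af(2) unfolding unbroken_def by auto
  then show "lab Z ` B \<noteq> K" using unbroken_empty_iff[OF B] by blast
next
  assume "lab Z ` B \<noteq> K"
  then have "\<partial> (Dg h s t B) \<noteq> 0" using Dg_cycle_iff[OF B] by blast
  moreover have "\<partial> D = 0" if "\<not> has_crossing D" for D :: "'i elt"
  proof -
    have "sd_diff \<mu> = 0" if "\<mu> \<in> terms D" for \<mu>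
    proof -
      have "crossings \<mu> = {}" using that \<open>\<not> has_crossing D\<close> unfolding has_crossing_def by blast
      then show ?thesis unfolding sd_diff_def by (intro sum.neutral) simp
    qed
    then show ?thesis unfolding diff_def by simp
  qed
  ultimately show "has_crossing (Dg h s t B)" by blast
qed

lemma Dg_viable: "B \<in> configs \<Longrightarrow> viable_diag Z (Dg h s t B)"
  unfolding viable_diag_def using Dg_configs[of B] viable viable_hgr_diagram[of "Dg h s t B"] by simp

lemma Dg_types:
  assumes B: "B \<in> configs"
  shows "crossed_diag Z (Dg h s t B) \<longleftrightarrow> lab Z ` B \<noteq> K"
    "tight_diag Z (Dg h s t B) \<longleftrightarrow> lab Z ` B = K \<and> doubled"
    "twisted_diag Z (Dg h s t B) \<longleftrightarrow> lab Z ` B = K \<and> \<not> doubled"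
  unfolding crossed_diag_def tight_diag_def twisted_diag_def
  using Dg_viable[OF B] has_crossing_Dg[OF B] Dg_hclass[OF B] by auto

end

section \<open>Products of diagrams without crossings\<close>

text \<open>The moving strands of a product. Strands that meet are concatenated, the others are
  prolonged by a horizontal strand of the other factor, so the result does not depend on the terms
  composed.\<close>

definition glue :: "'i sd \<Rightarrow> 'i sd \<Rightarrow> 'i sd" where
  "glue \<mu> \<nu> = {(x, y) \<in> \<mu>. y \<notin> Domain \<nu>} \<union> {(x, y) \<in> \<nu>. x \<notin> Range \<mu>} \<union> \<mu> O \<nu>"

lemma Domain_glue: "Domain (glue \<mu> \<nu>) = Domain \<mu> \<union> (Domain \<nu> - Range \<mu>)"
  unfolding glue_def by blast

lemma Range_glue: "Range (glue \<mu> \<nu>) = Range \<nu> \<union> (Range \<mu> - Domain \<nu>)"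
  unfolding glue_def by blast

lemma glue_Id_on:
  assumes "U \<inter> Range \<mu> = {}" "V \<inter> Domain \<nu> = {}" "Range \<mu> \<union> U = Domain \<nu> \<union> V"
  shows "(\<mu> \<union> Id_on U) O (\<nu> \<union> Id_on V) = glue \<mu> \<nu> \<union> Id_on (U \<inter> V)"
proof (intro equalityI subrelI)
  fix x z assume "(x, z) \<in> (\<mu> \<union> Id_on U) O (\<nu> \<union> Id_on V)"
  then obtain y where y: "(x, y) \<in> \<mu> \<or> x = y \<and> y \<in> U" "(y, z) \<in> \<nu> \<or> y = z \<and> y \<in> V" by auto
  then show "(x, z) \<in> glue \<mu> \<nu> \<union> Id_on (U \<inter> V)" using assms(1,2) unfolding glue_def by auto
next
  fix x z assume "(x, z) \<in> glue \<mu> \<nu> \<union> Id_on (U \<inter> V)"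
  then consider "(x, z) \<in> \<mu>" "z \<notin> Domain \<nu>" | "(x, z) \<in> \<nu>" "x \<notin> Range \<mu>" | "(x, z) \<in> \<mu> O \<nu>" | "x = z" "z \<in> U" "z \<in> V"
    unfolding glue_def by auto
  then show "(x, z) \<in> (\<mu> \<union> Id_on U) O (\<nu> \<union> Id_on V)"
  proof cases
    case 1
    then have "z \<in> V" using assms(3) by blast
    then show ?thesis using 1 by blast
  next
    case 2
    then have "x \<in> U" using assms(3) by blast
    then show ?thesis using 2 by blast
  qed blast+
qed

text \<open>Without crossings in the factors, two strands exchanged by the composite would have to
  meet in the middle, contradicting injectivity. So the inversion condition in
  \<open>sd_mult\<close> holds automatically, and a product can vanish only for lack of composable
  terms.\<close>

lemma crossings_relcomp:
  assumes \<kappa>: "strand_diagram Z \<kappa>" and c: "crossings \<kappa> = {}" "crossings \<kappa>' = {}"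
  shows "crossings (\<kappa> O \<kappa>') = {}"
proof (rule ccontr)
  assume "crossings (\<kappa> O \<kappa>') \<noteq> {}"
  then obtain x x'' y y'' where m: "(x, x'') \<in> \<kappa> O \<kappa>'" "(y, y'') \<in> \<kappa> O \<kappa>'" "pt_less x y" "pt_less y'' x''"
    unfolding crossings_def by blast
  obtain x' where x': "(x, x') \<in> \<kappa>" "(x', x'') \<in> \<kappa>'" using m(1) by blast
  obtain y' where y': "(y, y') \<in> \<kappa>" "(y', y'') \<in> \<kappa>'" using m(2) by blast
  have le: "pt_le x x'" "pt_le y y'" using \<kappa> x'(1) y'(1) unfolding strand_diagram_def by auto
  have "\<not> pt_less y' x'" using c(1) x' y' m(3) unfolding crossings_def by blast
  moreover have "\<not> pt_less x' y'" using c(2) x' y' m(4) unfolding crossings_def by blast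
  moreover have "fst x' = fst y'" using le m(3) by (simp add: pt_le_def pt_less_def)
  ultimately have "x' = y'" by (simp add: pt_less_def prod_eq_iff)
  then have "x = y" using strand_diagram_inj(2)[OF \<kappa>] x'(1) y'(1) by blast
  then show False using m(3) by (simp add: pt_less_def)
qed

context pre_arc_diagram
begin

lemma moving_not_endpoint:
  assumes "moving_sd Z \<mu>" "moving_sd Z \<nu>" "x \<in> Range \<mu>" "x \<in> Domain \<nu>"
  shows "x \<in> places Z"
proof -
  obtain w where w: "(w, x) \<in> \<mu>" using assms(3) by blast
  obtain y where y: "(x, y) \<in> \<nu>" using assms(4) by blast
  have "pt_le w x" "w \<noteq> x" "pt_le x y" "x \<noteq> y" "x \<in> points Z" "y \<in> points Z"
    using assms(1,2) w y unfolding moving_sd_def strand_diagram_def by auto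
  then show ?thesis unfolding points_def places_def pt_le_def by (cases w; cases x; cases y) auto
qed

text \<open>The pairs carried by the horizontal places in a section of \<open>s\<close> are those of
  \<open>s\<close> not met by \<open>B\<close>. Hence \<open>W\<close> and \<open>W0\<close> carry
  the same pairs and are interchangeable in the section of \<open>t\<close>.\<close>

lemma sect_replace:
  assumes t: "sect Z t (A \<union> W0)" and s0: "sect Z s (B \<union> W0)" and s: "sect Z s (B \<union> W)"
    and d: "W0 \<inter> A = {}" "W0 \<inter> B = {}" "W \<inter> B = {}"
  shows "sect Z t (A \<union> W)" "W \<inter> A \<inter> places Z = {}"
proof -
  let ?p = "places Z" and ?l = "lab Z"
  have lW: "?l ` (X \<inter> ?p) = s - ?l ` (B \<inter> ?p)" if X: "sect Z s (B \<union> X)" "X \<inter> B = {}" for X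
  proof -
    have "(B \<union> X) \<inter> ?p = (B \<inter> ?p) \<union> (X \<inter> ?p)" by blast
    then have i: "inj_on ?l ((B \<inter> ?p) \<union> (X \<inter> ?p))" "?l ` (B \<inter> ?p) \<union> ?l ` (X \<inter> ?p) = s"
      using X(1) unfolding sect_def by (simp_all add: image_Un)
    have "?l ` (B \<inter> ?p) \<inter> ?l ` (X \<inter> ?p) = {}"
      using inj_on_image_Int[OF i(1), of "B \<inter> ?p" "X \<inter> ?p"] X(2) by blast
    then show ?thesis using i(2) by blast
  qed
  have e: "?l ` (W \<inter> ?p) = ?l ` (W0 \<inter> ?p)" using lW[OF s d(3)] lW[OF s0 d(2)] by simp
  have u: "(A \<union> X) \<inter> ?p = (A \<inter> ?p) \<union> (X \<inter> ?p)" for X by blast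
  have ti: "inj_on ?l ((A \<inter> ?p) \<union> (W0 \<inter> ?p))" "?l ` (A \<inter> ?p) \<union> ?l ` (W0 \<inter> ?p) = t"
    using t unfolding sect_def u by (simp_all add: image_Un)
  have dis: "?l ` (A \<inter> ?p) \<inter> ?l ` (W0 \<inter> ?p) = {}"
    using inj_on_image_Int[OF ti(1), of "A \<inter> ?p" "W0 \<inter> ?p"] d(1) by blast
  have "inj_on ?l (W \<inter> ?p)" using s unfolding sect_def by (meson Int_mono Un_upper2 inj_on_subset subset_refl)
  moreover have "inj_on ?l (A \<inter> ?p)" using ti(1) by (rule inj_on_subset) blast
  ultimately have "inj_on ?l ((A \<inter> ?p) \<union> (W \<inter> ?p))"
    using dis unfolding inj_on_Un e[symmetric] by blast
  moreover have "A \<union> W \<subseteq> points Z" using s t unfolding sect_def by blast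
  ultimately show "sect Z t (A \<union> W)" using ti(2) e unfolding sect_def u by (simp add: image_Un)
  show "W \<inter> A \<inter> places Z = {}" using dis e by blast
qed

text \<open>A composable pair of horizontal sets \<open>U\<close>, \<open>V\<close> is determined by
  the intersection, and the intersections are exactly the horizontal sets of the glued strands. So
  the product is a full diagram as soon as one pair of terms composes.\<close>

lemma diagram_product:
  assumes E: "E \<in> diagrams Z" "\<not> has_crossing E" and L: "L \<in> diagrams Z" "\<not> has_crossing L"
    and tgt_src: "tgt Z E = src Z L"
  shows "\<not> (\<exists>\<kappa> \<in> terms E. \<exists>\<kappa>' \<in> terms L. Range \<kappa> = Domain \<kappa>') \<Longrightarrow> E \<odot> L = 0"
    "\<exists>\<kappa> \<in> terms E. \<exists>\<kappa>' \<in> terms L. Range \<kappa> = Domain \<kappa>' \<Longrightarrow>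
      E \<odot> L \<in> diagrams Z \<and> \<not> has_crossing (E \<odot> L) \<and>
      hdata_of Z (E \<odot> L) = (\<lambda>e. hgrading E e + hgrading L e, src Z E, tgt Z L)"
proof -
  have c0: "crossings \<kappa> = {}" if "\<kappa> \<in> terms E \<union> terms L" for \<kappa>
    using that E(2) L(2) unfolding has_crossing_def by blast
  have comp: "crossings (\<kappa> O \<kappa>') = {}" if "\<kappa> \<in> terms E" "\<kappa>' \<in> terms L" for \<kappa> \<kappa>'
    using crossings_relcomp[OF term_of_diagram(4)[OF E(1) that(1)]] c0 that by blast
  have mult: "sd_mult \<kappa> \<kappa>' = (if Range \<kappa> = Domain \<kappa>' then sd_of (\<kappa> O \<kappa>') else 0)"
    if "\<kappa> \<in> terms E" "\<kappa>' \<in> terms L" for \<kappa> \<kappa>'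
    using comp[OF that] c0 that by (simp add: sd_mult_def inv_count_def)
  show "E \<odot> L = 0" if "\<not> (\<exists>\<kappa> \<in> terms E. \<exists>\<kappa>' \<in> terms L. Range \<kappa> = Domain \<kappa>')"
    unfolding alg_mult_def using mult that by (intro sum.neutral ballI) auto
  assume "\<exists>\<kappa> \<in> terms E. \<exists>\<kappa>' \<in> terms L. Range \<kappa> = Domain \<kappa>'"
  then obtain \<kappa>0 \<kappa>0' where k0: "\<kappa>0 \<in> terms E" "\<kappa>0' \<in> terms L" "Range \<kappa>0 = Domain \<kappa>0'" by blast
  obtain s t \<mu> where \<mu>: "moving_sd Z \<mu>" "hset Z s t \<mu> \<noteq> {}" "E = diag Z s t \<mu>"
    using E(1)[unfolded diagrams_iff] by (elim exE conjE)
  obtain t1 t' \<nu> where \<nu>: "moving_sd Z \<nu>" "hset Z t1 t' \<nu> \<noteq> {}" "L = diag Z t1 t' \<nu>"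
    using L(1)[unfolded diagrams_iff] by (elim exE conjE)
  have nz: "diag Z s t \<mu> \<noteq> 0" "diag Z t1 t' \<nu> \<noteq> 0" using diag_eq_0 \<mu> \<nu> by auto
  note dE = data_of_diag[OF \<mu>(1) nz(1), folded \<mu>(3)] and dL = data_of_diag[OF \<nu>(1) nz(2), folded \<nu>(3)]
  have t1: "t1 = t" using tgt_src dE dL by simp
  let ?S = "Domain \<mu>" and ?T = "Range \<mu>" and ?S' = "Domain \<nu>" and ?T' = "Range \<nu>"
  let ?H = "hset Z s t \<mu>" and ?H' = "hset Z t t' \<nu>"
  let ?f = "\<lambda>U. \<mu> \<union> Id_on U" and ?f' = "\<lambda>V. \<nu> \<union> Id_on V"
  have tE: "terms E = ?f ` ?H" and tL: "terms L = ?f' ` ?H'" unfolding \<mu>(3) \<nu>(3) t1 using terms_diag \<mu>(1) \<nu>(1) by auto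
  have iE: "inj_on ?f ?H" and iL: "inj_on ?f' ?H'"
    by (rule inj_on_subset[OF inj_on_add_Id], auto simp: hset_def)+
  have RD: "Range (?f U) = ?T \<union> U" "Domain (?f' V) = ?S' \<union> V" for U V by (simp_all add: Range_Un_eq Domain_Un_eq Range_Id_on)
  define M where "M = {(U, V). U \<in> ?H \<and> V \<in> ?H' \<and> ?T \<union> U = ?S' \<union> V}"
  have HU: "U \<subseteq> points Z" "U \<inter> ?S = {}" "U \<inter> ?T = {}" "sect Z s (?S \<union> U)" "sect Z t (?T \<union> U)" if "U \<in> ?H" for U
    using that by (auto simp: hset_def)
  have HV: "V \<subseteq> points Z" "V \<inter> ?S' = {}" "V \<inter> ?T' = {}" "sect Z t (?S' \<union> V)" "sect Z t' (?T' \<union> V)" if "V \<in> ?H'" for V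
    using that by (auto simp: hset_def)
  have ME: "\<kappa> \<in> terms E \<and> \<kappa>' \<in> terms L \<and> \<kappa> O \<kappa>' = glue \<mu> \<nu> \<union> Id_on (U \<inter> V)"
    if "(U, V) \<in> M" "\<kappa> = ?f U" "\<kappa>' = ?f' V" for U V \<kappa> \<kappa>'
  proof -
    have UV: "U \<in> ?H" "V \<in> ?H'" "?T \<union> U = ?S' \<union> V" using that(1) by (auto simp: M_def)
    then show ?thesis unfolding that(2,3) tE tL using glue_Id_on[OF HU(3)[OF UV(1)] HV(2)[OF UV(2)] UV(3)] by blast
  qed
  obtain U0 V0 where 0: "(U0, V0) \<in> M" "\<kappa>0 = ?f U0" "\<kappa>0' = ?f' V0"
  proof -
    obtain U0 where U: "U0 \<in> ?H" "\<kappa>0 = ?f U0" using k0(1) tE by blast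
    obtain V0 where V: "V0 \<in> ?H'" "\<kappa>0' = ?f' V0" using k0(2) tL by blast
    have "?T \<union> U0 = ?S' \<union> V0" using k0(3) unfolding U V RD .
    then show ?thesis using that[of U0 V0] U V by (simp add: M_def)
  qed
  have UV0: "U0 \<in> ?H" "V0 \<in> ?H'" "?T \<union> U0 = ?S' \<union> V0" using 0(1) by (auto simp: M_def)
  have sdE: "strand_diagram Z \<kappa>0" and sdL: "strand_diagram Z \<kappa>0'"
    using term_of_diagram(4) E(1) L(1) k0 by blast+
  let ?\<rho> = "glue \<mu> \<nu>"
  have comp0: "\<kappa>0 O \<kappa>0' = ?\<rho> \<union> Id_on (U0 \<inter> V0)" using ME 0 by blast
  have \<rho>: "moving_sd Z ?\<rho>"
  proof -
    have sub: "?\<rho> \<subseteq> \<kappa>0 O \<kappa>0'" using comp0 by blast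
    note i1 = strand_diagram_inj[OF sdE] and i2 = strand_diagram_inj[OF sdL]
    have "y = y'" if *: "(x, y) \<in> ?\<rho>" "(x, y') \<in> ?\<rho>" for x y y'
    proof -
      obtain z where z: "(x, z) \<in> \<kappa>0" "(z, y) \<in> \<kappa>0'" using * sub by blast
      obtain z' where z': "(x, z') \<in> \<kappa>0" "(z', y') \<in> \<kappa>0'" using * sub by blast
      have "z = z'" using i1(1)[OF z(1) z'(1)] .
      then show ?thesis using i2(1)[OF z(2)] z'(2) by simp
    qed
    moreover have "x = x'" if *: "(x, y) \<in> ?\<rho>" "(x', y) \<in> ?\<rho>" for x x' y
    proof -
      obtain z where z: "(x, z) \<in> \<kappa>0" "(z, y) \<in> \<kappa>0'" using * sub by blast
      obtain z' where z': "(x', z') \<in> \<kappa>0" "(z', y) \<in> \<kappa>0'" using * sub by blast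
      have "z = z'" using i2(2)[OF z(2) z'(2)] .
      then show ?thesis using i1(2)[OF z(1)] z'(1) by simp
    qed
    ultimately have inj: "inj_on fst ?\<rho>" "inj_on snd ?\<rho>" unfolding inj_on_def by (metis prod.collapse)+
    have m: "x \<in> points Z \<and> y \<in> points Z \<and> pt_le x y \<and> x \<noteq> y" if "(x, y) \<in> \<mu> \<or> (x, y) \<in> \<nu>" for x y
      using that \<mu>(1) \<nu>(1) unfolding moving_sd_def strand_diagram_def by auto
    have "x \<in> points Z \<and> y \<in> points Z \<and> pt_le x y \<and> x \<noteq> y" if xy: "(x, y) \<in> ?\<rho>" for x y
    proof (cases "(x, y) \<in> \<mu> O \<nu>")
      case True
      then obtain z where z: "(x, z) \<in> \<mu>" "(z, y) \<in> \<nu>" by blast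
      have a: "x \<in> points Z" "pt_le x z" "x \<noteq> z" "y \<in> points Z" "pt_le z y" "z \<noteq> y" using m[of x z] m[of z y] z by auto
      then have "pt_le x y \<and> x \<noteq> y" by (cases x; cases y; cases z) (auto simp: pt_le_def)
      then show ?thesis using a by blast
    next
      case False
      then have "(x, y) \<in> \<mu> \<or> (x, y) \<in> \<nu>" using xy unfolding glue_def by blast
      then show ?thesis by (rule m)
    qed
    then show ?thesis using inj unfolding moving_sd_def strand_diagram_def by auto
  qed
  have W: "Domain ?\<rho> \<union> (U \<inter> V) = ?S \<union> U \<and> Range ?\<rho> \<union> (U \<inter> V) = ?T' \<union> V \<and>
      U = (U \<inter> V) \<union> (?S' - ?T) \<and> V = (U \<inter> V) \<union> (?T - ?S') \<and> ?T \<union> U = (?T \<union> ?S') \<union> (U \<inter> V)" if "(U, V) \<in> M" for U V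
  proof -
    have UV: "U \<in> ?H" "V \<in> ?H'" "?T \<union> U = ?S' \<union> V" using that by (auto simp: M_def)
    have eU: "U = (U \<inter> V) \<union> (?S' - ?T)" and eV: "V = (U \<inter> V) \<union> (?T - ?S')"
      using UV(3) HU(3)[OF UV(1)] HV(2)[OF UV(2)] by blast+
    have "Domain ?\<rho> \<union> (U \<inter> V) = ?S \<union> U" unfolding Domain_glue using eU by blast
    moreover have "Range ?\<rho> \<union> (U \<inter> V) = ?T' \<union> V" unfolding Range_glue using eV by blast
    moreover have "?T \<union> U = (?T \<union> ?S') \<union> (U \<inter> V)" using eU by blast
    ultimately show ?thesis using eU eV by blast
  qed
  let ?HL = "hset Z s t' ?\<rho>"
  have toH: "U \<inter> V \<in> ?HL" if "(U, V) \<in> M" for U V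
  proof -
    have UV: "U \<in> ?H" "V \<in> ?H'" using that by (auto simp: M_def)
    have "sect Z s (Domain ?\<rho> \<union> (U \<inter> V))" "sect Z t' (Range ?\<rho> \<union> (U \<inter> V))"
      using W[OF that] HU(4)[OF UV(1)] HV(5)[OF UV(2)] by simp_all
    moreover have "U \<inter> V \<subseteq> points Z - (Domain ?\<rho> \<union> Range ?\<rho>)"
      unfolding Domain_glue Range_glue using HU(1-3)[OF UV(1)] HV(2,3)[OF UV(2)] by blast
    ultimately show ?thesis unfolding hset_def by blast
  qed
  \<comment> \<open>The completed sets start or end correctly at \<open>s\<close> and
    \<open>t'\<close> by assumption; that the middle set is a section of \<open>t\<close> is
    transferred from the given composable pair \<open>U0\<close>, \<open>V0\<close> by
    \<open>sect_replace\<close>.\<close>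
  have fromH: "(W \<union> (?S' - ?T), W \<union> (?T - ?S')) \<in> M" if "W \<in> ?HL" for W
  proof -
    have Wd: "W \<subseteq> points Z" "W \<inter> Domain ?\<rho> = {}" "W \<inter> Range ?\<rho> = {}" "sect Z s (Domain ?\<rho> \<union> W)" "sect Z t' (Range ?\<rho> \<union> W)"
      using that by (auto simp: hset_def)
    note W0 = W[OF 0(1)] and W0H = toH[OF 0(1)]
    have d0: "U0 \<inter> V0 \<inter> Domain ?\<rho> = {}" "U0 \<inter> V0 \<inter> Range ?\<rho> = {}" "sect Z s (Domain ?\<rho> \<union> (U0 \<inter> V0))"
      using W0H by (auto simp: hset_def)
    have st: "sect Z t ((?T \<union> ?S') \<union> (U0 \<inter> V0))" using HU(5)[OF UV0(1)] W0 by simp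
    have d1: "U0 \<inter> V0 \<inter> (?T \<union> ?S') = {}" using HU(3)[OF UV0(1)] HV(2)[OF UV0(2)] by blast
    have t: "sect Z t ((?T \<union> ?S') \<union> W)" and dis: "W \<inter> (?T \<union> ?S') \<inter> places Z = {}"
      by (rule sect_replace[OF st d0(3) Wd(4) d1 d0(1) Wd(2)])+
    have "W \<inter> (?T \<inter> ?S') = {}" using dis moving_not_endpoint[OF \<mu>(1) \<nu>(1)] by blast
    then have WT: "W \<inter> ?T = {}" "W \<inter> ?S' = {}" "W \<inter> ?S = {}" "W \<inter> ?T' = {}"
      using Wd(2,3) unfolding Domain_glue Range_glue by blast+
    have sU: "?S' - ?T \<subseteq> U0" "?T - ?S' \<subseteq> V0" using UV0(3) by blast+
    have S'T: "(?S' - ?T) \<inter> ?S = {}" "?S' - ?T \<subseteq> points Z" "(?T - ?S') \<inter> ?T' = {}" "?T - ?S' \<subseteq> points Z"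
      using sU HU(1,2)[OF UV0(1)] HV(1,3)[OF UV0(2)] by blast+
    have e: "?S \<union> (W \<union> (?S' - ?T)) = Domain ?\<rho> \<union> W" "?T \<union> (W \<union> (?S' - ?T)) = (?T \<union> ?S') \<union> W"
      "?S' \<union> (W \<union> (?T - ?S')) = (?T \<union> ?S') \<union> W" "?T' \<union> (W \<union> (?T - ?S')) = Range ?\<rho> \<union> W"
      unfolding Domain_glue Range_glue by blast+
    have "W \<union> (?S' - ?T) \<subseteq> points Z - (?S \<union> ?T)" using Wd(1) WT(1,3) S'T(1,2) by blast
    then have "W \<union> (?S' - ?T) \<in> ?H" unfolding hset_def mem_Collect_eq e using Wd(4) t by (intro conjI)
    moreover have "W \<union> (?T - ?S') \<subseteq> points Z - (?S' \<union> ?T')" using Wd(1) WT(2,4) S'T(3,4) by blast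
    then have "W \<union> (?T - ?S') \<in> ?H'" unfolding hset_def mem_Collect_eq e using Wd(5) t by (intro conjI)
    ultimately show ?thesis unfolding M_def using e(2,3) by simp
  qed
  have fin: "finite ?H" "finite ?H'" by simp_all
  have "E \<odot> L = (\<Sum>\<kappa>\<in>?f ` ?H. \<Sum>\<kappa>'\<in>?f' ` ?H'. if Range \<kappa> = Domain \<kappa>' then sd_of (\<kappa> O \<kappa>') else 0)"
    unfolding alg_mult_def using mult unfolding tE tL by (intro sum.cong) auto
  also have "\<dots> = (\<Sum>U\<in>?H. \<Sum>V\<in>?H'. if ?T \<union> U = ?S' \<union> V then sd_of (?f U O ?f' V) else 0)"
    unfolding sum.reindex[OF iE] sum.reindex[OF iL] by (simp only: o_def RD)
  also have "\<dots> = (\<Sum>(U, V)\<in>?H \<times> ?H'. if ?T \<union> U = ?S' \<union> V then sd_of (?f U O ?f' V) else 0)"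
    by (rule sum.cartesian_product)
  also have "\<dots> = (\<Sum>(U, V)\<in>M. sd_of (?f U O ?f' V))"
  proof (rule sum.mono_neutral_cong_right)
    show "finite (?H \<times> ?H')" using fin by blast
    show "M \<subseteq> ?H \<times> ?H'" unfolding M_def by blast
    fix p assume "p \<in> M"
    then show "(case p of (U, V) \<Rightarrow> if ?T \<union> U = ?S' \<union> V then sd_of (?f U O ?f' V) else 0) = (case p of (U, V) \<Rightarrow> sd_of (?f U O ?f' V))"
      unfolding M_def by (cases p) simp
  next
    show "\<forall>p \<in> ?H \<times> ?H' - M. (case p of (U, V) \<Rightarrow> if ?T \<union> U = ?S' \<union> V then sd_of (?f U O ?f' V) else 0) = 0"
    proof
      fix p assume p: "p \<in> ?H \<times> ?H' - M"
      obtain U V where e: "p = (U, V)" by (cases p)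
      then have "?T \<union> U \<noteq> ?S' \<union> V" using p unfolding M_def by blast
      then show "(case p of (U, V) \<Rightarrow> if ?T \<union> U = ?S' \<union> V then sd_of (?f U O ?f' V) else 0) = 0"
        unfolding e prod.case by (rule if_not_P)
    qed
  qed
  also have "\<dots> = (\<Sum>W\<in>?HL. sd_of (?\<rho> \<union> Id_on W))"
  proof (rule sum.reindex_bij_witness[of _ "\<lambda>W. (W \<union> (?S' - ?T), W \<union> (?T - ?S'))" "\<lambda>(U, V). U \<inter> V"])
    fix p assume "p \<in> M"
    moreover obtain U V where p: "p = (U, V)" by (cases p)
    ultimately have m: "(U, V) \<in> M" by simp
    show "(\<lambda>W. (W \<union> (?S' - ?T), W \<union> (?T - ?S'))) (case p of (U, V) \<Rightarrow> U \<inter> V) = p" using W[OF m] p by simp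
    show "(case p of (U, V) \<Rightarrow> U \<inter> V) \<in> ?HL" using toH[OF m] p by simp
    show "sd_of (?\<rho> \<union> Id_on (case p of (U, V) \<Rightarrow> U \<inter> V)) = (case p of (U, V) \<Rightarrow> sd_of (?f U O ?f' V))"
      using ME[OF m refl refl] p by simp
  next
    fix V assume V: "V \<in> ?HL"
    show "(V \<union> (?S' - ?T), V \<union> (?T - ?S')) \<in> M" using fromH[OF V] .
    show "(case (V \<union> (?S' - ?T), V \<union> (?T - ?S')) of (U, V) \<Rightarrow> U \<inter> V) = V"  by auto
  qed
  also have "\<dots> = diag Z s t' ?\<rho>" using diag_sum[OF \<rho>] by simp
  finally have prod: "E \<odot> L = diag Z s t' ?\<rho>" .
  have ne: "?HL \<noteq> {}" using toH[OF 0(1)] by blast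
  then have nz': "diag Z s t' ?\<rho> \<noteq> 0" using diag_eq_0[OF \<rho>] by blast
  have "\<not> has_crossing (diag Z s t' ?\<rho>)"
  proof -
    have "crossings \<kappa> = {}" if \<kappa>: "\<kappa> \<in> terms (diag Z s t' ?\<rho>)" for \<kappa>
    proof -
      obtain W where Wm: "W \<in> ?HL" "\<kappa> = ?\<rho> \<union> Id_on W" using \<kappa> unfolding terms_diag[OF \<rho>] by blast
      have "(W \<union> (?S' - ?T)) \<inter> (W \<union> (?T - ?S')) = W" by blast
      moreover note m = ME[OF fromH[OF Wm(1)] refl refl]
      ultimately have e: "\<kappa> = ?f (W \<union> (?S' - ?T)) O ?f' (W \<union> (?T - ?S'))" using Wm(2) by simp
      show ?thesis unfolding e by (rule comp[OF conjunct1[OF m] conjunct1[OF conjunct2[OF m]]])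
    qed
    then show ?thesis unfolding has_crossing_def by blast
  qed
  moreover have "sd_hgr ?\<rho> e = sd_hgr \<mu> e + sd_hgr \<nu> e" for e
  proof -
    have "strand_diagram Z (?\<rho> \<union> Id_on (U0 \<inter> V0))"
      by (rule term_of_diag(5)[OF \<rho>, of _ s t']) (use toH[OF 0(1)] in \<open>simp add: terms_diag[OF \<rho>]\<close>)
    moreover have "Domain (\<kappa>0 O \<kappa>0') = Domain \<kappa>0" "Range (\<kappa>0 O \<kappa>0') = Range \<kappa>0'" using k0(3) by blast+
    ultimately have "sd_hgr (\<kappa>0 O \<kappa>0') e = sd_hgr \<kappa>0 e + sd_hgr \<kappa>0' e"
      using sd_hgr_Domain_Range[OF sdE] sd_hgr_Domain_Range[OF sdL] sd_hgr_Domain_Range[of "\<kappa>0 O \<kappa>0'" e] k0(3)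
      by (simp add: comp0)
    then show ?thesis unfolding comp0 unfolding 0(2,3) by (simp only: sd_hgr_add_Id)
  qed
  moreover have "E \<odot> L \<in> diagrams Z" unfolding prod diagrams_iff using \<rho> ne by blast
  ultimately show "E \<odot> L \<in> diagrams Z \<and> \<not> has_crossing (E \<odot> L) \<and>
      hdata_of Z (E \<odot> L) = (\<lambda>e. hgrading E e + hgrading L e, src Z E, tgt Z L)"
    unfolding prod data_of_diag(5)[OF \<rho> nz'] dE dL by auto
qed

text \<open>The common middle set must contain the final places on the left and the initial places
  on the right, and at most one place of each pair. A clash with a twin is the only obstruction;
  otherwise the set is completed by arbitrary places.\<close>

lemma composable_iff:
  assumes h: "viable01 Z h" "viable01 Z h'" and sum: "\<And>e. h e = 1 \<Longrightarrow> h' e \<noteq> 1"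
    and B: "B \<subseteq> full Z h" "config_ok h s t B" and B': "B' \<subseteq> full Z h'" "config_ok h' t t' B'"
  shows "(\<exists>\<kappa> \<in> terms (Dg h s t B). \<exists>\<kappa>' \<in> terms (Dg h' t t' B'). Range \<kappa> = Domain \<kappa>') \<longleftrightarrow>
    \<not> (\<exists>a \<in> places Z. a \<in> Range (strands h B) \<and> twin Z a \<in> Domain (strands h' B'))"
proof -
  let ?\<mu> = "strands h B" and ?\<nu> = "strands h' B'"
  let ?S = "Domain ?\<mu>" and ?T = "Range ?\<mu>" and ?S' = "Domain ?\<nu>" and ?T' = "Range ?\<nu>"
  have m: "moving_sd Z ?\<mu>" "moving_sd Z ?\<nu>" using moving_strands h by auto
  have tm: "terms (Dg h s t B) = (\<lambda>U. ?\<mu> \<union> Id_on U) ` hset Z s t ?\<mu>"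
    "terms (Dg h' t t' B') = (\<lambda>V. ?\<nu> \<union> Id_on V) ` hset Z t t' ?\<nu>"
    unfolding Dg_def using terms_diag m by auto
  have RD: "Range (?\<mu> \<union> Id_on U) = ?T \<union> U" "Domain (?\<nu> \<union> Id_on V) = ?S' \<union> V" for U V
    by (simp_all add: Range_Un_eq Domain_Un_eq Range_Id_on)
  have eq: "(\<exists>\<kappa> \<in> terms (Dg h s t B). \<exists>\<kappa>' \<in> terms (Dg h' t t' B'). Range \<kappa> = Domain \<kappa>') \<longleftrightarrow>
    (\<exists>U \<in> hset Z s t ?\<mu>. \<exists>V \<in> hset Z t t' ?\<nu>. ?T \<union> U = ?S' \<union> V)"
    unfolding tm by (simp only: bex_simps RD)
  show ?thesis
    unfolding eq
  proof
    assume "\<exists>U \<in> hset Z s t ?\<mu>. \<exists>V \<in> hset Z t t' ?\<nu>. ?T \<union> U = ?S' \<union> V"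
    then obtain U V where UV: "U \<in> hset Z s t ?\<mu>" "?T \<union> U = ?S' \<union> V" by blast
    have "inj_on (lab Z) ((?T \<union> U) \<inter> places Z)" using UV(1) unfolding hset_def sect_def by blast
    moreover have "?S' \<subseteq> ?T \<union> U" using UV(2) by blast
    ultimately have "twin Z a = a" if "a \<in> places Z" "a \<in> ?T" "twin Z a \<in> ?S'" for a
      using that twin_place[OF that(1)] by (intro inj_onD[of "lab Z" "(?T \<union> U) \<inter> places Z"]) auto
    then show "\<not> (\<exists>a \<in> places Z. a \<in> ?T \<and> twin Z a \<in> ?S')" using fibre_twin(2) by blast
  next
    assume no: "\<not> (\<exists>a \<in> places Z. a \<in> ?T \<and> twin Z a \<in> ?S')"
    obtain U0 where U0: "U0 \<subseteq> points Z - (?S \<union> ?T)" "sect Z s (?S \<union> U0)" "sect Z t (?T \<union> U0)"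
      using hset_nonempty_iff[OF h(1) B(1), of s t] B(2) unfolding hset_def by blast
    obtain V0 where V0: "V0 \<subseteq> points Z - (?S' \<union> ?T')" "sect Z t (?S' \<union> V0)" "sect Z t' (?T' \<union> V0)"
      using hset_nonempty_iff[OF h(2) B'(1), of t t'] B'(2) unfolding hset_def by blast
    define ch where "ch P = (SOME a. a \<in> fibre Z P)" for P
    have tP: "t \<subseteq> pairs Z" using B(2) unfolding config_ok_def by blast
    have ch: "ch P \<in> places Z" "lab Z (ch P) = P" if "P \<in> t" for P
    proof -
      have "P \<in> pairs Z" using that tP by blast
      then have "\<exists>a. a \<in> fibre Z P" by (auto simp: pairs_def fibre_def)
      from someI_ex[OF this] show "ch P \<in> places Z" "lab Z (ch P) = P" unfolding ch_def fibre_def by auto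
    qed
    \<comment> \<open>One place of each remaining pair of \<open>t\<close>; both factors are
      horizontal at these pairs.\<close>
    define C where "C = ch ` {P \<in> t. P \<notin> lab Z ` ((?T \<union> ?S') \<inter> places Z)}"
    have C: "a \<in> places Z" "lab Z a \<in> t" "lab Z a \<notin> lab Z ` ((?T \<union> ?S') \<inter> places Z)" "a = ch (lab Z a)" if "a \<in> C" for a
      using that ch unfolding C_def by auto
    define X where "X = ?T \<union> ?S' \<union> C"
    have Ti: "inj_on (lab Z) (?T \<inter> places Z)" "lab Z ` (?T \<inter> places Z) \<subseteq> t"
    proof -
      have "?T \<inter> places Z \<subseteq> (?T \<union> U0) \<inter> places Z" by blast
      then show "inj_on (lab Z) (?T \<inter> places Z)" "lab Z ` (?T \<inter> places Z) \<subseteq> t"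
        using U0(3) inj_on_subset unfolding sect_def by blast+
    qed
    have Si: "inj_on (lab Z) (?S' \<inter> places Z)" "lab Z ` (?S' \<inter> places Z) \<subseteq> t"
    proof -
      have "?S' \<inter> places Z \<subseteq> (?S' \<union> V0) \<inter> places Z" by blast
      then show "inj_on (lab Z) (?S' \<inter> places Z)" "lab Z ` (?S' \<inter> places Z) \<subseteq> t"
        using V0(2) inj_on_subset unfolding sect_def by blast+
    qed
    have TS: "a = b" if "a \<in> ?T" "b \<in> ?S'" "a \<in> places Z" "b \<in> places Z" "lab Z a = lab Z b" for a b
    proof -
      have "b = a \<or> b = twin Z a" using same_lab[OF that(3,4)] that(5) by simp
      then show ?thesis using that(1-3) no by blast
    qed
    have sX: "sect Z t X"
      unfolding sect_def
    proof (intro conjI)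
      have "?T \<subseteq> points Z" "?S' \<subseteq> points Z" using moving_sdD(2)[OF m(1)] moving_sdD(2)[OF m(2)] by blast+
      then show "X \<subseteq> points Z" unfolding X_def using C(1) places_subset by blast
      show "inj_on (lab Z) (X \<inter> places Z)"
      proof (rule inj_onI)
        fix a b assume ab: "a \<in> X \<inter> places Z" "b \<in> X \<inter> places Z" "lab Z a = lab Z b"
        have 1: "a = b" if *: "a \<in> ?T \<union> ?S'" "b \<in> ?T \<union> ?S'"
        proof -
          have p: "a \<in> places Z" "b \<in> places Z" using ab by auto
          consider "a \<in> ?T" "b \<in> ?T" | "a \<in> ?S'" "b \<in> ?S'" | "a \<in> ?T" "b \<in> ?S'" | "a \<in> ?S'" "b \<in> ?T" using * by blast
          then show ?thesis
          proof cases
            case 1 then show ?thesis using inj_onD[OF Ti(1) ab(3)] p by blast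
          next
            case 2 then show ?thesis using inj_onD[OF Si(1) ab(3)] p by blast
          next
            case 3 then show ?thesis using TS[OF _ _ p] ab(3) by blast
          next
            case 4 then show ?thesis using TS[OF _ _ p(2,1)] ab(3) by metis
          qed
        qed
        have 2: "a = b" if "a \<in> C" "b \<in> C" using C(4)[OF that(1)] C(4)[OF that(2)] ab(3) by simp
        have 3: False if "x \<in> C" "y \<in> (?T \<union> ?S') \<inter> places Z" "lab Z x = lab Z y" for x y
          using C(3)[OF that(1)] that(2,3) by blast
        show "a = b"
        proof (cases "a \<in> C")
          case True
          then show ?thesis using 2 3[OF True, of b] ab unfolding X_def by blast
        next
          case False
          then have "a \<in> ?T \<union> ?S'" using ab(1) unfolding X_def by blast
          moreover have "b \<notin> C" using 3[of b a] ab calculation by (metis IntD2 IntI)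
          then have "b \<in> ?T \<union> ?S'" using ab(2) unfolding X_def by blast
          ultimately show ?thesis by (rule 1)
        qed
      qed
      show "lab Z ` (X \<inter> places Z) = t"
      proof (intro equalityI subsetI)
        fix P assume "P \<in> lab Z ` (X \<inter> places Z)"
        then show "P \<in> t" using Ti(2) Si(2) C(2) unfolding X_def by blast
      next
        fix P assume P: "P \<in> t"
        show "P \<in> lab Z ` (X \<inter> places Z)"
        proof (cases "P \<in> lab Z ` ((?T \<union> ?S') \<inter> places Z)")
          case True
          then show ?thesis unfolding X_def by blast
        next
          case False
          then have "ch P \<in> X \<inter> places Z" using P ch unfolding X_def C_def by blast
          then show ?thesis using ch(2)[OF P] by (metis imageI)
        qed
      qed
    qed
    have SS: "?S \<inter> ?S' = {}"
    proof -
      have "h a = 1" if "a \<in> ?S" for a using that strandsD(1) by blast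
      moreover have "h' a = 1" if "a \<in> ?S'" for a using that strandsD(1) by blast
      ultimately show ?thesis using sum by blast
    qed
    have TT: "?T \<inter> ?T' = {}"
    proof -
      have "h (step_to a) = 1" if a: "a \<in> ?T" for a
      proof -
        obtain i m where e: "a = (i, m)" by (cases a)
        show ?thesis using a unfolding e Range_strands[OF h(1)] by simp
      qed
      moreover have "h' (step_to a) = 1" if a: "a \<in> ?T'" for a
      proof -
        obtain i m where e: "a = (i, m)" by (cases a)
        show ?thesis using a unfolding e Range_strands[OF h(2)] by simp
      qed
      ultimately show ?thesis using sum by blast
    qed
    \<comment> \<open>The left factor has a horizontal strand at every pair represented in
      \<open>C\<close>, so no strand of it can start there.\<close>
    have CS: "C \<inter> ?S = {}"
    proof (rule ccontr)
      assume "C \<inter> ?S \<noteq> {}"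
      then obtain x where x: "x \<in> C" "x \<in> ?S" by blast
      have "lab Z x \<in> lab Z ` ((?T \<union> U0) \<inter> places Z)" using C(2)[OF x(1)] U0(3) unfolding sect_def by blast
      then obtain u where u: "u \<in> ?T \<union> U0" "u \<in> places Z" "lab Z x = lab Z u" by blast
      then have "u \<in> U0" using C(3)[OF x(1)] by blast
      moreover have "inj_on (lab Z) ((?S \<union> U0) \<inter> places Z)" using U0(2) unfolding sect_def by blast
      ultimately have "x = u" using inj_onD[where f = "lab Z" and x = x and y = u] u(3) x(2) C(1)[OF x(1)] u(2) by blast
      then show False using x(2) \<open>u \<in> U0\<close> U0(1) by blast
    qed
    have CT: "C \<inter> ?T' = {}"
    proof (rule ccontr)
      assume "C \<inter> ?T' \<noteq> {}"
      then obtain x where x: "x \<in> C" "x \<in> ?T'" by blast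
      have "lab Z x \<in> lab Z ` ((?S' \<union> V0) \<inter> places Z)" using C(2)[OF x(1)] V0(2) unfolding sect_def by blast
      then obtain u where u: "u \<in> ?S' \<union> V0" "u \<in> places Z" "lab Z x = lab Z u" by blast
      then have "u \<in> V0" using C(3)[OF x(1)] by blast
      moreover have "inj_on (lab Z) ((?T' \<union> V0) \<inter> places Z)" using V0(3) unfolding sect_def by blast
      ultimately have "x = u" using inj_onD[where f = "lab Z" and x = x and y = u] u(3) x(2) C(1)[OF x(1)] u(2) by blast
      then show False using x(2) \<open>u \<in> V0\<close> V0(1) by blast
    qed
    have XP: "X \<subseteq> points Z" using sX unfolding sect_def by blast
    have eU: "?T \<union> (X - ?T) = X" "?S' \<union> (X - ?S') = X" unfolding X_def by blast+
    have "sect Z s (?S \<union> (X - ?T))"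
      by (rule sect_replace(1)[OF U0(2,3)]) (use sX eU U0(1) in auto)
    moreover have "X - ?T \<subseteq> points Z - (?S \<union> ?T)" using XP SS CS unfolding X_def by blast
    ultimately have U: "X - ?T \<in> hset Z s t ?\<mu>" using sX unfolding hset_def mem_Collect_eq eU by (intro conjI)
    have "sect Z t' (?T' \<union> (X - ?S'))"
      by (rule sect_replace(1)[OF V0(3,2)]) (use sX eU V0(1) in auto)
    moreover have "X - ?S' \<subseteq> points Z - (?S' \<union> ?T')" using XP TT CT unfolding X_def by blast
    ultimately have V: "X - ?S' \<in> hset Z t t' ?\<nu>" using sX unfolding hset_def mem_Collect_eq eU by (intro conjI)
    have "?T \<union> (X - ?T) = ?S' \<union> (X - ?S')" unfolding eU ..
    with U V show "\<exists>U \<in> hset Z s t ?\<mu>. \<exists>V \<in> hset Z t t' ?\<nu>. ?T \<union> U = ?S' \<union> V" by blast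
  qed
qed

end

section \<open>Products at a single matched pair\<close>

definition local_core :: "bool \<Rightarrow> bool \<Rightarrow> bool \<Rightarrow> bool \<Rightarrow> bool \<Rightarrow> bool \<Rightarrow> bool" where
  "local_core u v u' v' s t \<longleftrightarrow> s \<and> t \<and> u = v \<and> u' = v' \<and> (u \<or> u')"

text \<open>
  The situation after the product has become zero, where \<open>c\<close> counts the broken places (including
  those at which the step after the place was used up before the step before it).
\<close>

definition zero_state :: "bool \<Rightarrow> bool \<Rightarrow> bool \<Rightarrow> bool \<Rightarrow> bool \<Rightarrow> bool \<Rightarrow> nat \<Rightarrow> bool" where
  "zero_state u v u' v' s t c \<longleftrightarrow>
     (if local_ok u v u' v' False False s t
      then c = of_bool (local_core u v u' v' s t) + 1 \<and> (u \<and> v \<and> (u' \<or> v') \<or> u' \<and> v' \<and> (u \<or> v))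
      else c = 0 \<and> \<not> s \<and> \<not> t \<and> (u \<and> \<not> v \<and> \<not> u' \<and> v' \<or> \<not> u \<and> v \<and> u' \<and> \<not> v'))"

text \<open>Of the sixteen covering patterns only two are excluded outright: two strands starting at
  the pair, and two strands ending there. In the others the idempotents are forced, unless each
  place has both steps covered or neither, where only \<open>s = t\<close> is required.\<close>

lemma local_ok_cases:
  assumes "local_ok u v u' v' False False s t"
  shows "u = False \<and> v = False \<and> u' = False \<and> v' = False \<and> s = t \<or>
    u = False \<and> v = False \<and> u' = False \<and> v' = True \<and> s = True \<and> t = False \<or>
    u = False \<and> v = False \<and> u' = True \<and> v' = False \<and> s = False \<and> t = True \<or>
    u = False \<and> v = False \<and> u' = True \<and> v' = True \<and> s = t \<or>
    u = False \<and> v = True \<and> u' = False \<and> v' = False \<and> s = True \<and> t = False \<or>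
    u = False \<and> v = True \<and> u' = True \<and> v' = False \<and> s = True \<and> t = True \<or>
    u = False \<and> v = True \<and> u' = True \<and> v' = True \<and> s = True \<and> t = False \<or>
    u = True \<and> v = False \<and> u' = False \<and> v' = False \<and> s = False \<and> t = True \<or>
    u = True \<and> v = False \<and> u' = False \<and> v' = True \<and> s = True \<and> t = True \<or>
    u = True \<and> v = False \<and> u' = True \<and> v' = True \<and> s = False \<and> t = True \<or>
    u = True \<and> v = True \<and> u' = False \<and> v' = False \<and> s = t \<or>
    u = True \<and> v = True \<and> u' = False \<and> v' = True \<and> s = True \<and> t = False \<or>
    u = True \<and> v = True \<and> u' = True \<and> v' = False \<and> s = False \<and> t = True \<or>
    u = True \<and> v = True \<and> u' = True \<and> v' = True \<and> s = t"
  using assms unfolding local_ok_def Let_def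
  by (cases u; cases v; cases u'; cases v'; simp)

type_synonym local_row = "bool \<times> bool \<times> bool \<times> bool \<times> bool \<times> bool \<times> bool \<times> bool"

text \<open>
  All diagrams without crossings at a single pair, with the final places \<open>p\<close>, \<open>p'\<close> of their strands
  in the last two columns, and all tight ones among them, with the initial places instead.
\<close>

definition left_rows :: "local_row list" where
  "left_rows =
    [(False, False, False, False, False, False, False, False),
     (False, False, False, False, True, True, False, False),
     (False, False, False, True, True, False, False, False),
     (False, False, True, False, False, True, False, True),
     (False, False, True, True, False, False, False, False),
     (False, False, True, True, True, True, False, True),
     (False, True, False, False, True, False, False, False),
     (False, True, True, False, True, True, False, True),
     (False, True, True, True, True, False, False, False),
     (True, False, False, False, False, True, True, False),
     (True, False, False, True, True, True, True, False),
     (True, False, True, True, False, True, True, False),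
     (True, True, False, False, False, False, False, False),
     (True, True, False, False, True, True, True, False),
     (True, True, False, True, True, False, False, False),
     (True, True, True, False, False, True, False, True),
     (True, True, True, True, False, False, False, False),
     (True, True, True, True, True, True, True, False),
     (True, True, True, True, True, True, False, True)]"

definition right_rows :: "local_row list" where
  "right_rows =
    [(False, False, False, False, False, False, False, False),
     (False, False, False, False, True, True, False, False),
     (False, False, False, True, True, False, False, True),
     (False, False, True, False, False, True, False, False),
     (False, False, True, True, False, False, False, False),
     (False, True, False, False, True, False, True, False),
     (False, True, True, False, True, True, True, False),
     (False, True, True, True, True, False, True, False),
     (True, False, False, False, False, True, False, False),
     (True, False, False, True, True, True, False, True),
     (True, False, True, True, False, True, False, False),
     (True, True, False, False, False, False, False, False),
     (True, True, False, True, True, False, False, True),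
     (True, True, True, False, False, True, False, False),
     (True, True, True, True, False, False, False, False),
     (True, True, True, True, True, True, True, False),
     (True, True, True, True, True, True, False, True)]"

text \<open>At a core pair a diagram without crossings is broken at exactly one place, and a strand
  ends there. At any other pair strands end exactly where the covering ends.\<close>

lemma left_rows:
  assumes "local_ok u v u' v' False False s t"
    and "if local_core u v u' v' s t then (p \<longrightarrow> u) \<and> (p' \<longrightarrow> u') \<and> p = (\<not> p') else p = (u \<and> \<not> v) \<and> p' = (u' \<and> \<not> v')"
  shows "(u, v, u', v', s, t, p, p') \<in> set left_rows"
  using local_ok_cases[OF assms(1)] assms(2)
  by (elim disjE conjE; cases s; cases p; simp add: left_rows_def local_core_def)

lemma right_rows:
  assumes "local_ok u v u' v' False False s t" "local_core u v u' v' s t \<longrightarrow> u \<and> u'"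
    and "if local_core u v u' v' s t then (p \<longrightarrow> u) \<and> (p' \<longrightarrow> u') \<and> p = (\<not> p') else p = (v \<and> \<not> u) \<and> p' = (v' \<and> \<not> u')"
  shows "(u, v, u', v', s, t, p, p') \<in> set right_rows"
  using local_ok_cases[OF assms(1)] assms(2,3)
  by (elim disjE conjE; cases s; cases p; simp add: right_rows_def local_core_def)

text \<open>An executable form of the induction step, vacuous for rows that do not match or that
  overlap. The number \<open>c\<close> adds to the breaks of the two factors the places whose later
  step is covered on the left and whose earlier step is covered on the right; the condition on
  \<open>p\<close>, \<open>q'\<close> is the clash of \<open>composable_iff\<close>.\<close>

definition step_ok :: "local_row \<Rightarrow> local_row \<Rightarrow> bool" where
  "step_ok x y = (case x of (u1, v1, u1', v1', r, s1, p, p') \<Rightarrow> case y of (u2, v2, u2', v2', s2, t, q, q') \<Rightarrow>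
     if s1 \<noteq> s2 \<or> u1 \<and> u2 \<or> v1 \<and> v2 \<or> u1' \<and> u2' \<or> v1' \<and> v2' then True
     else (let c = of_bool (local_core u1 v1 u1' v1' r s1) + (of_bool (local_core u2 v2 u2' v2' s2 t) +
             of_bool (v1 \<and> u2) + of_bool (v1' \<and> u2')) :: nat
       in if p \<and> q' \<or> p' \<and> q
         then zero_state (u1 \<or> u2) (v1 \<or> v2) (u1' \<or> u2') (v1' \<or> v2') r t c
         else c = of_bool (local_core (u1 \<or> u2) (v1 \<or> v2) (u1' \<or> u2') (v1' \<or> v2') r t)))"

lemma all_steps_ok: "list_all (\<lambda>x. list_all (step_ok x) right_rows) left_rows"
  by code_simp

text \<open>When the data still admit a diagram, at least three of the four steps are covered, so a
  further factor can cover at most the fourth. Otherwise the two covered steps have empty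
  idempotents, and the only nontrivial continuation covers the step before the place whose later
  step is used up, which adds one to the count and makes the data admissible.\<close>

lemma zero_state_step:
  assumes "\<not> (u1 \<and> u2)" "\<not> (v1 \<and> v2)" "\<not> (u1' \<and> u2')" "\<not> (v1' \<and> v2')"
    and 1: "zero_state u1 v1 u1' v1' r s c" and 2: "local_ok u2 v2 u2' v2' False False s t"
    and "local_core u2 v2 u2' v2' s t \<longrightarrow> u2 \<and> u2'"
  shows "zero_state (u1 \<or> u2) (v1 \<or> v2) (u1' \<or> u2') (v1' \<or> v2') r t
    (c + (of_bool (local_core u2 v2 u2' v2' s t) + of_bool (v1 \<and> u2) + of_bool (v1' \<and> u2')))"
proof (cases "local_ok u1 v1 u1' v1' False False r s")
  case True
  then have "c = of_bool (local_core u1 v1 u1' v1' r s) + 1" "u1 \<and> v1 \<and> (u1' \<or> v1') \<or> u1' \<and> v1' \<and> (u1 \<or> v1)"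
    using 1 by (simp_all add: zero_state_def)
  then show ?thesis
    using local_ok_cases[OF 2] assms(1-4) local_ok_cases[OF True] assms(7)
    by (elim disjE conjE) (simp_all add: local_ok_def local_core_def zero_state_def)
next
  case False
  then have "c = 0" "\<not> r" "\<not> s" "u1 \<and> \<not> v1 \<and> \<not> u1' \<and> v1' \<or> \<not> u1 \<and> v1 \<and> u1' \<and> \<not> v1'"
    using 1 by (simp_all add: zero_state_def)
  then show ?thesis
    using local_ok_cases[OF 2] assms(1-4) assms(7)
    by (elim disjE conjE) (simp_all add: local_ok_def local_core_def zero_state_def)
qed

lemma alg_prod_snoc: "xs \<noteq> [] \<Longrightarrow> alg_prod (xs @ [x]) = alg_prod xs \<odot> x"
  by (cases xs) simp_all

lemma step_combine:
  assumes "(u1, v1, u1', v1', r, s, p, p') \<in> set left_rows" "(u2, v2, u2', v2', s, t, q, q') \<in> set right_rows"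
    and "\<not> (u1 \<and> u2)" "\<not> (v1 \<and> v2)" "\<not> (u1' \<and> u2')" "\<not> (v1' \<and> v2')"
    and "c = of_bool (local_core u1 v1 u1' v1' r s) + (of_bool (local_core u2 v2 u2' v2' s t) +
             of_bool (v1 \<and> u2) + of_bool (v1' \<and> u2'))"
  shows "if p \<and> q' \<or> p' \<and> q then zero_state (u1 \<or> u2) (v1 \<or> v2) (u1' \<or> u2') (v1' \<or> v2') r t c
     else c = of_bool (local_core (u1 \<or> u2) (v1 \<or> v2) (u1' \<or> u2') (v1' \<or> v2') r t)"
proof -
  have "step_ok (u1, v1, u1', v1', r, s, p, p') (u2, v2, u2', v2', s, t, q, q')"
    using all_steps_ok assms(1,2) unfolding list_all_iff by blast
  then show ?thesis using assms(3-6) unfolding step_ok_def Let_def prod.case assms(7) by simp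
qed

lemma viable01_le:
  assumes h: "viable01 Z h" and le: "\<And>e. 0 \<le> h' e" "\<And>e. h' e \<le> h e"
  shows "viable01 Z h'"
  unfolding viable01_def
proof (intro conjI allI impI)
  fix e
  have "h e = 0 \<or> h e = 1" using h unfolding viable01_def by blast
  then show "h' e = 0 \<or> h' e = 1" using le(1)[of e] le(2)[of e] by linarith
  assume "e \<notin> steps Z"
  then have "h e = 0" using h unfolding viable01_def by blast
  then show "h' e = 0" using le(1)[of e] le(2)[of e] by linarith
qed

context pre_arc_diagram
begin

lemma viable01_eq: "viable01 Z h \<Longrightarrow> h x = h y \<longleftrightarrow> (h x = 1 \<longleftrightarrow> h y = 1)"
  using viable01D(1) by metis

lemma core_local:
  assumes "viable01 Z h" "a \<in> places Z"
  shows "lab Z a \<in> core h s t \<longleftrightarrow>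
    local_core (h (step_to a) = 1) (h a = 1) (h (step_to (twin Z a)) = 1) (h (twin Z a) = 1) (lab Z a \<in> s) (lab Z a \<in> t)"
  unfolding in_core_iff[OF assms(2)] local_core_def viable01_eq[OF assms(1), of "step_to a" a]
    viable01_eq[OF assms(1), of "step_to (twin Z a)" "twin Z a"] by blast

text \<open>Translates a diagram without crossings into the tables of a single pair. The right table
  lists tight rows only, hence the condition that a core pair be doubly occupied.\<close>

lemma crossingless_rows:
  assumes D: "D \<in> diagrams Z" "viable01 Z (hgrading D)" "\<not> has_crossing D" and a: "a \<in> places Z"
  obtains B where "B \<subseteq> full Z (hgrading D)" "config_ok (hgrading D) (src Z D) (tgt Z D) B"
    "D = Dg (hgrading D) (src Z D) (tgt Z D) B"
    "local_ok (hgrading D (step_to a) = 1) (hgrading D a = 1) (hgrading D (step_to (twin Z a)) = 1) (hgrading D (twin Z a) = 1)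
       False False (lab Z a \<in> src Z D) (lab Z a \<in> tgt Z D)"
    "(hgrading D (step_to a) = 1, hgrading D a = 1, hgrading D (step_to (twin Z a)) = 1, hgrading D (twin Z a) = 1,
      lab Z a \<in> src Z D, lab Z a \<in> tgt Z D,
      a \<in> Range (strands (hgrading D) B), twin Z a \<in> Range (strands (hgrading D) B)) \<in> set left_rows"
    "(lab Z a \<in> core (hgrading D) (src Z D) (tgt Z D) \<longrightarrow> hgrading D a = 1 \<and> hgrading D (twin Z a) = 1) \<longrightarrow>
     (hgrading D (step_to a) = 1, hgrading D a = 1, hgrading D (step_to (twin Z a)) = 1, hgrading D (twin Z a) = 1,
      lab Z a \<in> src Z D, lab Z a \<in> tgt Z D,
      a \<in> Domain (strands (hgrading D) B), twin Z a \<in> Domain (strands (hgrading D) B)) \<in> set right_rows"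
proof -
  define h s t where "h = hgrading D" "s = src Z D" "t = tgt Z D"
  note e = h_s_t_def[symmetric]
  have h: "viable01 Z h" using D(2) e by simp
  obtain B where B: "B \<subseteq> brk h s t" "inj_on (lab Z) B" "D = Dg h s t B" "config_ok h s t {}"
    using viable_diagram_Dg[OF D(1,2)] unfolding e by metis
  interpret viable_data Z h s t by unfold_locales (use h B in auto)
  have Bc: "B \<in> configs" using B unfolding configs_def by blast
  have K: "lab Z ` B = core h s t" using has_crossing_Dg[OF Bc] D(3) B(3) by simp
  note tw = twin_place[OF a] fibre_twin(2)[OF a]
  have lo: "local_ok (h (step_to a) = 1) (h a = 1) (h (step_to (twin Z a)) = 1) (h (twin Z a) = 1)
       False False (lab Z a \<in> s) (lab Z a \<in> t)"
    using B(4) a unfolding config_ok_def by simp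
  note DR = Domain_places[OF h configsD(3)[OF Bc] a] Domain_places[OF h configsD(3)[OF Bc] tw(1)]
  let ?c = "local_core (h (step_to a) = 1) (h a = 1) (h (step_to (twin Z a)) = 1) (h (twin Z a) = 1) (lab Z a \<in> s) (lab Z a \<in> t)"
  note cl = core_local[OF h a, of s t]
  have BF: "x \<in> B \<Longrightarrow> h x = 1 \<and> h (step_to x) = 1" for x
    using configsD(3)[OF Bc] full_places by blast
  have one: "(a \<in> B) = (twin Z a \<notin> B)" if ?c
  proof -
    have "lab Z a \<in> lab Z ` B" using that cl K by blast
    then obtain x where x: "x \<in> B" "lab Z x = lab Z a" by (metis imageE)
    then have "x = a \<or> x = twin Z a" using same_lab[OF a, of x] configsD(1)[OF Bc] F_places by blast
    moreover have "\<not> (a \<in> B \<and> twin Z a \<in> B)" using configsD(2)[OF Bc] tw(2,3) by (metis inj_onD)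
    ultimately show ?thesis using x(1) by blast
  qed
  have none: "a \<notin> B \<and> twin Z a \<notin> B" if "\<not> ?c"
    using that cl K tw(2) by (metis imageI)
  have uv: "(h (step_to a) = 1) = (h a = 1) \<and> (h (step_to (twin Z a)) = 1) = (h (twin Z a) = 1)" if ?c
    using that unfolding local_core_def by blast
  have T: "if ?c then (a \<in> Range (strands h B) \<longrightarrow> h (step_to a) = 1) \<and>
        (twin Z a \<in> Range (strands h B) \<longrightarrow> h (step_to (twin Z a)) = 1) \<and>
        (a \<in> Range (strands h B)) = (\<not> twin Z a \<in> Range (strands h B))
      else (a \<in> Range (strands h B)) = (h (step_to a) = 1 \<and> \<not> h a = 1) \<and>
        (twin Z a \<in> Range (strands h B)) = (h (step_to (twin Z a)) = 1 \<and> \<not> h (twin Z a) = 1)"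
  proof (cases ?c)
    case True
    show ?thesis
      unfolding if_P[OF True] DR using one[OF True] uv[OF True] BF[of a] BF[of "twin Z a"] by blast
  next
    case False
    show ?thesis
      unfolding if_not_P[OF False] DR using none[OF False] BF[of a] BF[of "twin Z a"] by blast
  qed
  have S: "if ?c then (a \<in> Domain (strands h B) \<longrightarrow> h (step_to a) = 1) \<and>
        (twin Z a \<in> Domain (strands h B) \<longrightarrow> h (step_to (twin Z a)) = 1) \<and>
        (a \<in> Domain (strands h B)) = (\<not> twin Z a \<in> Domain (strands h B))
      else (a \<in> Domain (strands h B)) = (h a = 1 \<and> \<not> h (step_to a) = 1) \<and>
        (twin Z a \<in> Domain (strands h B)) = (h (twin Z a) = 1 \<and> \<not> h (step_to (twin Z a)) = 1)"
  proof (cases ?c)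
    case True
    show ?thesis
      unfolding if_P[OF True] DR using one[OF True] uv[OF True] BF[of a] BF[of "twin Z a"] by blast
  next
    case False
    show ?thesis
      unfolding if_not_P[OF False] DR using none[OF False] BF[of a] BF[of "twin Z a"] by blast
  qed
  show ?thesis
  proof (rule that[of B])
    show "B \<subseteq> full Z (hgrading D)" using configsD(3)[OF Bc] unfolding e .
    show "config_ok (hgrading D) (src Z D) (tgt Z D) B" using configs_config_ok[OF Bc] unfolding e .
    show "D = Dg (hgrading D) (src Z D) (tgt Z D) B" using B(3) unfolding e .
    show "local_ok (hgrading D (step_to a) = 1) (hgrading D a = 1) (hgrading D (step_to (twin Z a)) = 1) (hgrading D (twin Z a) = 1)
       False False (lab Z a \<in> src Z D) (lab Z a \<in> tgt Z D)" using lo unfolding e .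
    show "(hgrading D (step_to a) = 1, hgrading D a = 1, hgrading D (step_to (twin Z a)) = 1, hgrading D (twin Z a) = 1,
      lab Z a \<in> src Z D, lab Z a \<in> tgt Z D,
      a \<in> Range (strands (hgrading D) B), twin Z a \<in> Range (strands (hgrading D) B)) \<in> set left_rows"
      unfolding e by (rule left_rows[OF lo T])
    show "(lab Z a \<in> core (hgrading D) (src Z D) (tgt Z D) \<longrightarrow> hgrading D a = 1 \<and> hgrading D (twin Z a) = 1) \<longrightarrow>
     (hgrading D (step_to a) = 1, hgrading D a = 1, hgrading D (step_to (twin Z a)) = 1, hgrading D (twin Z a) = 1,
      lab Z a \<in> src Z D, lab Z a \<in> tgt Z D,
      a \<in> Domain (strands (hgrading D) B), twin Z a \<in> Domain (strands (hgrading D) B)) \<in> set right_rows"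
      unfolding e
    proof
      assume "lab Z a \<in> core h s t \<longrightarrow> h a = 1 \<and> h (twin Z a) = 1"
      then have "?c \<longrightarrow> h (step_to a) = 1 \<and> h (step_to (twin Z a)) = 1" using cl uv by blast
      then show "(h (step_to a) = 1, h a = 1, h (step_to (twin Z a)) = 1, h (twin Z a) = 1, lab Z a \<in> s, lab Z a \<in> t,
          a \<in> Domain (strands h B), twin Z a \<in> Domain (strands h B)) \<in> set right_rows"
        by (rule right_rows[OF lo _ S])
    qed
  qed
qed

text \<open>Induction on the prefix. As long as the product is nonzero it has no crossings and
  \<open>c\<close> is 1 or 0 according to whether the pair is in the core; a vanishing product hands
  over to \<open>zero_state\<close>. The prefix may become twisted, whereas each new factor is
  tight.\<close>

lemma prefix_products:
  fixes L :: "nat \<Rightarrow> 'i elt"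
  assumes P: "pairs Z = {P}" and a: "a \<in> places Z"
    and L: "\<And>i. i < n \<Longrightarrow> L i \<in> diagrams Z \<and> \<not> has_crossing (L i) \<and> viable01 Z (hs i) \<and>
      hdata_of Z (L i) = (hs i, ss i, ss (Suc i))"
    and tight: "\<And>i. i < n \<Longrightarrow> P \<in> core (hs i) (ss i) (ss (Suc i)) \<Longrightarrow> hs i a = 1 \<and> hs i (twin Z a) = 1"
    and H: "viable01 Z (\<lambda>e. \<Sum>i<n. hs i e)"
    and k: "1 \<le> k" "k \<le> n"
  defines "Hs \<equiv> \<lambda>k e. \<Sum>i<k. hs i e"
  defines "c \<equiv> \<lambda>k. \<Sum>i<k. of_bool (P \<in> core (hs i) (ss i) (ss (Suc i))) + of_bool (Hs i a = 1 \<and> hs i (step_to a) = 1) +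
      of_bool (Hs i (twin Z a) = 1 \<and> hs i (step_to (twin Z a)) = 1) :: nat"
  defines "E \<equiv> \<lambda>k. alg_prod (map L [0..<k])"
  shows "(E k \<in> diagrams Z \<and> \<not> has_crossing (E k) \<and> hdata_of Z (E k) = (Hs k, ss 0, ss k) \<and>
      c k = of_bool (P \<in> core (Hs k) (ss 0) (ss k))) \<or>
    (E k = 0 \<and> zero_state (Hs k (step_to a) = 1) (Hs k a = 1) (Hs k (step_to (twin Z a)) = 1) (Hs k (twin Z a) = 1)
      (P \<in> ss 0) (P \<in> ss k) (c k))"
  using k
proof (induction k rule: nat_induct_at_least)
  case base
  then have "0 < n" by simp
  then show ?case using L[of 0] by (simp add: E_def Hs_def c_def)
next
  case (Suc k)
  have kn: "k < n" using Suc.prems by simp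
  have lab: "lab Z a = P" using a P by (auto simp: pairs_def)
  have pl: "places Z = {a, twin Z a}" using fibre_twin(1)[OF a] P unfolding fibre_def pairs_def lab by blast
  have nn: "0 \<le> hs i e" if "i < n" for i e using L[OF that] viable01D(1)[of "hs i" e] by fastforce
  have HS: "Hs (Suc k) e = Hs k e + hs k e" for e by (simp add: Hs_def)
  have vH: "viable01 Z (Hs j)" if "j \<le> n" for j
  proof -
    have "0 \<le> Hs j e" for e
      unfolding Hs_def by (intro sum_nonneg nn) (use that in auto)
    moreover have "Hs j e \<le> (\<Sum>i<n. hs i e)" for e
      unfolding Hs_def using nn[of _ e] by (intro sum_mono2) (use that in auto)
    ultimately show ?thesis by (rule viable01_le[OF H])
  qed
  have v: "viable01 Z (Hs k)" "viable01 Z (Hs (Suc k))" "viable01 Z (hs k)" using vH kn L[OF kn] by auto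
  have dis: "\<not> (Hs k e = 1 \<and> hs k e = 1)" and orr: "(Hs (Suc k) e = 1) = (Hs k e = 1 \<or> hs k e = 1)" for e
  proof -
    have "Hs k e = 0 \<or> Hs k e = 1" "hs k e = 0 \<or> hs k e = 1" "Hs (Suc k) e = 0 \<or> Hs (Suc k) e = 1"
      using viable01D(1) v by blast+
    then show "\<not> (Hs k e = 1 \<and> hs k e = 1)" "(Hs (Suc k) e = 1) = (Hs k e = 1 \<or> hs k e = 1)"
      using HS[of e] by linarith+
  qed
  have ES: "E (Suc k) = E k \<odot> L k" unfolding E_def using alg_prod_snoc[of "map L [0..<k]" "L k"] Suc.hyps by simp
  have cS: "c (Suc k) = c k + (of_bool (P \<in> core (hs k) (ss k) (ss (Suc k))) + of_bool (Hs k a = 1 \<and> hs k (step_to a) = 1) +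
      of_bool (Hs k (twin Z a) = 1 \<and> hs k (step_to (twin Z a)) = 1))" by (simp add: c_def)
  have Lk: "L k \<in> diagrams Z" "\<not> has_crossing (L k)" "hgrading (L k) = hs k" "src Z (L k) = ss k" "tgt Z (L k) = ss (Suc k)"
    using L[OF kn] by (auto simp: hdata_of_def)
  have tk: "lab Z a \<in> core (hs k) (ss k) (ss (Suc k)) \<longrightarrow> hs k a = 1 \<and> hs k (twin Z a) = 1" using tight[OF kn] lab by blast
  obtain C where C: "C \<subseteq> full Z (hs k)" "config_ok (hs k) (ss k) (ss (Suc k)) C" "L k = Dg (hs k) (ss k) (ss (Suc k)) C"
    "local_ok (hs k (step_to a) = 1) (hs k a = 1) (hs k (step_to (twin Z a)) = 1) (hs k (twin Z a) = 1)
       False False (lab Z a \<in> ss k) (lab Z a \<in> ss (Suc k))"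
    "(hs k (step_to a) = 1, hs k a = 1, hs k (step_to (twin Z a)) = 1, hs k (twin Z a) = 1,
      lab Z a \<in> ss k, lab Z a \<in> ss (Suc k), a \<in> Domain (strands (hs k) C), twin Z a \<in> Domain (strands (hs k) C)) \<in> set right_rows"
    by (rule crossingless_rows[OF Lk(1) _ Lk(2) a, unfolded Lk]) (use v(3) tk in blast)+
  note cl = core_local[OF v(3) a, unfolded lab, of "ss k" "ss (Suc k)"] core_local[OF v(1) a, unfolded lab, of "ss 0" "ss k"]
    core_local[OF v(2) a, unfolded lab, of "ss 0" "ss (Suc k)"]
  have IH: "(E k \<in> diagrams Z \<and> \<not> has_crossing (E k) \<and> hdata_of Z (E k) = (Hs k, ss 0, ss k) \<and>
      c k = of_bool (P \<in> core (Hs k) (ss 0) (ss k))) \<or>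
    (E k = 0 \<and> zero_state (Hs k (step_to a) = 1) (Hs k a = 1) (Hs k (step_to (twin Z a)) = 1) (Hs k (twin Z a) = 1)
      (P \<in> ss 0) (P \<in> ss k) (c k))" using Suc.IH Suc.prems by simp
  show ?case
  proof (cases "E k = 0")
    case True
    moreover have "(0 :: 'i elt) \<notin> diagrams Z" unfolding diagrams_def by simp
    ultimately have "E k \<notin> diagrams Z" by simp
    then have z: "zero_state (Hs k (step_to a) = 1) (Hs k a = 1) (Hs k (step_to (twin Z a)) = 1) (Hs k (twin Z a) = 1)
      (P \<in> ss 0) (P \<in> ss k) (c k)" using IH by blast
    have tk': "local_core (hs k (step_to a) = 1) (hs k a = 1) (hs k (step_to (twin Z a)) = 1) (hs k (twin Z a) = 1) (P \<in> ss k) (P \<in> ss (Suc k))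
        \<longrightarrow> hs k (step_to a) = 1 \<and> hs k (step_to (twin Z a)) = 1"
      using tk unfolding lab cl local_core_def by blast
    have "zero_state (Hs k (step_to a) = 1 \<or> hs k (step_to a) = 1) (Hs k a = 1 \<or> hs k a = 1)
      (Hs k (step_to (twin Z a)) = 1 \<or> hs k (step_to (twin Z a)) = 1) (Hs k (twin Z a) = 1 \<or> hs k (twin Z a) = 1)
      (P \<in> ss 0) (P \<in> ss (Suc k)) (c (Suc k))"
      unfolding cS cl by (rule zero_state_step[OF dis dis dis dis z C(4)[unfolded lab] tk'])
    then show ?thesis unfolding orr[symmetric] using True ES by simp
  next
    case False
    then have Ek: "E k \<in> diagrams Z" "\<not> has_crossing (E k)" "hdata_of Z (E k) = (Hs k, ss 0, ss k)"
      "c k = of_bool (P \<in> core (Hs k) (ss 0) (ss k))" using IH by auto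
    then have Ed: "hgrading (E k) = Hs k" "src Z (E k) = ss 0" "tgt Z (E k) = ss k" by (auto simp: hdata_of_def)
    obtain B where B: "B \<subseteq> full Z (Hs k)" "config_ok (Hs k) (ss 0) (ss k) B" "E k = Dg (Hs k) (ss 0) (ss k) B"
      "(Hs k (step_to a) = 1, Hs k a = 1, Hs k (step_to (twin Z a)) = 1, Hs k (twin Z a) = 1,
        lab Z a \<in> ss 0, lab Z a \<in> ss k, a \<in> Range (strands (Hs k) B), twin Z a \<in> Range (strands (Hs k) B)) \<in> set left_rows"
      by (rule crossingless_rows[OF Ek(1) _ Ek(2) a, unfolded Ed]) (use v(1) in blast)+
    let ?z = "a \<in> Range (strands (Hs k) B) \<and> twin Z a \<in> Domain (strands (hs k) C) \<or>
      twin Z a \<in> Range (strands (Hs k) B) \<and> a \<in> Domain (strands (hs k) C)"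
    let ?cn = "of_bool (local_core (Hs k (step_to a) = 1) (Hs k a = 1) (Hs k (step_to (twin Z a)) = 1) (Hs k (twin Z a) = 1) (P \<in> ss 0) (P \<in> ss k)) +
      (of_bool (local_core (hs k (step_to a) = 1) (hs k a = 1) (hs k (step_to (twin Z a)) = 1) (hs k (twin Z a) = 1) (P \<in> ss k) (P \<in> ss (Suc k))) +
       of_bool (Hs k a = 1 \<and> hs k (step_to a) = 1) + of_bool (Hs k (twin Z a) = 1 \<and> hs k (step_to (twin Z a)) = 1)) :: nat"
    have cc: "c (Suc k) = ?cn" unfolding cS Ek(4) cl ..
    have st: "if ?z then zero_state (Hs (Suc k) (step_to a) = 1) (Hs (Suc k) a = 1) (Hs (Suc k) (step_to (twin Z a)) = 1)
        (Hs (Suc k) (twin Z a) = 1) (P \<in> ss 0) (P \<in> ss (Suc k)) (c (Suc k))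
      else c (Suc k) = of_bool (local_core (Hs (Suc k) (step_to a) = 1) (Hs (Suc k) a = 1) (Hs (Suc k) (step_to (twin Z a)) = 1)
        (Hs (Suc k) (twin Z a) = 1) (P \<in> ss 0) (P \<in> ss (Suc k)))"
      unfolding orr by (rule step_combine[OF B(4)[unfolded lab] C(5)[unfolded lab] dis dis dis dis cc])
    have comp: "(\<exists>\<kappa> \<in> terms (E k). \<exists>\<kappa>' \<in> terms (L k). Range \<kappa> = Domain \<kappa>') \<longleftrightarrow> \<not> ?z"
      unfolding B(3) C(3) using composable_iff[OF v(1,3) _ B(1,2) C(1,2)] dis pl twin_twin[OF a] by auto
    note prod = diagram_product[OF Ek(1,2) Lk(1,2), unfolded Ed Lk, OF refl]
    show ?thesis
    proof (cases ?z)
      case True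
      then have "E (Suc k) = 0" unfolding ES using prod(1) comp by blast
      then show ?thesis using st True by simp
    next
      case False
      then have "E (Suc k) \<in> diagrams Z \<and> \<not> has_crossing (E (Suc k)) \<and> hdata_of Z (E (Suc k)) = (\<lambda>e. Hs k e + hs k e, ss 0, ss (Suc k))"
        unfolding ES using prod(2) comp by blast
      moreover have "(\<lambda>e. Hs k e + hs k e) = Hs (Suc k)" using HS by auto
      moreover have "c (Suc k) = of_bool (P \<in> core (Hs (Suc k)) (ss 0) (ss (Suc k)))" using st False unfolding cl by simp
      ultimately show ?thesis by simp
    qed
  qed
qed

end

section \<open>Cutting at a matched pair\<close>

text \<open>The restriction of \<open>h\<close> to a fragment, where \<open>(a, 0)\<close> names the
  step before the place \<open>a\<close> and \<open>(a, 1)\<close> the step after it.\<close>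

definition loc :: "'i arc_diagram \<Rightarrow> nat \<Rightarrow> 'i hgr \<Rightarrow> 'i pt hgr" where
  "loc Z P h = (\<lambda>(a, j). if a \<in> fibre Z P then (if j = 0 then h (step_to a) else if j = 1 then h a else 0) else 0)"

definition loc_places :: "'i arc_diagram \<Rightarrow> nat \<Rightarrow> 'i pt set \<Rightarrow> 'i pt pt set" where
  "loc_places Z P B = (\<lambda>a. (a, 1)) ` (B \<inter> fibre Z P)"

lemma places_fragment: "places (fragment Z P) = (\<lambda>a. (a, 1)) ` fibre Z P"
  unfolding places_def fragment_def by force

lemma steps_fragment: "steps (fragment Z P) = {(a, j). a \<in> fibre Z P \<and> j \<le> 1}"
  unfolding steps_def fragment_def by simp

lemma lab_fragment [simp]: "lab (fragment Z P) x = P"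
  by (simp add: fragment_def)

lemma loc_sum: "loc Z P (\<lambda>e. \<Sum>i\<in>I. h i e) = (\<lambda>x. \<Sum>i\<in>I. loc Z P (h i) x)"
  unfolding loc_def by (rule ext) (auto split: prod.split)

lemma loc_at:
  assumes "a \<in> fibre Z P"
  shows "loc Z P h (a, 1) = h a" "loc Z P h (a, Suc 0) = h a" "loc Z P h (a, 0) = h (step_to a)"
  using assms by (simp_all add: loc_def)

context pre_arc_diagram
begin

context
  fixes P assumes P: "P \<in> pairs Z"
begin

lemma fibre_ex: "\<exists>a. a \<in> fibre Z P"
  using card_fibre[OF P] by (metis card.empty ex_in_conv zero_neq_numeral)

lemma fibreD: "a \<in> fibre Z P \<Longrightarrow> a \<in> places Z" "a \<in> fibre Z P \<Longrightarrow> lab Z a = P"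
  by (simp_all add: fibre_def)

lemma fibre_eq: "a \<in> fibre Z P \<Longrightarrow> fibre Z P = {a, twin Z a}"
  using fibre_twin(1)[of a] fibreD by metis

lemma pairs_fragment: "pairs (fragment Z P) = {P}"
  using fibre_ex unfolding pairs_def places_fragment by (auto simp: image_image)

lemma fibre_fragment: "fibre (fragment Z P) P = (\<lambda>a. (a, 1)) ` fibre Z P"
  by (simp add: fibre_def places_fragment)

lemma fragment_pre: "pre_arc_diagram (fragment Z P)"
proof
  show "finite (ivs (fragment Z P))"
    using card_fibre[OF P] unfolding fragment_def by (simp add: card_ge_0_finite)
  fix Q assume "Q \<in> pairs (fragment Z P)"
  then have "Q = P" using pairs_fragment by simp
  then show "card (fibre (fragment Z P) Q) = 2"
    using card_fibre[OF P] by (simp add: fibre_fragment card_image inj_on_def)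
qed

interpretation f: pre_arc_diagram "fragment Z P"
  by (rule fragment_pre)

lemma twin_fragment: "a \<in> fibre Z P \<Longrightarrow> twin (fragment Z P) (a, 1) = (twin Z a, 1)"
proof -
  assume a: "a \<in> fibre Z P"
  have m: "(a, 1) \<in> places (fragment Z P)" unfolding places_fragment using a by blast
  have "fibre (fragment Z P) P = {(a, 1), twin (fragment Z P) (a, 1)}" "twin (fragment Z P) (a, 1) \<noteq> (a, 1)"
    using f.fibre_twin[OF m] by simp_all
  moreover have "fibre (fragment Z P) P = {(a, 1), (twin Z a, 1)}"
    unfolding fibre_fragment fibre_eq[OF a] by simp
  ultimately show ?thesis by (metis doubleton_eq_iff)
qed

lemma viable01_loc: "viable01 Z h \<Longrightarrow> viable01 (fragment Z P) (loc Z P h)"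
  unfolding viable01_def steps_fragment loc_def by (auto split: prod.split)

lemma full_fragment: "full (fragment Z P) (loc Z P h) = loc_places Z P (full Z h)"
proof (intro equalityI subsetI)
  fix x assume x: "x \<in> full (fragment Z P) (loc Z P h)"
  then obtain a where a: "x = (a, 1)" "a \<in> fibre Z P" unfolding full_def places_fragment by blast
  then show "x \<in> loc_places Z P (full Z h)"
    using x fibreD[OF a(2)] unfolding full_def loc_places_def by (auto simp: loc_at[OF a(2)])
next
  fix x assume "x \<in> loc_places Z P (full Z h)"
  then obtain a where a: "x = (a, 1)" "a \<in> fibre Z P" "a \<in> full Z h" unfolding loc_places_def by blast
  then show "x \<in> full (fragment Z P) (loc Z P h)"
    unfolding full_def places_fragment by (auto simp: loc_at[OF a(2)])
qed

text \<open>Cutting commutes with the description by runs and breaks, because inside a fragment a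
  strand is seen only through the two steps at a place and whether it is broken there.\<close>

lemma cut_strands_strands:
  assumes h: "viable01 Z h" and B: "B \<subseteq> full Z h"
  shows "cut_strands Z P (strands h B) = strands (loc Z P h) (loc_places Z P B)"
proof -
  have v: "viable01 (fragment Z P) (loc Z P h)" using viable01_loc[OF h] .
  have pos: "snd a > 0" if "a \<in> fibre Z P" for a using fibreD(1)[OF that] by (auto simp: places_def)
  have lp: "(a, j) \<in> loc_places Z P B \<longleftrightarrow> j = 1 \<and> a \<in> B" if "a \<in> fibre Z P" for a j
    unfolding loc_places_def using that by auto
  \<comment> \<open>An interval of a fragment has three points, so its only possible strands run
    from 0 to 1, from 0 to 2 and from 1 to 2.\<close>
  have three: "((a, m), (a, n)) \<in> strands (loc Z P h) (loc_places Z P B) \<longleftrightarrow>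
      m = 0 \<and> n = 1 \<and> h (step_to a) = 1 \<and> (h a = 0 \<or> a \<in> B) \<or>
      m = 0 \<and> n = 2 \<and> h (step_to a) = 1 \<and> h a = 1 \<and> a \<notin> B \<or>
      m = 1 \<and> n = 2 \<and> h a = 1 \<and> (h (step_to a) = 0 \<or> a \<in> B)" if a: "a \<in> fibre Z P" for a m n
  proof -
    have l: "loc Z P h (a, j) = (if j = 0 then h (step_to a) else if j = 1 then h a else 0)" for j
      using a by (simp add: loc_def)
    show ?thesis
    proof
      assume "((a, m), (a, n)) \<in> strands (loc Z P h) (loc_places Z P B)"
      note s = this[unfolded strands_iff lp[OF a] l]
      have "n \<le> 2"
      proof (rule ccontr)
        assume "\<not> n \<le> 2"
        then have "m \<le> n - 1" "n - 1 < n" "n - 1 \<noteq> 0" "n - 1 \<noteq> 1" using s by auto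
        then show False using s by (metis zero_neq_one)
      qed
      moreover have "m < n" using s by blast
      ultimately consider "m = 0" "n = 1" | "m = 0" "n = 2" | "m = 1" "n = 2" by linarith
      then show "m = 0 \<and> n = 1 \<and> h (step_to a) = 1 \<and> (h a = 0 \<or> a \<in> B) \<or>
          m = 0 \<and> n = 2 \<and> h (step_to a) = 1 \<and> h a = 1 \<and> a \<notin> B \<or>
          m = 1 \<and> n = 2 \<and> h a = 1 \<and> (h (step_to a) = 0 \<or> a \<in> B)"
      proof cases
        case 1
        then show ?thesis using s by auto
      next
        case 2
        have "h (step_to a) = 1" "h a = 1" using s 2 by (metis less_2_cases_iff zero_le, metis One_nat_def lessI numeral_2_eq_2 zero_le zero_neq_one)
        moreover have "a \<notin> B" using s 2 by (metis One_nat_def lessI numeral_2_eq_2 zero_less_one)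
        ultimately show ?thesis using 2 by blast
      next
        case 3
        then show ?thesis using s by auto
      qed
    next
      assume "m = 0 \<and> n = 1 \<and> h (step_to a) = 1 \<and> (h a = 0 \<or> a \<in> B) \<or>
          m = 0 \<and> n = 2 \<and> h (step_to a) = 1 \<and> h a = 1 \<and> a \<notin> B \<or>
          m = 1 \<and> n = 2 \<and> h a = 1 \<and> (h (step_to a) = 0 \<or> a \<in> B)"
      then show "((a, m), (a, n)) \<in> strands (loc Z P h) (loc_places Z P B)"
        unfolding strands_iff lp[OF a] l by (elim disjE conjE) auto
    qed
  qed
  show ?thesis
  proof (intro equalityI subrelI)
    fix x' y' assume "(x', y') \<in> cut_strands Z P (strands h B)"
    then obtain p x y where e: "x' = clamp_pt p x" "y' = clamp_pt p y" and p: "p \<in> fibre Z P" and xy: "(x, y) \<in> strands h B"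
      and f: "fst x = fst p" and ne: "clamp_pt p x \<noteq> clamp_pt p y" unfolding cut_strands_def by blast
    obtain i k where pk: "p = (i, k)" by (cases p)
    have "fst x = fst y" using strandsD(1)[OF xy] by blast
    then obtain m n where mn: "x = (i, m)" "y = (i, n)" using f pk by (cases x; cases y) simp
    have s: "m < n" "\<forall>k. m \<le> k \<and> k < n \<longrightarrow> h (i, k) = 1" "\<forall>k. m < k \<and> k < n \<longrightarrow> (i, k) \<notin> B"
      "m = 0 \<or> h (i, m - 1) = 0 \<or> (i, m) \<in> B" "h (i, n) = 0 \<or> (i, n) \<in> B"
      using xy[unfolded mn strands_iff] by blast+
    have k0: "k > 0" using pos[OF p] pk by simp
    consider "m < k" "n = k" | "m < k" "k < n" | "m = k" "k < n" | "m > k \<or> n < k" using s(1) by linarith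
    then have "\<exists>m' n'. x' = (p, m') \<and> y' = (p, n') \<and> ((p, m'), (p, n')) \<in> strands (loc Z P h) (loc_places Z P B)"
    proof cases
      case 1
      have "h (i, k - 1) = 1" using s(2) 1 k0 by auto
      then show ?thesis using 1 s(5) unfolding e mn pk clamp_pt_def by (simp add: three[OF p, unfolded pk])
    next
      case 2
      have "m \<le> k - 1" "k - 1 < n" using 2 k0 by linarith+
      then have "h (i, k - 1) = 1" "h (i, k) = 1" "(i, k) \<notin> B" using s(2,3) 2 by auto
      then show ?thesis using 2 unfolding e mn pk clamp_pt_def by (simp add: three[OF p, unfolded pk])
    next
      case 3
      have "h (i, k) = 1" using s(2) 3 by auto
      then show ?thesis using 3 s(4) k0 unfolding e mn pk clamp_pt_def by (simp add: three[OF p, unfolded pk])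
    next
      case 4
      then have False using ne s(1) unfolding mn pk clamp_pt_def by auto
      then show ?thesis ..
    qed
    then show "(x', y') \<in> strands (loc Z P h) (loc_places Z P B)" by blast
  next
    fix x' y' assume xy: "(x', y') \<in> strands (loc Z P h) (loc_places Z P B)"
    then have st: "fst x' = fst y'" "loc Z P h x' = 1" using strandsD(1) by blast+
    obtain a m' where x': "x' = (a, m')" by (cases x')
    obtain n' where y': "y' = (a, n')" using st(1) x' by (cases y') simp
    have a: "a \<in> fibre Z P" using st(2) unfolding x' loc_def by (auto split: if_splits)
    obtain i k where ak: "a = (i, k)" by (cases a)
    have k0: "k > 0" using pos[OF a] ak by simp
    have aP: "(i, k) \<in> fibre Z P" using a ak by simp
    have mem: "(clamp_pt a x, clamp_pt a y) \<in> cut_strands Z P (strands h B)"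
      if "(x, y) \<in> strands h B" "fst x = fst a" "clamp_pt a x \<noteq> clamp_pt a y" for x y
      using that a unfolding cut_strands_def by blast
    from three[OF a, of m' n'] xy[unfolded x' y'] consider
      "m' = 0" "n' = 1" "h (step_to a) = 1" "h a = 0 \<or> a \<in> B" |
      "m' = 0" "n' = 2" "h (step_to a) = 1" "h a = 1" "a \<notin> B" |
      "m' = 1" "n' = 2" "h a = 1" "h (step_to a) = 0 \<or> a \<in> B" by blast
    then show "(x', y') \<in> cut_strands Z P (strands h B)"
    proof cases
      case 1
      then have "a \<in> Range (strands h B)" using k0 unfolding ak Range_strands[OF h] by simp
      then obtain x where x: "(x, a) \<in> strands h B" by blast
      then have "fst x = i" "snd x < k" using strandsD(1)[OF x] ak by auto
      then have "clamp_pt a x = x'" "clamp_pt a a = y'" "fst x = fst a" unfolding clamp_pt_def x' y' using 1 ak by auto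
      then show ?thesis using mem[OF x] 1 unfolding x' y' by auto
    next
      case 2
      obtain m n where s: "m \<le> k" "k < n" "((i, m), (i, n)) \<in> strands h B"
        using strand_through[OF h, of i k] 2(4) ak by metis
      have "a \<notin> Domain (strands h B)" using 2 k0 unfolding ak Domain_strands[OF h] by simp
      then have "m < k" using s ak by (metis Domain.DomainI le_neq_implies_less)
      then have "clamp_pt a (i, m) = x'" "clamp_pt a (i, n) = y'" unfolding clamp_pt_def x' y' using 2 ak s by auto
      then show ?thesis using mem[OF s(3)] 2 ak unfolding x' y' by auto
    next
      case 3
      then have "a \<in> Domain (strands h B)" using k0 unfolding ak Domain_strands[OF h] by auto
      then obtain y where y: "(a, y) \<in> strands h B" by blast
      then have "fst y = i" "k < snd y" using strandsD(1)[OF y] ak by auto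
      then have "clamp_pt a a = x'" "clamp_pt a y = y'" unfolding clamp_pt_def x' y' using 3 ak by auto
      then show ?thesis using mem[OF y] 3 unfolding x' y' by auto
    qed
  qed
qed

lemma config_ok_fragment:
  "f.config_ok (loc Z P h) (s \<inter> {P}) (t \<inter> {P}) {} \<longleftrightarrow>
    (\<forall>a \<in> fibre Z P. local_ok (h (step_to a) = 1) (h a = 1) (h (step_to (twin Z a)) = 1) (h (twin Z a) = 1)
        False False (P \<in> s) (P \<in> t))"
proof -
  let ?l = "\<lambda>x. local_ok (loc Z P h (step_to x) = 1) (loc Z P h x = 1) (loc Z P h (step_to (twin (fragment Z P) x)) = 1)
    (loc Z P h (twin (fragment Z P) x) = 1) (x \<in> {}) (twin (fragment Z P) x \<in> {}) (P \<in> s \<inter> {P}) (P \<in> t \<inter> {P})"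
  have e: "?l (a, 1) = local_ok (h (step_to a) = 1) (h a = 1) (h (step_to (twin Z a)) = 1) (h (twin Z a) = 1)
        False False (P \<in> s) (P \<in> t)" if a: "a \<in> fibre Z P" for a
  proof -
    have tw: "twin Z a \<in> fibre Z P" using fibre_eq[OF a] by blast
    show ?thesis by (simp add: twin_fragment[OF a, unfolded One_nat_def] loc_at[OF a] loc_at[OF tw])
  qed
  have "f.config_ok (loc Z P h) (s \<inter> {P}) (t \<inter> {P}) {} \<longleftrightarrow> (\<forall>a \<in> fibre Z P. ?l (a, 1))"
    unfolding f.config_ok_def places_fragment pairs_fragment lab_fragment by blast
  then show ?thesis by (simp only: e cong: ball_cong)
qed

lemma core_fragment: "f.core (loc Z P h) (s \<inter> {P}) (t \<inter> {P}) = core h s t \<inter> {P}"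
proof -
  have "(\<forall>b \<in> fibre (fragment Z P) P. loc Z P h (step_to b) = loc Z P h b) = (\<forall>a \<in> fibre Z P. h (step_to a) = h a)"
    "(\<exists>b \<in> fibre (fragment Z P) P. loc Z P h b = 1) = (\<exists>a \<in> fibre Z P. h a = 1)"
    unfolding fibre_fragment by (simp_all only: ball_simps bex_simps fst_step_to loc_at diff_self_eq_0 cong: ball_cong bex_cong)
  then show ?thesis unfolding f.core_def core_def pairs_fragment using P by blast
qed

lemma brk_fragment: "f.brk (loc Z P h) (s \<inter> {P}) (t \<inter> {P}) = loc_places Z P (brk h s t)"
  unfolding f.brk_def core_fragment full_fragment brk_def loc_places_def using fibreD(2) by auto

end

end

text \<open>Only the steps after the places are tested: at a core pair the steps before them have
  the same multiplicity, so there this is double occupation.\<close>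

definition doubly :: "'i arc_diagram \<Rightarrow> 'i hgr \<Rightarrow> nat \<Rightarrow> bool" where
  "doubly Z h P \<longleftrightarrow> (\<forall>a \<in> fibre Z P. h a = 1)"

context viable_data
begin

lemma doubled_iff: "doubled \<longleftrightarrow> (\<forall>P \<in> K. doubly Z h P)"
proof
  assume d: doubled
  show "\<forall>P \<in> K. doubly Z h P"
  proof
    fix P assume "P \<in> K"
    then obtain a where a: "a \<in> F" "P = lab Z a" by (metis core_brk imageE)
    have "twin Z a \<in> F" using d a(1) unfolding doubled_def by blast
    then show "doubly Z h P" unfolding doubly_def a(2) fibre_twin(1)[OF F_places[OF a(1)]]
      using a(1) brk_places(2) full_places(2) by blast
  qed
next
  assume d: "\<forall>P \<in> K. doubly Z h P"
  show doubled
    unfolding doubled_def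
  proof
    fix a assume a: "a \<in> F"
    have ap: "a \<in> places Z" and l: "lab Z a \<in> K" using F_places[OF a] F_core[OF a] by auto
    then have "h (twin Z a) = 1" using d fibre_twin(1)[OF ap] unfolding doubly_def by blast
    moreover have "h (step_to (twin Z a)) = h (twin Z a)" using in_core_iff[OF ap] l by blast
    ultimately show "twin Z a \<in> F" using twin_place[OF ap] l by (simp add: brk_def full_def)
  qed
qed

lemma fragment_viable_data:
  assumes "P \<in> pairs Z"
  shows "viable_data (fragment Z P) (loc Z P h) (s \<inter> {P}) (t \<inter> {P})"
proof -
  have "pre_arc_diagram.config_ok (fragment Z P) (loc Z P h) (s \<inter> {P}) (t \<inter> {P}) {}"
    unfolding config_ok_fragment[OF assms]
  proof
    fix a assume "a \<in> fibre Z P"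
    then have "a \<in> places Z" "lab Z a = P" by (auto simp: fibre_def)
    then show "local_ok (h (step_to a) = 1) (h a = 1) (h (step_to (twin Z a)) = 1) (h (twin Z a) = 1)
        False False (P \<in> s) (P \<in> t)" using ok unfolding config_ok_def by auto
  qed
  then show ?thesis
    unfolding viable_data_def viable_data_axioms_def using fragment_pre[OF assms] viable01_loc[OF assms viable] by blast
qed

text \<open>The local diagram of a configuration is given by its breaks at \<open>P\<close>, so the
  classification of diagrams applies to it in the fragment.\<close>

lemma local_diag_Dg:
  assumes P: "P \<in> pairs Z" and B: "B \<in> configs"
  shows "local_diag Z P (Dg h s t B) =
    pre_arc_diagram.Dg (fragment Z P) (loc Z P h) (s \<inter> {P}) (t \<inter> {P}) (loc_places Z P B)"
    "loc_places Z P B \<in> viable_data.configs (fragment Z P) (loc Z P h) (s \<inter> {P}) (t \<inter> {P})"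
    "lab (fragment Z P) ` loc_places Z P B = lab Z ` B \<inter> {P}"
proof -
  interpret f: viable_data "fragment Z P" "loc Z P h" "s \<inter> {P}" "t \<inter> {P}"
    by (rule fragment_viable_data[OF P])
  show "local_diag Z P (Dg h s t B) = f.Dg (loc Z P h) (s \<inter> {P}) (t \<inter> {P}) (loc_places Z P B)"
    unfolding local_diag_def f.Dg_def Dg_configs(4-6)[OF B] cut_strands_strands[OF P viable configsD(3)[OF B]] ..
  have "loc_places Z P B \<subseteq> loc_places Z P F" using configsD(1)[OF B] unfolding loc_places_def by blast
  moreover have "inj_on (lab (fragment Z P)) (loc_places Z P B)"
  proof (rule inj_onI)
    fix x y assume "x \<in> loc_places Z P B" "y \<in> loc_places Z P B"
    then obtain a b where "x = (a, 1)" "y = (b, 1)" "a \<in> B" "b \<in> B" "a \<in> fibre Z P" "b \<in> fibre Z P"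
      unfolding loc_places_def by blast
    moreover from this have "lab Z a = lab Z b" by (simp add: fibre_def)
    ultimately show "x = y" using configsD(2)[OF B] by (metis inj_onD)
  qed
  ultimately show "loc_places Z P B \<in> f.configs" unfolding f.configs_def brk_fragment[OF P] by blast
  show "lab (fragment Z P) ` loc_places Z P B = lab Z ` B \<inter> {P}"
  proof (cases "B \<inter> fibre Z P = {}")
    case True
    then have "P \<notin> lab Z ` B" using configsD(1)[OF B] F_places unfolding fibre_def by blast
    then show ?thesis using True unfolding loc_places_def by auto
  next
    case False
    then have "P \<in> lab Z ` B" unfolding fibre_def by blast
    then show ?thesis using False unfolding loc_places_def by auto
  qed
qed

lemma fragment_doubled:
  assumes "P \<in> pairs Z"
  shows "viable_data.doubled (fragment Z P) (loc Z P h) (s \<inter> {P}) (t \<inter> {P}) \<longleftrightarrow> (P \<in> K \<longrightarrow> doubly Z h P)"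
proof -
  interpret f: viable_data "fragment Z P" "loc Z P h" "s \<inter> {P}" "t \<inter> {P}"
    by (rule fragment_viable_data[OF assms])
  show ?thesis
    unfolding f.doubled_iff core_fragment[OF assms] doubly_def by (auto simp: fibre_fragment[OF assms] loc_at)
qed

text \<open>The global criteria applied in the fragment, whose core is \<open>K\<close> restricted
  to \<open>P\<close>: an unbroken core pair is crossed, and a broken one is twisted or tight
  according to its occupation.\<close>

lemma Dg_types_at:
  assumes P: "P \<in> pairs Z" and B: "B \<in> configs"
  shows "crossed_at Z P (Dg h s t B) \<longleftrightarrow> P \<in> K - lab Z ` B"
    "twisted_at Z P (Dg h s t B) \<longleftrightarrow> P \<in> lab Z ` B \<and> \<not> doubly Z h P"
    "tight_at Z P (Dg h s t B) \<longleftrightarrow> (P \<in> K \<longrightarrow> P \<in> lab Z ` B \<and> doubly Z h P)"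
proof -
  interpret f: viable_data "fragment Z P" "loc Z P h" "s \<inter> {P}" "t \<inter> {P}"
    by (rule fragment_viable_data[OF P])
  note l = local_diag_Dg[OF P B]
  note ty = f.Dg_types[OF l(2), unfolded core_fragment[OF P] l(3) fragment_doubled[OF P]]
  have "lab Z ` B \<subseteq> K" using configsD(1)[OF B] F_core by blast
  then show "crossed_at Z P (Dg h s t B) \<longleftrightarrow> P \<in> K - lab Z ` B"
    "twisted_at Z P (Dg h s t B) \<longleftrightarrow> P \<in> lab Z ` B \<and> \<not> doubly Z h P"
    "tight_at Z P (Dg h s t B) \<longleftrightarrow> (P \<in> K \<longrightarrow> P \<in> lab Z ` B \<and> doubly Z h P)"
    unfolding crossed_at_def twisted_at_def tight_at_def l(1) ty using Dg_viable[OF B] by auto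
qed

end

section \<open>Tensor products at a matched pair\<close>

lemma rep_props:
  assumes "C \<in> diag_classes Z"
  shows "rep Z C \<in> diagrams Z" "\<partial> (rep Z C) = 0" "hclass Z (rep Z C) = C" "C \<noteq> hclass Z 0"
proof -
  have ex: "\<exists>D. D \<in> diagrams Z \<and> \<partial> D = 0 \<and> hclass Z D = C" and "C \<noteq> hclass Z 0"
    using assms unfolding diag_classes_def by auto
  from someI_ex[OF ex] show "rep Z C \<in> diagrams Z" "\<partial> (rep Z C) = 0" "hclass Z (rep Z C) = C"
    unfolding rep_def by auto
  show "C \<noteq> hclass Z 0" by fact
qed

context pre_arc_diagram
begin

lemma diagram_viable_data:
  assumes D: "D \<in> diagrams Z" "viable01 Z (hgrading D)"
  shows "viable_data Z (hgrading D) (src Z D) (tgt Z D)"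
    "\<exists>B \<in> viable_data.configs Z (hgrading D) (src Z D) (tgt Z D). D = Dg (hgrading D) (src Z D) (tgt Z D) B"
proof -
  obtain B where B: "B \<subseteq> brk (hgrading D) (src Z D) (tgt Z D)" "inj_on (lab Z) B"
    "D = Dg (hgrading D) (src Z D) (tgt Z D) B" "config_ok (hgrading D) (src Z D) (tgt Z D) {}"
    using viable_diagram_Dg[OF D] by metis
  show v: "viable_data Z (hgrading D) (src Z D) (tgt Z D)"
    using D(2) B(4) pre_arc_diagram_axioms unfolding viable_data_def viable_data_axioms_def by blast
  show "\<exists>B \<in> viable_data.configs Z (hgrading D) (src Z D) (tgt Z D). D = Dg (hgrading D) (src Z D) (tgt Z D) B"
    unfolding viable_data.configs_def[OF v] using B by blast
qed

text \<open>A single diagram with crossings is never a cycle, so a representing diagram has none; if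
  some core pair were once occupied its class would be zero.\<close>

lemma generator_tight:
  assumes D: "D \<in> diagrams Z" "viable01 Z (hgrading D)" "\<partial> D = 0" "hclass Z D \<noteq> hclass Z 0"
  obtains B where "viable_data Z (hgrading D) (src Z D) (tgt Z D)"
    "B \<in> viable_data.configs Z (hgrading D) (src Z D) (tgt Z D)" "D = Dg (hgrading D) (src Z D) (tgt Z D) B"
    "lab Z ` B = core (hgrading D) (src Z D) (tgt Z D)" "viable_data.doubled Z (hgrading D) (src Z D) (tgt Z D)"
    "\<not> has_crossing D"
proof -
  define h s t where "h = hgrading D" "s = src Z D" "t = tgt Z D"
  note e = h_s_t_def[symmetric]
  interpret viable_data Z h s t using diagram_viable_data(1)[OF D(1,2)] unfolding e .
  obtain B where B: "B \<in> configs" "D = Dg h s t B" using diagram_viable_data(2)[OF D(1,2)] unfolding e by blast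
  have K: "lab Z ` B = K" using Dg_cycle_iff[OF B(1)] D(3) B(2) by simp
  have "doubled" using Dg_hclass[OF B(1) K] D(4) B(2) by simp
  moreover have "\<not> has_crossing D" using has_crossing_Dg[OF B(1)] K B(2) by simp
  ultimately show ?thesis using that[of B] B K viable_data_axioms unfolding e by blast
qed

text \<open>The local tensor product works with the diagram chosen by \<open>rep\<close>, which may
  differ from the local diagram of \<open>D\<close>. Both represent the same nonzero class, so they
  agree in H-data and in having no crossings, which is all that the local products need.\<close>

lemma local_rep:
  assumes D: "D \<in> diagrams Z" "viable01 Z (hgrading D)" "\<partial> D = 0" "hclass Z D \<noteq> hclass Z 0" and P: "P \<in> pairs Z"
  defines "L \<equiv> rep (fragment Z P) (hclass (fragment Z P) (local_diag Z P D))"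
  shows "L \<in> diagrams (fragment Z P)" "\<not> has_crossing L"
    "hdata_of (fragment Z P) L = (loc Z P (hgrading D), src Z D \<inter> {P}, tgt Z D \<inter> {P})"
    "viable01 (fragment Z P) (loc Z P (hgrading D))"
proof -
  obtain B where v: "viable_data Z (hgrading D) (src Z D) (tgt Z D)"
    and B: "B \<in> viable_data.configs Z (hgrading D) (src Z D) (tgt Z D)" "D = Dg (hgrading D) (src Z D) (tgt Z D) B"
    "lab Z ` B = core (hgrading D) (src Z D) (tgt Z D)" "viable_data.doubled Z (hgrading D) (src Z D) (tgt Z D)"
    by (rule generator_tight[OF D])
  define h s t where "h = hgrading D" "s = src Z D" "t = tgt Z D"
  note e = h_s_t_def[symmetric]
  interpret viable_data Z h s t using v unfolding e .
  interpret f: viable_data "fragment Z P" "loc Z P h" "s \<inter> {P}" "t \<inter> {P}"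
    by (rule fragment_viable_data[OF P])
  note Bc = B(1)[unfolded e]
  note ld = local_diag_Dg[OF P Bc]
  let ?X = "local_diag Z P D"
  have X: "?X = f.Dg (loc Z P h) (s \<inter> {P}) (t \<inter> {P}) (loc_places Z P B)" using ld(1) B(2)[unfolded e] by simp
  have labX: "lab (fragment Z P) ` loc_places Z P B = f.K" unfolding ld(3) core_fragment[OF P] using B(3)[unfolded e] by simp
  have "f.doubled" unfolding fragment_doubled[OF P] using B(4)[unfolded e doubled_iff] by blast
  then have Xne: "hclass (fragment Z P) ?X \<noteq> hclass (fragment Z P) 0" unfolding X using f.Dg_hclass[OF ld(2) labX] by blast
  have X0: "\<partial> ?X = 0" unfolding X using f.Dg_cycle_iff[OF ld(2)] labX by blast
  have Xd: "?X \<in> diagrams (fragment Z P)" "hdata_of (fragment Z P) ?X = (loc Z P h, s \<inter> {P}, t \<inter> {P})"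
    unfolding X using f.Dg_configs[OF ld(2)] by auto
  have "hclass (fragment Z P) ?X \<in> diag_classes (fragment Z P)"
    unfolding diag_classes_def using Xd(1) X0 Xne by blast
  note r = rep_props[OF this, folded L_def]
  show L: "L \<in> diagrams (fragment Z P)" by (rule r(1))
  have hd: "hdata_of (fragment Z P) L = (loc Z P h, s \<inter> {P}, t \<inter> {P})"
    unfolding Xd(2)[symmetric] by (rule f.diagrams_hclass_data[OF L Xd(1)]) (use r in simp_all)
  then have Lh: "hgrading L = loc Z P h" "src (fragment Z P) L = s \<inter> {P}" "tgt (fragment Z P) L = t \<inter> {P}"
    by (auto simp: hdata_of_def)
  have Ln: "hclass (fragment Z P) L \<noteq> hclass (fragment Z P) 0" using r(3,4) by simp
  show "\<not> has_crossing L"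
    by (rule f.generator_tight[OF L _ r(2) Ln]) (use Lh f.viable in simp_all)
  show "hdata_of (fragment Z P) L = (loc Z P (hgrading D), src Z D \<inter> {P}, tgt Z D \<inter> {P})"
    using hd unfolding e .
  show "viable01 (fragment Z P) (loc Z P (hgrading D))" using f.viable unfolding e .
qed

end

locale tensor = pre_arc_diagram Z for Z :: "'i arc_diagram" +
  fixes M :: "'i elt set list"
  assumes classes: "M \<in> lists (diag_classes Z)" and nonempty: "M \<noteq> []" and viable_M: "viable_tensor Z M"
begin

definition D :: "nat \<Rightarrow> 'i elt" where "D i = rep Z (M ! i)"
definition h :: "nat \<Rightarrow> 'i hgr" where "h i = hgrading (D i)"
text \<open>The idempotent between consecutive factors; the last value, \<open>s n\<close>, is the
  target of the last factor. Viability makes \<open>s (Suc i)\<close> the target of factor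
  \<open>i\<close>.\<close>

definition s :: "nat \<Rightarrow> nat set" where "s i = (if i < length M then src Z (D i) else tgt Z (D (length M - 1)))"
definition H :: "nat \<Rightarrow> 'i hgr" where "H k = (\<lambda>e. \<Sum>i<k. h i e)"

abbreviation "n \<equiv> length M"

lemma n_pos: "0 < n" using nonempty by simp

lemma D_props:
  assumes "i < n"
  shows "D i \<in> diagrams Z" "\<partial> (D i) = 0" "hclass Z (D i) = M ! i" "hclass Z (D i) \<noteq> hclass Z 0"
proof -
  have "M ! i \<in> diag_classes Z" using classes assms by (auto simp: lists_eq_set)
  from rep_props[OF this] show "D i \<in> diagrams Z" "\<partial> (D i) = 0" "hclass Z (D i) = M ! i" "hclass Z (D i) \<noteq> hclass Z 0"
    unfolding D_def by auto
qed

lemma src_tgt: "i < n \<Longrightarrow> src Z (D i) = s i" "i < n \<Longrightarrow> tgt Z (D i) = s (Suc i)"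
proof -
  assume i: "i < n"
  then show "src Z (D i) = s i" by (simp add: s_def)
  show "tgt Z (D i) = s (Suc i)"
  proof (cases "Suc i < n")
    case True
    then show ?thesis using viable_M unfolding viable_tensor_def mismatch_def s_def D_def by auto
  next
    case False
    then have "n - 1 = i" using i by simp
    then have "s (Suc i) = tgt Z (D i)" unfolding s_def using False by (simp only: if_False)
    then show ?thesis ..
  qed
qed

lemma tensor_hgr_eq: "tensor_hgr Z M = H n"
  unfolding tensor_hgr_def H_def h_def D_def by (rule ext) (simp add: sum_list_sum_nth atLeast0LessThan)

lemma tensor_hdata_eq: "tensor_hdata Z M = (H n, s 0, s n)"
  unfolding tensor_hdata_def tensor_hgr_eq using n_pos nonempty src_tgt(1)[of 0] src_tgt(2)[of "n - 1"]
  by (simp add: hd_conv_nth last_conv_nth D_def)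

lemma h_nonneg: "0 \<le> h i e"
  unfolding h_def hgrading_def sd_hgr_def by simp

lemma viable_Hn: "viable01 Z (H n)"
  unfolding viable01_def
proof (intro conjI allI impI)
  have off: "H n e = 0" if "e \<notin> steps Z" for e
    unfolding H_def h_def using hgrading_off_steps[OF D_props(1) that] by simp
  then show "H n e = 0" if "e \<notin> steps Z" for e using that .
  show "H n e = 0 \<or> H n e = 1" for e
  proof (cases "e \<in> steps Z")
    case True
    then show ?thesis using viable_M unfolding viable_tensor_def viable_hgr_def tensor_hgr_eq by blast
  qed (use off in blast)
qed

lemma viable_H: "k \<le> n \<Longrightarrow> viable01 Z (H k)"
proof (rule viable01_le[OF viable_Hn])
  assume k: "k \<le> n"
  show "0 \<le> H k e" for e unfolding H_def by (intro sum_nonneg h_nonneg)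
  show "H k e \<le> H n e" for e unfolding H_def using k by (intro sum_mono2) (auto intro: h_nonneg)
qed

lemma viable_h: "i < n \<Longrightarrow> viable01 Z (h i)"
proof (rule viable01_le[OF viable_Hn])
  assume i: "i < n"
  show "0 \<le> h i e" for e by (rule h_nonneg)
  show "h i e \<le> H n e" for e unfolding H_def using i h_nonneg by (intro member_le_sum) auto
qed

lemma H_Suc: "H (Suc k) e = H k e + h k e"
  by (simp add: H_def)

text \<open>
  The contributions of a pair to the number of places broken in the product: places broken in a
  factor, and places whose later step is covered by an earlier factor.
\<close>

definition broken :: "nat \<Rightarrow> nat" where
  "broken P = (\<Sum>i<n. of_bool (P \<in> core (h i) (s i) (s (Suc i))) +
     (\<Sum>a \<in> fibre Z P. of_bool (H i a = 1 \<and> h i (step_to a) = 1)))"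

text \<open>\<open>prefix_products\<close> in the fragment. A nonzero local product has no crossings
  and is tight or twisted according to occupation. A zero one is critical, because \<open>ok\<close>
  provides a diagram with the local data and so rules out the singular alternative of
  \<open>zero_state\<close>; the other alternative adds exactly 1 to the count.\<close>

lemma pair_types:
  assumes P: "P \<in> pairs Z" and ok: "config_ok (H n) (s 0) (s n) {}"
  defines "K \<equiv> core (H n) (s 0) (s n)"
  shows "P \<in> twisted_pairs Z M \<longleftrightarrow> P \<in> K \<and> \<not> doubly Z (H n) P"
    "P \<notin> twisted_pairs Z M \<Longrightarrow> P \<notin> critical_pairs Z M \<Longrightarrow> P \<in> tight_pairs Z M"
    "P \<in> critical_pairs Z M \<or> P \<in> tight_pairs Z M \<Longrightarrow> P \<notin> twisted_pairs Z M"
    "broken P = of_bool (P \<in> K) + of_bool (P \<in> critical_pairs Z M)"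
proof -
  let ?f = "fragment Z P"
  interpret vd: viable_data Z "H n" "s 0" "s n" by unfold_locales (use viable_Hn ok in auto)
  interpret f: viable_data ?f "loc Z P (H n)" "s 0 \<inter> {P}" "s n \<inter> {P}"
    by (rule vd.fragment_viable_data[OF P])
  define L where "L i = rep ?f (hclass ?f (local_diag Z P (D i)))" for i
  have L: "L i \<in> diagrams ?f" "\<not> has_crossing (L i)"
    "hdata_of ?f (L i) = (loc Z P (h i), s i \<inter> {P}, s (Suc i) \<inter> {P})" "viable01 ?f (loc Z P (h i))"
    if "i < n" for i
    using local_rep[OF D_props(1)[OF that] _ D_props(2,4)[OF that] P] viable_h[OF that] src_tgt[OF that]
    unfolding L_def h_def by auto
  let ?M = "local_tensor Z P M"
  have lM: "length ?M = n" by (simp add: local_tensor_def)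
  have repM: "rep ?f (?M ! i) = L i" if "i < n" for i using that by (simp add: local_tensor_def L_def D_def)
  have Lm: "map (rep ?f) ?M = map L [0..<n]" by (rule nth_equalityI) (use lM repM in auto)
  have thg: "tensor_hgr ?f ?M = loc Z P (H n)"
  proof
    fix e
    have "tensor_hgr ?f ?M e = (\<Sum>i<n. hgrading (rep ?f (?M ! i)) e)"
      unfolding tensor_hgr_def using lM by (simp add: sum_list_sum_nth atLeast0LessThan)
    also have "\<dots> = (\<Sum>i<n. loc Z P (h i) e)"
      using repM L(3) by (intro sum.cong) (auto simp: hdata_of_def)
    finally show "tensor_hgr ?f ?M e = loc Z P (H n) e" unfolding H_def loc_sum .
  qed
  have Mne: "?M \<noteq> []" using lM n_pos by auto
  have thd: "tensor_hdata ?f ?M = (loc Z P (H n), s 0 \<inter> {P}, s n \<inter> {P})"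
    unfolding tensor_hdata_def thg using Mne lM n_pos repM[of 0] repM[of "n - 1"] L(3)[of 0] L(3)[of "n - 1"]
    by (simp add: hd_conv_nth last_conv_nth hdata_of_def)
  have viaM: "viable_tensor ?f ?M"
    unfolding viable_tensor_def
  proof
    show "\<not> mismatch ?f ?M"
      unfolding mismatch_def lM using repM L(3) by (auto simp: hdata_of_def)
    show "viable_hgr ?f (tensor_hgr ?f ?M)"
      unfolding thg using f.viable unfolding viable_hgr_def viable01_def by blast
  qed
  obtain a where a: "a \<in> fibre Z P" using fibre_ex[OF P] by blast
  then have ap: "a \<in> places Z" "lab Z a = P" by (auto simp: fibre_def)
  have fib: "fibre Z P = {a, twin Z a}" and tw: "twin Z a \<in> fibre Z P" "twin Z a \<noteq> a"
    using fibre_twin[OF ap(1)] ap(2) by auto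
  have af: "(a, 1) \<in> places ?f" unfolding places_fragment using a by blast
  have tf: "twin ?f (a, 1) = (twin Z a, 1)" by (rule twin_fragment[OF P a])
  have locH: "loc Z P (H k) x = (\<Sum>i<k. loc Z P (h i) x)" for k x unfolding H_def loc_sum ..
  have tight: "loc Z P (h i) (a, 1) = 1 \<and> loc Z P (h i) (twin ?f (a, 1)) = 1"
    if i: "i < n" and Pi: "P \<in> f.core (loc Z P (h i)) (s i \<inter> {P}) (s (Suc i) \<inter> {P})" for i
  proof -
    have v: "viable01 Z (hgrading (D i))" using viable_h[OF i] unfolding h_def .
    obtain B where vi: "viable_data Z (hgrading (D i)) (src Z (D i)) (tgt Z (D i))"
      and dbl: "viable_data.doubled Z (hgrading (D i)) (src Z (D i)) (tgt Z (D i))"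
      by (rule generator_tight[OF D_props(1)[OF i] v D_props(2,4)[OF i]])
    have "P \<in> core (h i) (s i) (s (Suc i))" using Pi unfolding core_fragment[OF P] by blast
    then have "doubly Z (h i) P"
      using viable_data.doubled_iff[OF vi] dbl src_tgt[OF i] unfolding h_def by simp
    then show ?thesis unfolding tf doubly_def using a tw(1) by (simp add: loc_at)
  qed
  define E where "E = alg_prod (map L [0..<n])"
  define c where "c = (\<Sum>i<n. of_bool (P \<in> f.core (loc Z P (h i)) (s i \<inter> {P}) (s (Suc i) \<inter> {P})) +
      of_bool (loc Z P (H i) (a, 1) = 1 \<and> loc Z P (h i) (step_to (a, 1)) = 1) +
      of_bool (loc Z P (H i) (twin ?f (a, 1)) = 1 \<and> loc Z P (h i) (step_to (twin ?f (a, 1))) = 1) :: nat)"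
  have pp: "(E \<in> diagrams ?f \<and> \<not> has_crossing E \<and> hdata_of ?f E = (loc Z P (H n), s 0 \<inter> {P}, s n \<inter> {P}) \<and>
      c = of_bool (P \<in> f.core (loc Z P (H n)) (s 0 \<inter> {P}) (s n \<inter> {P}))) \<or>
    (E = 0 \<and> zero_state (loc Z P (H n) (step_to (a, 1)) = 1) (loc Z P (H n) (a, 1) = 1)
      (loc Z P (H n) (step_to (twin ?f (a, 1))) = 1) (loc Z P (H n) (twin ?f (a, 1)) = 1)
      (P \<in> s 0 \<inter> {P}) (P \<in> s n \<inter> {P}) c)"
    unfolding E_def c_def locH
  proof (rule f.prefix_products[where n = n])
    show "viable01 ?f (\<lambda>e. \<Sum>i<n. loc Z P (h i) e)" using f.viable unfolding H_def loc_sum .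
    show "pairs ?f = {P}" by (rule pairs_fragment[OF P])
    show "1 \<le> n" using n_pos by linarith
  qed (use af L tight n_pos in auto)
  have cb: "c = broken P"
    unfolding c_def broken_def core_fragment[OF P] tf
    by (intro sum.cong) (use a tw in \<open>simp_all add: fib loc_at\<close>)
  have rp: "rep_prod ?f ?M = E" unfolding rep_prod_def Lm E_def ..
  have Kf: "P \<in> f.K \<longleftrightarrow> P \<in> K" unfolding core_fragment[OF P] K_def by blast
  have dbl: "f.doubled \<longleftrightarrow> (P \<in> K \<longrightarrow> doubly Z (H n) P)" unfolding K_def by (rule vd.fragment_doubled[OF P])
  have tt: "P \<in> tight_pairs Z M \<longleftrightarrow> E \<noteq> 0 \<and> tight_diag ?f E" "P \<in> twisted_pairs Z M \<longleftrightarrow> E \<noteq> 0 \<and> twisted_diag ?f E"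
    "P \<in> critical_pairs Z M \<longleftrightarrow> E = 0 \<and> alg_summand ?f (loc Z P (H n), s 0 \<inter> {P}, s n \<inter> {P}) \<noteq> {0}"
    unfolding tight_pairs_def twisted_pairs_def critical_pairs_def tight_tensor_def twisted_tensor_def critical_tensor_def rp thd mem_Collect_eq
    using P viaM by blast+
  have all: "(P \<in> twisted_pairs Z M \<longleftrightarrow> P \<in> K \<and> \<not> doubly Z (H n) P) \<and>
    (P \<notin> twisted_pairs Z M \<longrightarrow> P \<notin> critical_pairs Z M \<longrightarrow> P \<in> tight_pairs Z M) \<and>
    (P \<in> critical_pairs Z M \<or> P \<in> tight_pairs Z M \<longrightarrow> P \<notin> twisted_pairs Z M) \<and>
    broken P = of_bool (P \<in> K) + of_bool (P \<in> critical_pairs Z M)"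
  proof (cases "E = 0")
    case False
    then have E: "E \<in> diagrams ?f" "\<not> has_crossing E" "hdata_of ?f E = (loc Z P (H n), s 0 \<inter> {P}, s n \<inter> {P})"
      "c = of_bool (P \<in> f.K)" using pp by blast+
    obtain B where B: "B \<in> f.configs" "E = f.Dg (loc Z P (H n)) (s 0 \<inter> {P}) (s n \<inter> {P}) B"
      by (rule f.diagram_with_data[OF E(1,3)])
    have "lab ?f ` B = f.K" using f.has_crossing_Dg[OF B(1)] E(2) B(2) by blast
    then have ty: "tight_diag ?f E \<longleftrightarrow> f.doubled" "twisted_diag ?f E \<longleftrightarrow> \<not> f.doubled"
      unfolding B(2) using f.Dg_types[OF B(1)] by blast+
    show ?thesis unfolding tt ty dbl using False E(4) cb Kf by auto
  next
    case True
    then have "E \<notin> diagrams ?f" unfolding diagrams_def by auto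
    then have z: "zero_state (loc Z P (H n) (step_to (a, 1)) = 1) (loc Z P (H n) (a, 1) = 1)
      (loc Z P (H n) (step_to (twin ?f (a, 1))) = 1) (loc Z P (H n) (twin ?f (a, 1)) = 1)
      (P \<in> s 0 \<inter> {P}) (P \<in> s n \<inter> {P}) c" using pp by blast
    have z': "zero_state (H n (step_to a) = 1) (H n a = 1) (H n (step_to (twin Z a)) = 1) (H n (twin Z a) = 1)
      (P \<in> s 0) (P \<in> s n) c" using z unfolding tf by (simp add: loc_at[OF a] loc_at[OF tw(1)])
    have lo: "local_ok (H n (step_to a) = 1) (H n a = 1) (H n (step_to (twin Z a)) = 1) (H n (twin Z a) = 1)
      False False (P \<in> s 0) (P \<in> s n)" using ok ap unfolding config_ok_def by auto
    note cl = core_local[OF viable_Hn ap(1), unfolded ap(2), of "s 0" "s n", folded K_def]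
    have c1: "c = of_bool (P \<in> K) + 1" and three: "H n (step_to a) = 1 \<and> H n a = 1 \<and> (H n (step_to (twin Z a)) = 1 \<or> H n (twin Z a) = 1) \<or>
        H n (step_to (twin Z a)) = 1 \<and> H n (twin Z a) = 1 \<and> (H n (step_to a) = 1 \<or> H n a = 1)"
      using z' lo unfolding zero_state_def cl by simp_all
    \<comment> \<open>At a core pair each place has both steps covered or neither, so three covered
      steps force four. A critical pair is therefore never once occupied in the core.\<close>
    have "doubly Z (H n) P" if "P \<in> K"
      using that three unfolding cl local_core_def doubly_def fib by blast
    moreover have "alg_summand ?f (loc Z P (H n), s 0 \<inter> {P}, s n \<inter> {P}) \<noteq> {0}"
    proof -
      have e: "{} \<in> f.configs" unfolding f.configs_def by simp
      have "f.Dg (loc Z P (H n)) (s 0 \<inter> {P}) (s n \<inter> {P}) {} \<in> alg_summand ?f (loc Z P (H n), s 0 \<inter> {P}, s n \<inter> {P})"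
        unfolding alg_summand_def by (rule lin_span_base) (use f.Dg_configs[OF e] in simp)
      then show ?thesis using f.Dg_configs(7)[OF e] by blast
    qed
    ultimately show ?thesis unfolding tt using True c1 cb by auto
  qed
  from all show "P \<in> twisted_pairs Z M \<longleftrightarrow> P \<in> K \<and> \<not> doubly Z (H n) P"
    "P \<notin> twisted_pairs Z M \<Longrightarrow> P \<notin> critical_pairs Z M \<Longrightarrow> P \<in> tight_pairs Z M"
    "P \<in> critical_pairs Z M \<or> P \<in> tight_pairs Z M \<Longrightarrow> P \<notin> twisted_pairs Z M"
    "broken P = of_bool (P \<in> K) + of_bool (P \<in> critical_pairs Z M)"
    by blast+
qed

end

section \<open>The Maslov grading\<close>

context pre_arc_diagram
begin

definition starts :: "'i hgr \<Rightarrow> 'i pt set" where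
  "starts h = {a \<in> places Z. h (step_to a) = 0 \<and> h a = 1}"

lemma sum_of_bool_places: "(\<Sum>p\<in>places Z. of_bool (p \<in> A \<and> Q p)) = (of_nat (card {p \<in> A \<inter> places Z. Q p}) :: rat)"
  by (subst sum_of_bool_eq) (auto intro!: arg_cong[of _ _ card])

text \<open>A horizontal strand at a covered place adds one crossing and average multiplicity 1, so
  it contributes nothing. What remains is 1 for each broken place and one half for each place at
  which the covering begins, independently of the chosen term.\<close>

lemma sd_maslov_term:
  assumes h: "viable01 Z h" and B: "B \<subseteq> full Z h" and U: "U \<in> hset Z s t (strands h B)"
  shows "sd_maslov Z (strands h B \<union> Id_on U) = - of_nat (card B) - of_nat (card (starts h)) / 2"
proof -
  let ?\<kappa> = "strands h B \<union> Id_on U"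
  have d: "U \<inter> Domain (strands h B) = {}" "U \<inter> Range (strands h B) = {}" using U by (auto simp: hset_def)
  have hg: "sd_hgr ?\<kappa> = h" by (simp add: sd_hgr_add_Id sd_hgr_strands[OF h])
  have Dm: "Domain ?\<kappa> = Domain (strands h B) \<union> U" by (simp add: Domain_Un_eq)
  have pt: "of_int (if p \<in> Domain ?\<kappa> then 1 else 0) * (of_int (h (step_to p)) + of_int (h p)) / 2 =
      (of_bool (p \<in> B \<and> True) + of_bool (p \<in> starts h \<and> True) / 2 + of_bool (p \<in> U \<and> h p = 1) :: rat)" if p: "p \<in> places Z" for p
  proof -
    have u: "h (step_to p) = 0 \<or> h (step_to p) = 1" "h p = 0 \<or> h p = 1" using viable01D(1)[OF h] by blast+
    note DR = Domain_places[OF h B p]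
    have BB: "p \<in> B \<Longrightarrow> h p = 1 \<and> h (step_to p) = 1" using B full_places by blast
    have UU: "p \<in> U \<Longrightarrow> \<not> (h p = 1 \<and> (h (step_to p) = 1 \<longrightarrow> p \<in> B)) \<and> \<not> (h (step_to p) = 1 \<and> (h p = 1 \<longrightarrow> p \<in> B))"
      using d DR by blast
    have st: "p \<in> starts h \<longleftrightarrow> h (step_to p) = 0 \<and> h p = 1" using p by (simp add: starts_def)
    show ?thesis
      unfolding Dm Un_iff DR st using u BB UU by (cases "p \<in> B"; cases "p \<in> U"; elim disjE) auto
  qed
  have "avg_mult Z h (\<lambda>p. if p \<in> Domain ?\<kappa> then 1 else 0) =
      (\<Sum>p\<in>places Z. of_bool (p \<in> B \<and> True) + of_bool (p \<in> starts h \<and> True) / 2 + of_bool (p \<in> U \<and> h p = 1))"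
    unfolding avg_mult_def using pt by (rule sum.cong[OF refl])
  also have "\<dots> = of_nat (card {p \<in> B \<inter> places Z. True}) + of_nat (card {p \<in> starts h \<inter> places Z. True}) / 2 +
      of_nat (card {p \<in> U \<inter> places Z. h p = 1})"
    unfolding sum.distrib sum_divide_distrib[symmetric] sum_of_bool_places ..
  also have "{p \<in> B \<inter> places Z. True} = B" using B full_places by blast
  also have "{p \<in> starts h \<inter> places Z. True} = starts h" unfolding starts_def by blast
  also have "{p \<in> U \<inter> places Z. h p = 1} = {p \<in> U. h p = 1}"
    using covered_horizontal[OF h, of _ B] d full_places(1) by blast
  finally show ?thesis
    unfolding sd_maslov_def hg inv_count_term[OF h d(1)] by simp
qed

end

context viable_data
begin

lemma maslov_Dg_term:
  assumes B: "B \<in> configs" and \<kappa>: "\<kappa> \<in> terms (Dg h s t B)"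
  shows "sd_maslov Z \<kappa> = - of_nat (card B) - of_nat (card (starts h)) / 2"
  using \<kappa> sd_maslov_term[OF viable configsD(3)[OF B]] unfolding Dg_def terms_diag[OF moving_strands[OF viable]] by blast

lemma homogeneous_realize:
  assumes v: "Poly_Mapping.keys v \<subseteq> configs" and hom: "homogeneous Z d (realize v)" and B: "B \<in> Poly_Mapping.keys v"
  shows "- of_nat (card B) - of_nat (card (starts h)) / 2 = d"
proof -
  have Bc: "B \<in> configs" using v B by blast
  obtain \<kappa> where \<kappa>: "\<kappa> \<in> terms (Dg h s t B)" using Dg_configs(7)[OF Bc] by (metis ex_in_conv keys_eq_empty)
  then have "\<kappa> \<in> terms (realize v)" unfolding terms_realize[OF v] using B by blast
  then show ?thesis using hom maslov_Dg_term[OF Bc \<kappa>] unfolding homogeneous_def by simp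
qed

lemma card_config: "B \<in> configs \<Longrightarrow> card (lab Z ` B) = card B" "B \<in> configs \<Longrightarrow> lab Z ` B \<subseteq> K"
  using card_image[OF configsD(2)] configsD(1) F_core by blast+

end

context tensor
begin

text \<open>Generators have no crossings, so every core pair is broken exactly once.\<close>

lemma maslov_D:
  assumes i: "i < n"
  shows "maslov Z (D i) = - of_nat (card (core (h i) (s i) (s (Suc i)))) - of_nat (card (starts (h i))) / 2"
proof -
  have v: "viable01 Z (hgrading (D i))" using viable_h[OF i] unfolding h_def .
  obtain B where vi: "viable_data Z (hgrading (D i)) (src Z (D i)) (tgt Z (D i))"
    and B: "B \<in> viable_data.configs Z (hgrading (D i)) (src Z (D i)) (tgt Z (D i))"
    "D i = Dg (hgrading (D i)) (src Z (D i)) (tgt Z (D i)) B" "lab Z ` B = core (hgrading (D i)) (src Z (D i)) (tgt Z (D i))"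
    by (rule generator_tight[OF D_props(1)[OF i] v D_props(2,4)[OF i]])
  note e = h_def[symmetric] src_tgt[OF i]
  interpret vd: viable_data Z "h i" "s i" "s (Suc i)" using vi unfolding e .
  have "some_term (D i) \<in> terms (D i)" using some_term_in vd.Dg_configs(7) B(1,2) unfolding e by metis
  then have "sd_maslov Z (some_term (D i)) = - of_nat (card B) - of_nat (card (starts (h i))) / 2"
    using vd.maslov_Dg_term B(1,2) unfolding e by metis
  moreover have "card B = card (core (h i) (s i) (s (Suc i)))" using vd.card_config(1) B(1,3) unfolding e by metis
  ultimately show ?thesis unfolding maslov_def by simp
qed

lemma avg_mult_sum: "(\<Sum>j\<in>J. avg_mult Z g (c j)) = avg_mult Z g (\<lambda>p. \<Sum>j\<in>J. c j p)"
  unfolding avg_mult_def by (subst sum.swap) (simp add: sum_distrib_right sum_divide_distrib)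

lemma chain_bd_sum: "(\<lambda>p. \<Sum>j<k. chain_bd (h j) p) = chain_bd (H k)"
  unfolding chain_bd_def H_def by (simp add: sum_subtractf)

definition late :: "nat \<Rightarrow> nat" where
  "late i = (\<Sum>p\<in>places Z. of_bool (H i p = 1 \<and> h i (step_to p) = 1))"

text \<open>The halves contributed by the beginnings of \<open>h k\<close> turn, together with the
  cross term, into a difference for the accumulated grading \<open>H\<close>, up to the late places.
  The identity holds at each place separately, where disjointness leaves nine cases for the two
  steps.\<close>

lemma maslov_step:
  assumes k: "k < n"
  shows "avg_mult Z (h k) (chain_bd (H k)) - of_nat (card (starts (h k))) / 2 =
    of_nat (card (starts (H k))) / 2 - of_nat (card (starts (H (Suc k)))) / 2 - of_nat (late k)"
proof -
  have st: "of_nat (card (starts g)) = (\<Sum>p\<in>places Z. of_bool (g (step_to p) = 0 \<and> g p = 1) :: rat)" for g :: "'i hgr"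
    unfolding starts_def by (subst sum_of_bool_eq) (auto intro!: arg_cong[of _ _ card])
  have "of_int (chain_bd (H k) p) * (of_int (h k (step_to p)) + of_int (h k p)) / 2 - of_bool (h k (step_to p) = 0 \<and> h k p = 1) / 2 =
      of_bool (H k (step_to p) = 0 \<and> H k p = 1) / 2 - of_bool (H (Suc k) (step_to p) = 0 \<and> H (Suc k) p = 1) / 2 -
      (of_bool (H k p = 1 \<and> h k (step_to p) = 1) :: rat)" for p
  proof -
    have v: "viable01 Z (H k)" "viable01 Z (H (Suc k))" "viable01 Z (h k)" using viable_H viable_h k by auto
    have x: "H k q = 0 \<and> h k q = 0 \<or> H k q = 1 \<and> h k q = 0 \<or> H k q = 0 \<and> h k q = 1" for q
    proof -
      have "H k q = 0 \<or> H k q = 1" "h k q = 0 \<or> h k q = 1" "H k q + h k q = 0 \<or> H k q + h k q = 1"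
        using viable01D(1) v H_Suc[of k q] by metis+
      then show ?thesis by linarith
    qed
    show ?thesis
      unfolding chain_bd_def H_Suc using x[of p] x[of "step_to p"] by (elim disjE conjE) simp_all
  qed
  then have "(\<Sum>p\<in>places Z. of_int (chain_bd (H k) p) * (of_int (h k (step_to p)) + of_int (h k p)) / 2 - of_bool (h k (step_to p) = 0 \<and> h k p = 1) / 2) =
      (\<Sum>p\<in>places Z. of_bool (H k (step_to p) = 0 \<and> H k p = 1) / 2 - of_bool (H (Suc k) (step_to p) = 0 \<and> H (Suc k) p = 1) / 2 -
      (of_bool (H k p = 1 \<and> h k (step_to p) = 1) :: rat))"
    by (intro sum.cong refl)
  then show ?thesis
    unfolding st avg_mult_def late_def by (simp only: sum_subtractf sum_divide_distrib of_nat_sum of_nat_of_bool)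
qed

lemma finite_pairs: "finite (pairs Z)"
  unfolding pairs_def by simp

text \<open>The same places counted in two orders: each place lies over exactly one pair, so the sum
  over pairs and fibres is a sum over places.\<close>

lemma sum_broken: "(\<Sum>P\<in>pairs Z. broken P) = (\<Sum>i<n. card (core (h i) (s i) (s (Suc i))) + late i)"
proof -
  have c: "(\<Sum>P\<in>pairs Z. of_bool (P \<in> core (h i) (s i) (s (Suc i)))) = card (core (h i) (s i) (s (Suc i)))" for i
  proof -
    have "pairs Z \<inter> core (h i) (s i) (s (Suc i)) = core (h i) (s i) (s (Suc i))" unfolding core_def by blast
    then show ?thesis using finite_pairs by (simp add: sum_of_bool_eq)
  qed
  have l: "(\<Sum>P\<in>pairs Z. \<Sum>a\<in>fibre Z P. of_bool (H i a = 1 \<and> h i (step_to a) = 1)) = late i" for i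
    unfolding late_def fibre_def by (rule sum.group) (auto simp: finite_pairs pairs_def)
  show ?thesis
    unfolding broken_def by (subst sum.swap) (simp add: sum.distrib c l)
qed

text \<open>The cross terms are additive in the boundary, so the sum over earlier factors is a
  single cross term with \<open>H k\<close>; then \<open>maslov_step\<close> telescopes from the
  empty grading.\<close>

lemma tensor_maslov_eq:
  "tensor_maslov Z M = - of_nat (card (starts (H n))) / 2 - of_nat (\<Sum>P\<in>pairs Z. broken P)"
proof -
  have "(\<Sum>i<k. maslov Z (D i) + avg_mult Z (h i) (chain_bd (H i))) =
      - of_nat (card (starts (H k))) / 2 - of_nat (\<Sum>i<k. card (core (h i) (s i) (s (Suc i))) + late i)" if "k \<le> n" for k
    using that
  proof (induction k)
    case 0
    have "starts (H 0) = {}" unfolding starts_def H_def by simp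
    then show ?case by simp
  next
    case (Suc k)
    then have k: "k < n" by simp
    have "maslov Z (D k) + avg_mult Z (h k) (chain_bd (H k)) =
        of_nat (card (starts (H k))) / 2 - of_nat (card (starts (H (Suc k)))) / 2 - of_nat (late k) - of_nat (card (core (h k) (s k) (s (Suc k))))"
      using maslov_D[OF k] maslov_step[OF k] by linarith
    then show ?case using Suc.IH k by simp
  qed
  from this[of n] have "(\<Sum>i<n. maslov Z (D i) + avg_mult Z (h i) (chain_bd (H i))) =
      - of_nat (card (starts (H n))) / 2 - of_nat (\<Sum>P\<in>pairs Z. broken P)" unfolding sum_broken by simp
  moreover have "tensor_maslov Z M = (\<Sum>i<n. maslov Z (D i) + avg_mult Z (h i) (chain_bd (H i)))"
  proof -
    have "(\<Sum>C\<leftarrow>M. maslov Z (rep Z C)) = (\<Sum>i<n. maslov Z (D i))"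
      unfolding D_def by (simp add: sum_list_sum_nth atLeast0LessThan)
    moreover have "(\<Sum>j<k. avg_mult Z (hgrading (rep Z (M ! k))) (chain_bd (hgrading (rep Z (M ! j))))) = avg_mult Z (h k) (chain_bd (H k))" for k
      unfolding chain_bd_sum[symmetric] avg_mult_sum[symmetric] h_def D_def ..
    ultimately show ?thesis unfolding tensor_maslov_def by (simp add: sum.distrib)
  qed
  ultimately show ?thesis by simp
qed

text \<open>A diagram without crossings has one break for each core pair, so the critical pairs are
  the exact defect of the grading of \<open>M\<close> against it.\<close>

lemma tensor_maslov_critical:
  assumes "config_ok (H n) (s 0) (s n) {}"
  shows "tensor_maslov Z M = - of_nat (card (starts (H n))) / 2 - of_nat (card (core (H n) (s 0) (s n))) - of_nat (card (critical_pairs Z M))"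
proof -
  have sub: "pairs Z \<inter> core (H n) (s 0) (s n) = core (H n) (s 0) (s n)" "pairs Z \<inter> critical_pairs Z M = critical_pairs Z M"
    unfolding core_def critical_pairs_def by blast+
  have "(\<Sum>P\<in>pairs Z. broken P) = (\<Sum>P\<in>pairs Z. of_bool (P \<in> core (H n) (s 0) (s n)) + of_bool (P \<in> critical_pairs Z M))"
    using pair_types(4)[OF _ assms] by (intro sum.cong) auto
  also have "\<dots> = card (core (H n) (s 0) (s n)) + card (critical_pairs Z M)"
    using finite_pairs sub by (simp add: sum.distrib sum_of_bool_eq)
  finally show ?thesis unfolding tensor_maslov_eq by simp
qed

text \<open>A nonzero value is a sum of at least one diagram with the H-data of \<open>M\<close>;
  this is how singular pairs are excluded.\<close>

lemma summand_config_ok: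
  assumes x: "x \<in> alg_summand Z (tensor_hdata Z M)" and ne: "x \<noteq> 0"
  shows "config_ok (H n) (s 0) (s n) {}"
proof -
  obtain G where G: "G \<subseteq> {D \<in> diagrams Z. hdata_of Z D = (H n, s 0, s n)}" "x = (\<Sum>D\<in>G. D)"
    using x unfolding alg_summand_def lin_span_def tensor_hdata_eq by blast
  then have "G \<noteq> {}" using ne by auto
  then obtain E where "E \<in> diagrams Z" "hdata_of Z E = (H n, s 0, s n)" using G(1) by blast
  then have E: "E \<in> diagrams Z" "hgrading E = H n" "src Z E = s 0" "tgt Z E = s n" by (auto simp: hdata_of_def)
  then have "viable01 Z (hgrading E)" using viable_Hn by simp
  from diagram_viable_data(1)[OF E(1) this] show ?thesis
    unfolding E(2-4) viable_data_def viable_data_axioms_def by blast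
qed

section \<open>Values of the operations\<close>

text \<open>Since both gradings are known, the degree fixes the number of breaks and hence of
  crossed pairs in every diagram of \<open>x\<close>. The hypothesis \<open>cyc\<close> is the only
  input on \<open>x\<close> beyond its data and degree; it settles the bound on
  \<open>m\<close>.\<close>

lemma morphism_value:
  assumes x: "x \<in> alg_summand Z (tensor_hdata Z M)" and hom: "homogeneous Z (tensor_maslov Z M + of_nat n - 1) x"
    and cyc: "\<partial> x = 0 \<Longrightarrow> x = 0" and ne: "bar Z x \<noteq> bar Z 0" and n2: "n \<ge> 2"
  defines "l \<equiv> card (twisted_pairs Z M)" and "m \<equiv> card (critical_pairs Z M)"
  shows "l + m \<ge> n - 1 \<and> m \<le> n - 2 \<and>
    pairs Z - (twisted_pairs Z M \<union> critical_pairs Z M) \<subseteq> tight_pairs Z M \<and>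
    (\<exists>\<D>. finite \<D> \<and> \<D> \<subseteq> {D. viable_diag Z D} \<and> bar Z x = bar Z (\<Sum>D \<in> \<D>. D) \<and>
       (\<forall>D \<in> \<D>. (\<forall>P \<in> critical_pairs Z M \<union> tight_pairs Z M. tight_at Z P D) \<and>
          card {P \<in> pairs Z. crossed_at Z P D} = n - 1 - m \<and>
          card {P \<in> pairs Z. twisted_at Z P D} = l + m + 1 - n))"
proof -
  have x0: "x \<noteq> 0" using ne by auto
  have ok: "config_ok (H n) (s 0) (s n) {}" by (rule summand_config_ok[OF x x0])
  interpret vd: viable_data Z "H n" "s 0" "s n" by unfold_locales (use viable_Hn ok in auto)
  let ?K = "core (H n) (s 0) (s n)"
  have KP: "?K \<subseteq> pairs Z" unfolding core_def by blast
  note pt = pair_types[OF _ ok]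
  have tw: "twisted_pairs Z M = {P \<in> ?K. \<not> doubly Z (H n) P}"
    using pt(1) KP unfolding twisted_pairs_def by blast
  have subP: "critical_pairs Z M \<subseteq> pairs Z" "tight_pairs Z M \<subseteq> pairs Z" unfolding critical_pairs_def tight_pairs_def by blast+
  obtain v where v: "Poly_Mapping.keys v \<subseteq> vd.configs" "x = vd.realize v"
    using x unfolding tensor_hdata_eq vd.alg_summand_iff by blast
  \<comment> \<open>Stated additively, because a difference of natural numbers would truncate before
    \<open>m\<close> is known to be at most \<open>n - 1\<close>.\<close>
  have cardB: "card ?K + m + 1 = card B + n" if "B \<in> Poly_Mapping.keys v" for B
  proof -
    have "- of_nat (card B) - of_nat (card (starts (H n))) / 2 = tensor_maslov Z M + of_nat n - (1 :: rat)"
      by (rule vd.homogeneous_realize[OF v(1) _ that]) (use hom v(2) in simp)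
    then have "(of_nat (card ?K + m + 1) :: rat) = of_nat (card B + n)"
      unfolding tensor_maslov_critical[OF ok] m_def by simp
    then show ?thesis by (simp only: of_nat_eq_iff)
  qed
  have BK: "card (?K - lab Z ` B) + card B = card ?K" if "B \<in> vd.configs" for B
    using vd.card_config[OF that] card_Diff_subset[of "lab Z ` B" ?K] card_mono[of ?K "lab Z ` B"] finite_subset[OF vd.card_config(2)[OF that]]
    by simp
  have crossed: "card (?K - lab Z ` B) = n - 1 - m \<and> m + 1 \<le> n" if "B \<in> Poly_Mapping.keys v" for B
  proof -
    have "B \<in> vd.configs" using that v(1) by blast
    from BK[OF this] cardB[OF that] n2 show ?thesis by linarith
  qed
  have v0: "v \<noteq> 0" using x0 v(2) by (auto simp: vd.realize_def)
  then obtain B1 where B1: "B1 \<in> Poly_Mapping.keys v" by (metis ex_in_conv keys_eq_empty)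
  \<comment> \<open>For a larger \<open>m\<close> no crossed pairs are left, so every diagram of
    \<open>x\<close> is a cycle and \<open>cyc\<close> makes \<open>x\<close> zero.\<close>
  have m2: "m \<le> n - 2"
  proof (rule ccontr)
    assume "\<not> m \<le> n - 2"
    then have mn: "n - 1 - m = 0" using crossed[OF B1] by simp
    have "\<partial> x = lext (\<lambda>B. \<partial> (Dg (H n) (s 0) (s n) B)) v"
      unfolding v(2) vd.realize_def diff_lext lext_lext ..
    also have "\<dots> = lext (\<lambda>B. 0) v"
    proof (rule lext_cong)
      fix B assume B: "B \<in> Poly_Mapping.keys v"
      then have Bc: "B \<in> vd.configs" using v(1) by blast
      have "?K - lab Z ` B = {}" using crossed[OF B] mn by (simp add: card_eq_0_iff)
      then have "lab Z ` B = ?K" using vd.card_config(2)[OF Bc] by blast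
      then show "\<partial> (Dg (H n) (s 0) (s n) B) = 0" using vd.Dg_cycle_iff[OF Bc] by blast
    qed
    finally have "\<partial> x = 0" by (simp add: lext_def)
    then show False using cyc x0 by blast
  qed
  \<comment> \<open>The diagrams crossed only at twisted pairs of \<open>M\<close>. Any other one is
    crossed at a core pair that is not twisted in \<open>M\<close>, hence doubly occupied, and lies
    in the ideal.\<close>
  define G where "G = {B \<in> Poly_Mapping.keys v. ?K - lab Z ` B \<subseteq> twisted_pairs Z M}"
  let ?R = "Poly_Mapping.keys v - G"
  let ?Dg = "Dg (H n) (s 0) (s n)"
  have Gk: "G \<subseteq> Poly_Mapping.keys v" "finite G" unfolding G_def by auto
  have Gc: "G \<subseteq> vd.configs" using Gk(1) v(1) by blast
  have inj: "inj_on ?Dg G" using vd.Dg_inj Gc by (intro inj_onI) blast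
  have "x = (\<Sum>B\<in>Poly_Mapping.keys v. ?Dg B)" unfolding v(2) vd.realize_def lext_def ..
  also have "\<dots> = (\<Sum>B\<in>?R. ?Dg B) + (\<Sum>B\<in>G. ?Dg B)" by (rule sum.subset_diff[OF Gk(1)]) simp
  also have "(\<Sum>B\<in>G. ?Dg B) = (\<Sum>D \<in> ?Dg ` G. D)" using sum.reindex[OF inj, of "\<lambda>D. D"] by simp
  finally have xs: "x = (\<Sum>B\<in>?R. ?Dg B) + (\<Sum>D \<in> ?Dg ` G. D)" .
  have "(\<Sum>B\<in>?R. ?Dg B) \<in> ideal_F Z"
    unfolding ideal_F_def
  proof (rule lin_span_sum, rule lin_span_base)
    fix B assume B: "B \<in> ?R"
    then have Bc: "B \<in> vd.configs" using v(1) by blast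
    obtain P where P: "P \<in> ?K - lab Z ` B" "P \<notin> twisted_pairs Z M" using B unfolding G_def by blast
    have d: "doubly Z (H n) P" using P tw by blast
    have PP: "P \<in> pairs Z" using P(1) KP by blast
    have "doubly_occupied Z (hgrading (?Dg B)) P"
      unfolding vd.Dg_configs(3)[OF Bc] doubly_occupied_def full_at_def
      using d P(1) unfolding doubly_def core_def by auto
    moreover have "crossed_at Z P (?Dg B)" using vd.Dg_types_at(1)[OF PP Bc] P(1) by blast
    ultimately show "?Dg B \<in> {D \<in> diagrams Z. \<not> viable_diag Z D \<or> (\<exists>P\<in>pairs Z. doubly_occupied Z (hgrading D) P \<and> crossed_at Z P D)}"
      using vd.Dg_configs(1)[OF Bc] PP by blast
  qed
  then have bar: "bar Z x = bar Z (\<Sum>D \<in> ?Dg ` G. D)"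
    unfolding bar_eq_iff xs by (simp add: add.assoc)
  have "G \<noteq> {}"
  proof
    assume "G = {}"
    then show False using bar ne by simp
  qed
  then obtain B0 where B0: "B0 \<in> G" by blast
  have ftw: "finite (twisted_pairs Z M)" unfolding tw by simp
  have "n - 1 - m \<le> l"
    using card_mono[OF ftw, of "?K - lab Z ` B0"] B0 crossed[of B0] unfolding G_def l_def by auto
  then have lm: "l + m \<ge> n - 1" by simp
  have D: "viable_diag Z (?Dg B) \<and> (\<forall>P \<in> critical_pairs Z M \<union> tight_pairs Z M. tight_at Z P (?Dg B)) \<and>
      card {P \<in> pairs Z. crossed_at Z P (?Dg B)} = n - 1 - m \<and> card {P \<in> pairs Z. twisted_at Z P (?Dg B)} = l + m + 1 - n"
    if B: "B \<in> G" for B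
  proof (intro conjI ballI)
    have Bc: "B \<in> vd.configs" and sub: "?K - lab Z ` B \<subseteq> twisted_pairs Z M" and Bk: "B \<in> Poly_Mapping.keys v"
      using B Gc unfolding G_def by auto
    note ty = vd.Dg_types_at[OF _ Bc]
    show "viable_diag Z (?Dg B)" by (rule vd.Dg_viable[OF Bc])
    show "tight_at Z P (?Dg B)" if P: "P \<in> critical_pairs Z M \<union> tight_pairs Z M" for P
    proof -
      have PP: "P \<in> pairs Z" using P subP by blast
      then have nt: "P \<notin> twisted_pairs Z M" using pt(3)[OF PP] P by blast
      then have "P \<in> ?K \<longrightarrow> P \<in> lab Z ` B \<and> doubly Z (H n) P" using sub tw by blast
      then show ?thesis using ty(3)[OF PP] by blast
    qed
    have "{P \<in> pairs Z. crossed_at Z P (?Dg B)} = ?K - lab Z ` B" using ty(1) KP by blast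
    then show "card {P \<in> pairs Z. crossed_at Z P (?Dg B)} = n - 1 - m" using crossed[OF Bk] by simp
    \<comment> \<open>The twisted pairs of \<open>M\<close> that are not crossed in the diagram are
      broken core pairs with one occupied place; subtracting the \<open>n - 1 - m\<close> crossed
      ones from \<open>l\<close> gives the count.\<close>
    have "{P \<in> pairs Z. twisted_at Z P (?Dg B)} = twisted_pairs Z M - (?K - lab Z ` B)"
      using ty(2) KP vd.card_config(2)[OF Bc] tw by blast
    then have "card {P \<in> pairs Z. twisted_at Z P (?Dg B)} = l - (n - 1 - m)"
      using card_Diff_subset[OF finite_subset[OF sub ftw] sub] crossed[OF Bk] unfolding l_def by simp
    then show "card {P \<in> pairs Z. twisted_at Z P (?Dg B)} = l + m + 1 - n" using lm m2 n2 by simp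
  qed
  have "finite (?Dg ` G)" "?Dg ` G \<subseteq> {D. viable_diag Z D}" using Gk(2) D by auto
  moreover have "\<forall>E \<in> ?Dg ` G. (\<forall>P \<in> critical_pairs Z M \<union> tight_pairs Z M. tight_at Z P E) \<and>
      card {P \<in> pairs Z. crossed_at Z P E} = n - 1 - m \<and> card {P \<in> pairs Z. twisted_at Z P E} = l + m + 1 - n"
    using D by blast
  moreover have "pairs Z - (twisted_pairs Z M \<union> critical_pairs Z M) \<subseteq> tight_pairs Z M" using pt(2) by blast
  ultimately show ?thesis using lm m2 bar by blast
qed

text \<open>A nonzero class exists only if all core pairs are doubly occupied, so no pair is
  twisted, and only in the degree of diagrams without crossings; comparison with the degree of
  \<open>c\<close> gives \<open>m = n - 2\<close>. Homology being one-dimensional there, every tight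
  diagram represents the same class.\<close>

lemma product_value:
  assumes c: "c \<in> alg_summand Z (tensor_hdata Z M)" "\<partial> c = 0" and hom: "homogeneous Z (tensor_maslov Z M + of_nat n - 2) c"
    and ne: "hclass Z c \<noteq> hclass Z 0" and n2: "n \<ge> 2"
  shows "card (critical_pairs Z M) = n - 2" "pairs Z - critical_pairs Z M \<subseteq> tight_pairs Z M"
    "{hclass Z D | D. tight_diag Z D \<and> hdata_of Z D = tensor_hdata Z M} = {hclass Z c}"
proof -
  let ?m = "card (critical_pairs Z M)"
  have c0: "c \<noteq> 0" using ne by auto
  have ok: "config_ok (H n) (s 0) (s n) {}" by (rule summand_config_ok[OF c(1) c0])
  interpret vd: viable_data Z "H n" "s 0" "s n" by unfold_locales (use viable_Hn ok in auto)
  let ?K = "core (H n) (s 0) (s n)" and ?Dg = "Dg (H n) (s 0) (s n)"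
  note pt = pair_types[OF _ ok]
  obtain v where v: "Poly_Mapping.keys v \<subseteq> vd.configs" "c = vd.realize v"
    using c(1) unfolding tensor_hdata_eq vd.alg_summand_iff by blast
  have cardB: "card ?K + ?m + 2 = card B + n" if "B \<in> Poly_Mapping.keys v" for B
  proof -
    have "- of_nat (card B) - of_nat (card (starts (H n))) / 2 = tensor_maslov Z M + of_nat n - (2 :: rat)"
      by (rule vd.homogeneous_realize[OF v(1) _ that]) (use hom v(2) in simp)
    then have "(of_nat (card ?K + ?m + 2) :: rat) = of_nat (card B + n)"
      unfolding tensor_maslov_critical[OF ok] by simp
    then show ?thesis by (simp only: of_nat_eq_iff)
  qed
  define r where "r = card ?K + ?m + 2 - n"
  have vr: "Poly_Mapping.keys v \<subseteq> {B \<in> vd.configs. card B = r}" using v(1) cardB unfolding r_def by fastforce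
  have cyc: "vd.chain_diff v = 0" using vd.cycle_iff[OF v(1)] c(2) v(2) by simp
  have nb: "\<not> (\<exists>w. Poly_Mapping.keys w \<subseteq> vd.configs \<and> v = vd.chain_diff w)"
    using ne hclass_eq_iff[of Z c 0] vd.boundary_iff[OF v(1)] v(2) by simp
  have dbl: vd.doubled
  proof (rule ccontr)
    assume "\<not> vd.doubled"
    from vd.once_occupied_acyclic[OF v(1) cyc this] nb show False by blast
  qed
  \<comment> \<open>An arbitrary choice of one place for each core pair; its image is a
    configuration without crossings, used as the reference generator.\<close>
  define g where "g P = (SOME a. a \<in> vd.F \<and> lab Z a = P)" for P
  have g: "g P \<in> vd.F \<and> lab Z (g P) = P" if "P \<in> ?K" for P
  proof -
    have "\<exists>a. a \<in> vd.F \<and> lab Z a = P" using that core_brk[of P "H n" "s 0" "s n"] by blast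
    from someI_ex[OF this] show ?thesis unfolding g_def .
  qed
  have gK: "g ` ?K \<in> vd.configs" "lab Z ` (g ` ?K) = ?K"
  proof -
    have "inj_on (lab Z) (g ` ?K)"
    proof (rule inj_onI)
      fix a b assume "a \<in> g ` ?K" "b \<in> g ` ?K" "lab Z a = lab Z b"
      then show "a = b" using g by (metis imageE)
    qed
    then show "g ` ?K \<in> vd.configs" unfolding vd.configs_def using g by blast
    show "lab Z ` (g ` ?K) = ?K" using g by force
  qed
  let ?S = "\<lambda>B. Poly_Mapping.single B (1::bit)"
  \<comment> \<open>Applied twice: to the chain of \<open>c\<close>, and to the single configuration
    of any tight diagram with the same H-data.\<close>
  have gen: "hclass Z (vd.realize w) = hclass Z (?Dg (g ` ?K)) \<and> q = card ?K"
    if w: "Poly_Mapping.keys w \<subseteq> {B \<in> vd.configs. card B = q}" "vd.chain_diff w = 0"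
      "\<not> (\<exists>w'. Poly_Mapping.keys w' \<subseteq> vd.configs \<and> w = vd.chain_diff w')" for w q
  proof -
    have "q = card ?K \<and> (\<exists>w'. Poly_Mapping.keys w' \<subseteq> vd.configs \<and> w + ?S (g ` ?K) = vd.chain_diff w')"
      by (rule vd.cycle_doubled[OF dbl g w(1,2)]) (use w(3) in blast)+
    then obtain w' where w': "q = card ?K" "Poly_Mapping.keys w' \<subseteq> vd.configs" "w + ?S (g ` ?K) = vd.chain_diff w'" by blast
    have "Poly_Mapping.keys (w + ?S (g ` ?K)) \<subseteq> vd.configs" unfolding w'(3) by (rule vd.keys_chain_diff[OF w'(2)])
    then have "vd.realize (w + ?S (g ` ?K)) \<in> boundaries Z" using vd.boundary_iff w'(2,3) by blast
    then show ?thesis using w'(1) unfolding hclass_eq_iff vd.realize_add by simp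
  qed
  note cc = gen[OF vr cyc nb, folded v(2)]
  have "v \<noteq> 0"
  proof
    assume "v = 0"
    then have "Poly_Mapping.keys (0 :: 'i pt set \<Rightarrow>\<^sub>0 bit) \<subseteq> vd.configs \<and> v = vd.chain_diff 0" by (simp add: vd.chain_diff_def)
    then show False using nb by blast
  qed
  then obtain B where B: "B \<in> Poly_Mapping.keys v" by (metis ex_in_conv keys_eq_empty)
  then have "card B = card ?K" using vr cc by blast
  then show m: "?m = n - 2" using cardB[OF B] by simp
  have "P \<notin> twisted_pairs Z M" if "P \<in> pairs Z" for P
    using pt(1)[OF that] dbl unfolding vd.doubled_iff by blast
  then show "pairs Z - critical_pairs Z M \<subseteq> tight_pairs Z M" using pt(2) by blast
  show "{hclass Z D | D. tight_diag Z D \<and> hdata_of Z D = tensor_hdata Z M} = {hclass Z c}"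
  proof (intro equalityI subsetI)
    fix y assume "y \<in> {hclass Z D | D. tight_diag Z D \<and> hdata_of Z D = tensor_hdata Z M}"
    then obtain E where E: "y = hclass Z E" "tight_diag Z E" "hdata_of Z E = (H n, s 0, s n)"
      unfolding tensor_hdata_eq by blast
    then have Ed: "E \<in> diagrams Z" "hclass Z E \<noteq> hclass Z 0" unfolding tight_diag_def viable_diag_def by auto
    obtain B where B: "B \<in> vd.configs" "E = ?Dg B" by (rule vd.diagram_with_data[OF Ed(1) E(3)])
    have BK: "lab Z ` B = ?K" using vd.Dg_types(2)[OF B(1)] E(2) B(2) by blast
    have sB: "Poly_Mapping.keys (?S B) \<subseteq> {C \<in> vd.configs. card C = card B}" using B(1) by simp
    have "hclass Z (vd.realize (?S B)) = hclass Z (?Dg (g ` ?K)) \<and> card B = card ?K"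
    proof (rule gen[OF sB])
      show "vd.chain_diff (?S B) = 0" using vd.chain_diff_single_eq_0[OF B(1)] BK by blast
      show "\<not> (\<exists>w'. Poly_Mapping.keys w' \<subseteq> vd.configs \<and> ?S B = vd.chain_diff w')"
        using Ed(2) hclass_eq_iff[of Z E 0] vd.boundary_iff[OF vd.single_configs[OF B(1)]] B(2) by simp
    qed
    then show "y \<in> {hclass Z c}" using cc E(1) B(2) by simp
  next
    fix y assume "y \<in> {hclass Z c}"
    then have y: "y = hclass Z (?Dg (g ` ?K))" using cc by simp
    have "tight_diag Z (?Dg (g ` ?K))" using vd.Dg_types(2)[OF gK(1)] gK(2) dbl by blast
    then show "y \<in> {hclass Z D | D. tight_diag Z D \<and> hdata_of Z D = tensor_hdata Z M}"
      unfolding y tensor_hdata_eq using vd.Dg_configs(2)[OF gK(1)] by blast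
  qed
qed

end

lemma arc_diagram_pre: "arc_diagram Z \<Longrightarrow> pre_arc_diagram Z"
  unfolding arc_diagram_def pre_arc_diagram_def by blast

lemma diag_classes_homology: "diag_classes Z \<subseteq> homology Z"
  unfolding diag_classes_def homology_def cycles_def strand_algebra_def using lin_span_base by blast

theorem theorem1p2:
  fixes Z :: "'i arc_diagram"
    and ord :: "'i pair_order"
    and X :: "'i elt set list \<Rightarrow> 'i elt set"
    and f :: "'i elt set list \<Rightarrow> 'i elt"
    and M :: "'i elt set list"
    and n :: nat
  assumes "arc_diagram Z" and "pair_ordering Z ord" and "arises_from Z ord X f"
    and "M \<in> lists (diag_classes Z)" and "length M = n" and "n \<ge> 1"
  shows
    "(n \<ge> 2 \<and> bar Z (f M) \<noteq> bar Z 0 \<longrightarrow>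
       viable_tensor Z M \<and>
       (\<exists>l m. card (twisted_pairs Z M) = l \<and> card (critical_pairs Z M) = m \<and>
          l + m \<ge> n - 1 \<and> m \<le> n - 2 \<and>
          pairs Z - (twisted_pairs Z M \<union> critical_pairs Z M) \<subseteq> tight_pairs Z M \<and>
          (\<exists>\<D>. finite \<D> \<and> \<D> \<subseteq> {D. viable_diag Z D} \<and> bar Z (f M) = bar Z (\<Sum>D \<in> \<D>. D) \<and>
             (\<forall>D \<in> \<D>.
                (\<forall>P \<in> critical_pairs Z M \<union> tight_pairs Z M. tight_at Z P D) \<and>
                card {P \<in> pairs Z. crossed_at Z P D} = n - 1 - m \<and>
                card {P \<in> pairs Z. twisted_at Z P D} = l + m + 1 - n)))) \<and>
     (X M \<noteq> hclass Z 0 \<longrightarrow>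
       viable_tensor Z M \<and>
       n \<ge> 2 \<and> card (critical_pairs Z M) = n - 2 \<and>
       pairs Z - critical_pairs Z M \<subseteq> tight_pairs Z M \<and>
       {hclass Z D | D. tight_diag Z D \<and> hdata_of Z D = tensor_hdata Z M} = {X M})"
proof -
  have M: "M \<noteq> []" "M \<in> lists (homology Z)" "length M = n"
    using assms(4-6) diag_classes_homology[of Z] by auto
  note ar = assms(3)[unfolded arises_from_def]
  have fM: "\<partial> (f M) = f [X M] - U_op X f M"
    using mp[OF bspec[OF conjunct2[OF ar[THEN conjunct2, THEN conjunct1, unfolded A_infinity_morphism_def]] M(2)] M(1)] .
  \<comment> \<open>In arity 1 the operation vanishes, which is where \<open>n \<ge> 2\<close> in
    the second part comes from.\<close>
  have X1: "X M = hclass Z 0" if n1: "n = 1"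
  proof -
    obtain C where "M = [C]" using M(3) n1 by (auto simp: length_Suc_conv)
    then show ?thesis using bspec[OF ar[THEN conjunct2, THEN conjunct2, THEN conjunct1], of C] M(2) by simp
  qed
  have props: "(\<not> viable_tensor Z M \<longrightarrow> bar Z (f M) = bar Z 0 \<and> X M = hclass Z 0) \<and>
      f M \<in> alg_summand Z (tensor_hdata Z M) \<and>
      homogeneous Z (tensor_maslov Z M + of_nat (length M) - 1) (f M) \<and>
      (\<exists>c \<in> alg_summand Z (tensor_hdata Z M). \<partial> c = 0 \<and>
           homogeneous Z (tensor_maslov Z M + of_nat (length M) - 2) c \<and> X M = hclass Z c) \<and>
      (2 \<le> length M \<and> f [X M] - U_op X f M = 0 \<longrightarrow> f M = 0)"
    using mp[OF bspec[OF ar[THEN conjunct2, THEN conjunct2, THEN conjunct2, THEN conjunct2, THEN conjunct2, THEN conjunct2] assms(4)] M(1)]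
    by (elim conjE, intro conjI)
  show ?thesis
  proof (cases "viable_tensor Z M")
    case False
    \<comment> \<open>Both premises fail: off the viable tensors \<open>bar Z (f M)\<close> and
      \<open>X M\<close> are zero.\<close>
    then show ?thesis using props by blast
  next
    case True
    interpret pre_arc_diagram Z by (rule arc_diagram_pre[OF assms(1)])
    interpret T: tensor Z M by unfold_locales (use assms(4) M(1) True in auto)
    have 1: "viable_tensor Z M \<and>
       (\<exists>l m. card (twisted_pairs Z M) = l \<and> card (critical_pairs Z M) = m \<and>
          l + m \<ge> n - 1 \<and> m \<le> n - 2 \<and>
          pairs Z - (twisted_pairs Z M \<union> critical_pairs Z M) \<subseteq> tight_pairs Z M \<and>
          (\<exists>\<D>. finite \<D> \<and> \<D> \<subseteq> {D. viable_diag Z D} \<and> bar Z (f M) = bar Z (\<Sum>D \<in> \<D>. D) \<and>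
             (\<forall>D \<in> \<D>.
                (\<forall>P \<in> critical_pairs Z M \<union> tight_pairs Z M. tight_at Z P D) \<and>
                card {P \<in> pairs Z. crossed_at Z P D} = n - 1 - m \<and>
                card {P \<in> pairs Z. twisted_at Z P D} = l + m + 1 - n)))"
      if a: "n \<ge> 2" "bar Z (f M) \<noteq> bar Z 0"
    proof -
      \<comment> \<open>The morphism relation \<open>fM\<close> identifies the boundary with
        \<open>f [X M] - U_op X f M\<close>, and \<open>arises_from\<close> sets \<open>f M\<close>
        to zero when that vanishes.\<close>
      have "\<partial> (f M) = 0 \<Longrightarrow> f M = 0" using fM props a(1) M(3) by simp
      from T.morphism_value[OF _ _ this a(2)] props a(1) True show ?thesis unfolding M(3) by blast
    qed
    have 2: "viable_tensor Z M \<and>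
       n \<ge> 2 \<and> card (critical_pairs Z M) = n - 2 \<and>
       pairs Z - critical_pairs Z M \<subseteq> tight_pairs Z M \<and>
       {hclass Z D | D. tight_diag Z D \<and> hdata_of Z D = tensor_hdata Z M} = {X M}"
      if a: "X M \<noteq> hclass Z 0"
    proof -
      have n2: "n \<ge> 2" using X1 a assms(6) by linarith
      obtain c where c: "c \<in> alg_summand Z (tensor_hdata Z M)" "\<partial> c = 0"
        "homogeneous Z (tensor_maslov Z M + of_nat (length M) - 2) c" "X M = hclass Z c" using props by blast
      show ?thesis
        using T.product_value[OF c(1-3)] a n2 True unfolding c(4) M(3) by blast
    qed
    from 1 2 show ?thesis by blast
  qed
qed

end
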